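(* Let $a,b>-1$ and $s\in\mathbb R$. The spaces $H^s_{(a,b)}(\mathrm I)$ and $H^s_{\rho^{(a,b)}}(\mathrm I)$ coincide, and their corresponding norms are equivalent.
   Context: $\mathrm I=(0,1)$, $\mathbb N_0=\mathbb N\cup\{0\}$, $\rho^{(a,b)}(x)=(1-x)^ax^b$, and $\|f\|_{\omega}=\big(\int_0^1\omega f^2dx\big)^{1/2}$, $L^2_\omega(\mathrm I)=\{f:\|f\|_\omega<\infty\}$ for a positive weight $\omega$. Interpolation definition. For $n\in\mathbb N_0$, $H^n_{\rho^{(a,b)}}(\mathrm I)=\{v:\ \|v\|_{n,\rho^{(a,b)}}^2:=\sum_{j=0}^n\|D^jv\|^2_{\rho^{(a+j,b+j)}}<\infty\}$, with $D^j$ the $j$-th derivative. For non-integer $s>0$, $H^s_{\rho^{(a,b)}}(\mathrm I)$ is defined by the $K$-method of interpolation: for integers $0\le m<s<n$ and $\theta$ with $s=(1-\theta)m+\theta n$, $$K(t,u)=\inf_{v\in H^n_{\rho^{(a,b)}}}\left(\|u-v\|_{m,\rho^{(a,b)}}+t\,\|v\|_{n,\rho^{(a,b)}}\right),\qquad \|u\|_{s,\rho^{(a,b)}}=\left(\int_0^\infty t^{-2\theta}K(t,u)^2\frac{dt}{t}\right)^{1/2}$$ (the paper works with $m=n-1$). For $s<0$ the space is defined by (weighted) $L^2_{\rho^{(a,b)}}$ duality. Jacobi-coefficient definition. Let $G_j^{(a,b)}(x)=P_j^{(a,b)}(2x-1)$, where $P_j^{(a,b)}$ is the Jacobi polynomial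 on $(-1,1)$ (orthogonal for the weight $(1-t)^a(1+t)^b$), $\widetilde G_j^{(a,b)}=G_j^{(a,b)}/\|G_j^{(a,b)}\|_{\rho^{(a,b)}}$, and $v_j=\int_0^1\rho^{(a,b)}v\,\widetilde G_j^{(a,b)}dx$. For $s\ge0$, $H^s_{(a,b)}(\mathrm I)=\{v\in L^2_{\rho^{(a,b)}}(\mathrm I):\ \|v\|_{s,(a,b)}^2:=\sum_{j\ge0}(1+j^2)^sv_j^2<\infty\}$. For $s>0$, $H^{-s}_{(a,b)}(\mathrm I)$ is the space of bounded linear functionals on $H^s_{(a,b)}(\mathrm I)$. *)

theory Defs
  imports "HOL-Analysis.Analysis"
begin

text \<open>
  Elements of the function spaces are real functions that are Lebesgue measurable on the unit
  interval. As usual, functions equal almost everywhere there are to be identified; instead of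
  passing to a quotient, every space below is a set of functions closed under this identification
  and every norm is the corresponding seminorm, which does not distinguish identified functions.
\<close>

abbreviation unit_ivl :: "real set" where
  "unit_ivl \<equiv> {0<..<1}"

definition rho :: "real \<Rightarrow> real \<Rightarrow> real \<Rightarrow> real" where
  "rho a b x = (1 - x) powr a * x powr b"

definition weighted_L2 :: "(real \<Rightarrow> real) \<Rightarrow> (real \<Rightarrow> real) set" where
  "weighted_L2 w = {f. f \<in> borel_measurable (lebesgue_on unit_ivl) \<and>
     set_integrable lebesgue unit_ivl (\<lambda>x. w x * (f x)\<^sup>2)}"

definition weighted_norm :: "(real \<Rightarrow> real) \<Rightarrow> (real \<Rightarrow> real) \<Rightarrow> real" where
  "weighted_norm w f = sqrt (LINT x:unit_ivl|lebesgue. w x * (f x)\<^sup>2)"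

definition norms_equivalent_on :: "'a set \<Rightarrow> ('a \<Rightarrow> real) \<Rightarrow> ('a \<Rightarrow> real) \<Rightarrow> bool" where
  "norms_equivalent_on V N1 N2 \<longleftrightarrow>
     (\<exists>c>0. \<exists>C>0. \<forall>u\<in>V. c * N1 u \<le> N2 u \<and> N2 u \<le> C * N1 u)"


section \<open>Duality\<close>

text \<open>
  Functionals on \<open>V\<close> are made extensional, so that a functional is determined by its values on
  \<open>V\<close>. Boundedness with respect to the seminorm \<open>N\<close> forces a functional to respect equality almost
  everywhere. For \<open>V\<close> contained in the weighted \<open>L\<^sup>2\<close> space, a function \<open>f\<close> of the latter
  is regarded as the functional sending \<open>u\<close> to the weighted integral of \<open>f u\<close>.
\<close>

definition dual_space ::
  "(real \<Rightarrow> real) set \<Rightarrow> ((real \<Rightarrow> real) \<Rightarrow> real) \<Rightarrow> ((real \<Rightarrow> real) \<Rightarrow> real) set" where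
  "dual_space V N = {F \<in> extensional V.
     (\<forall>u\<in>V. \<forall>v\<in>V. F (\<lambda>x. u x + v x) = F u + F v) \<and>
     (\<forall>c. \<forall>u\<in>V. F (\<lambda>x. c * u x) = c * F u) \<and>
     (\<exists>C. \<forall>u\<in>V. \<bar>F u\<bar> \<le> C * N u)}"

definition dual_norm ::
  "(real \<Rightarrow> real) set \<Rightarrow> ((real \<Rightarrow> real) \<Rightarrow> real) \<Rightarrow> ((real \<Rightarrow> real) \<Rightarrow> real) \<Rightarrow> real" where
  "dual_norm V N F = (SUP u\<in>{u \<in> V. N u \<le> 1}. \<bar>F u\<bar>)"


section \<open>Weighted Sobolev spaces and interpolation\<close>

definition test_function :: "(real \<Rightarrow> real) \<Rightarrow> bool" where
  "test_function \<phi> \<longleftrightarrow>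
     (\<forall>k x. (deriv ^^ k) \<phi> field_differentiable (at x)) \<and>
     (\<exists>K. compact K \<and> K \<subseteq> unit_ivl \<and> (\<forall>x. x \<notin> K \<longrightarrow> \<phi> x = 0))"

definition locally_integrable :: "(real \<Rightarrow> real) \<Rightarrow> bool" where
  "locally_integrable f \<longleftrightarrow> (\<forall>K. compact K \<and> K \<subseteq> unit_ivl \<longrightarrow> set_integrable lebesgue K f)"

definition has_weak_deriv :: "nat \<Rightarrow> (real \<Rightarrow> real) \<Rightarrow> (real \<Rightarrow> real) \<Rightarrow> bool" where
  "has_weak_deriv j v g \<longleftrightarrow> locally_integrable v \<and> locally_integrable g \<and>
     (\<forall>\<phi>. test_function \<phi> \<longrightarrow>
        (LINT x:unit_ivl|lebesgue. v x * (deriv ^^ j) \<phi> x) =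
        (-1) ^ j * (LINT x:unit_ivl|lebesgue. g x * \<phi> x))"

text \<open>Weak derivatives are unique up to null sets, so the choice below affects neither membership
  in a weighted \<open>L\<^sup>2\<close> space nor the norm.\<close>

definition weak_deriv :: "nat \<Rightarrow> (real \<Rightarrow> real) \<Rightarrow> real \<Rightarrow> real" where
  "weak_deriv j v = (SOME g. has_weak_deriv j v g)"

definition sobolev_space :: "real \<Rightarrow> real \<Rightarrow> nat \<Rightarrow> (real \<Rightarrow> real) set" where
  "sobolev_space a b n = {v. \<forall>j\<le>n. (\<exists>g. has_weak_deriv j v g) \<and>
     weak_deriv j v \<in> weighted_L2 (rho (a + real j) (b + real j))}"

definition sobolev_norm :: "real \<Rightarrow> real \<Rightarrow> nat \<Rightarrow> (real \<Rightarrow> real) \<Rightarrow> real" where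
  "sobolev_norm a b n v =
     sqrt (\<Sum>j\<le>n. (weighted_norm (rho (a + real j) (b + real j)) (weak_deriv j v))\<^sup>2)"

definition K_functional ::
  "real \<Rightarrow> real \<Rightarrow> nat \<Rightarrow> nat \<Rightarrow> real \<Rightarrow> (real \<Rightarrow> real) \<Rightarrow> real" where
  "K_functional a b m n t u =
     (INF v\<in>sobolev_space a b n.
        sobolev_norm a b m (\<lambda>x. u x - v x) + t * sobolev_norm a b n v)"

text \<open>For \<open>m < n\<close>, the infimum in \<^const>\<open>K_functional\<close> is over finite values precisely when
  \<open>u\<close> lies in the space of order \<open>m\<close>, whence the restriction to that space below. The exponent
  \<open>\<theta>\<close> is determined by \<open>s = (1 - \<theta>) m + \<theta> n\<close>.\<close>

definition interp_exponent :: "nat \<Rightarrow> nat \<Rightarrow> real \<Rightarrow> real" where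
  "interp_exponent m n s = (s - real m) / (real n - real m)"

definition interp_space ::
  "real \<Rightarrow> real \<Rightarrow> nat \<Rightarrow> nat \<Rightarrow> real \<Rightarrow> (real \<Rightarrow> real) set" where
  "interp_space a b m n s = {u \<in> sobolev_space a b m.
     set_integrable lebesgue {0<..}
       (\<lambda>t. t powr (- 2 * interp_exponent m n s) * (K_functional a b m n t u)\<^sup>2 / t)}"

definition interp_norm ::
  "real \<Rightarrow> real \<Rightarrow> nat \<Rightarrow> nat \<Rightarrow> real \<Rightarrow> (real \<Rightarrow> real) \<Rightarrow> real" where
  "interp_norm a b m n s u =
     sqrt (LINT t:{0<..}|lebesgue.
       t powr (- 2 * interp_exponent m n s) * (K_functional a b m n t u)\<^sup>2 / t)"

text \<open>In the following definitions for \<open>s \<ge> 0\<close>, the endpoints \<open>m < s < n\<close> of the interpolation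
  are only relevant for non-integer \<open>s\<close>.\<close>

definition H_rho_space ::
  "real \<Rightarrow> real \<Rightarrow> nat \<Rightarrow> nat \<Rightarrow> real \<Rightarrow> (real \<Rightarrow> real) set" where
  "H_rho_space a b m n s =
     (if s \<in> \<int> then sobolev_space a b (nat \<lfloor>s\<rfloor>) else interp_space a b m n s)"

definition H_rho_norm ::
  "real \<Rightarrow> real \<Rightarrow> nat \<Rightarrow> nat \<Rightarrow> real \<Rightarrow> (real \<Rightarrow> real) \<Rightarrow> real" where
  "H_rho_norm a b m n s =
     (if s \<in> \<int> then sobolev_norm a b (nat \<lfloor>s\<rfloor>) else interp_norm a b m n s)"

text \<open>The space of order \<open>- r\<close>, for \<open>r > 0\<close>.\<close>

definition H_rho_neg_space ::
  "real \<Rightarrow> real \<Rightarrow> nat \<Rightarrow> nat \<Rightarrow> real \<Rightarrow> ((real \<Rightarrow> real) \<Rightarrow> real) set" where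
  "H_rho_neg_space a b m n r = dual_space (H_rho_space a b m n r) (H_rho_norm a b m n r)"

definition H_rho_neg_norm ::
  "real \<Rightarrow> real \<Rightarrow> nat \<Rightarrow> nat \<Rightarrow> real \<Rightarrow> ((real \<Rightarrow> real) \<Rightarrow> real) \<Rightarrow> real" where
  "H_rho_neg_norm a b m n r = dual_norm (H_rho_space a b m n r) (H_rho_norm a b m n r)"


section \<open>Spaces defined by Jacobi coefficients\<close>

text \<open>The classical explicit formula for the Jacobi polynomial of degree \<open>j\<close> on \<open>(-1,1)\<close>,
  which is orthogonal with respect to the weight \<open>(1 - t)\<^sup>a (1 + t)\<^sup>b\<close> and has the value
  \<open>(j + a) gchoose j\<close> at \<open>1\<close>.\<close>

definition jacobi_P :: "real \<Rightarrow> real \<Rightarrow> nat \<Rightarrow> real \<Rightarrow> real" where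
  "jacobi_P a b j t =
     (\<Sum>k\<le>j. ((real j + a) gchoose (j - k)) * ((real j + b) gchoose k) *
        ((t - 1) / 2) ^ k * ((t + 1) / 2) ^ (j - k))"

definition jacobi_G :: "real \<Rightarrow> real \<Rightarrow> nat \<Rightarrow> real \<Rightarrow> real" where
  "jacobi_G a b j x = jacobi_P a b j (2 * x - 1)"

definition jacobi_G_normalized :: "real \<Rightarrow> real \<Rightarrow> nat \<Rightarrow> real \<Rightarrow> real" where
  "jacobi_G_normalized a b j x = jacobi_G a b j x / weighted_norm (rho a b) (jacobi_G a b j)"

definition jacobi_coeff :: "real \<Rightarrow> real \<Rightarrow> (real \<Rightarrow> real) \<Rightarrow> nat \<Rightarrow> real" where
  "jacobi_coeff a b v j =
     (LINT x:unit_ivl|lebesgue. rho a b x * v x * jacobi_G_normalized a b j x)"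

definition H_jacobi_space :: "real \<Rightarrow> real \<Rightarrow> real \<Rightarrow> (real \<Rightarrow> real) set" where
  "H_jacobi_space a b s = {v \<in> weighted_L2 (rho a b).
     summable (\<lambda>j. (1 + (real j)\<^sup>2) powr s * (jacobi_coeff a b v j)\<^sup>2)}"

definition H_jacobi_norm :: "real \<Rightarrow> real \<Rightarrow> real \<Rightarrow> (real \<Rightarrow> real) \<Rightarrow> real" where
  "H_jacobi_norm a b s v = sqrt (\<Sum>j. (1 + (real j)\<^sup>2) powr s * (jacobi_coeff a b v j)\<^sup>2)"

text \<open>Again the space of order \<open>- r\<close>, for \<open>r > 0\<close>.\<close>

definition H_jacobi_neg_space :: "real \<Rightarrow> real \<Rightarrow> real \<Rightarrow> ((real \<Rightarrow> real) \<Rightarrow> real) set" where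
  "H_jacobi_neg_space a b r = dual_space (H_jacobi_space a b r) (H_jacobi_norm a b r)"

definition H_jacobi_neg_norm ::
  "real \<Rightarrow> real \<Rightarrow> real \<Rightarrow> ((real \<Rightarrow> real) \<Rightarrow> real) \<Rightarrow> real" where
  "H_jacobi_neg_norm a b r = dual_norm (H_jacobi_space a b r) (H_jacobi_norm a b r)"

end

theory Submission
  imports Defs
begin

text \<open>
  Both scales of spaces are described by one and the same condition on the coefficients \<open>c\<^sub>j\<close> of a
  function in the orthonormal basis of Jacobi polynomials of \<open>L\<^sup>2\<close> with weight \<open>\<rho>\<^bsub>a,b\<^esub> = (1 - x)\<^sup>a x\<^sup>b\<close>.

  \<^emph>\<open>Integer order.\<close> The derivative of the Jacobi polynomial of degree \<open>j\<close> for \<open>(a, b)\<close> is a multiple of the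
  one of degree \<open>j - 1\<close> for \<open>(a + 1, b + 1)\<close>, and the adjoint relation, one step of Rodrigues' formula,
  holds as well. After normalization, differentiation therefore maps \<open>L\<^sup>2\<close> for \<open>(a, b)\<close> to \<open>L\<^sup>2\<close> for
  \<open>(a + 1, b + 1)\<close> as a weighted shift of coefficients, with factors \<open>sqrt (j (j + a + b + 1))\<close>.
  This is exactly why the exponents of the weights grow with the order of the derivative in
  \<^const>\<open>sobolev_norm\<close>. Iterating, the \<open>i\<close>-th derivative has squared norm \<open>\<Sum>\<^sub>j w\<^sub>i(j) c\<^sub>j\<^sup>2\<close> with \<open>w\<^sub>i(j)\<close> of
  the size of \<open>j\<^sup>2\<^sup>i\<close>, and \<open>sobolev_space_eq_jacobi\<close> and \<open>sobolev_norm_equivalent\<close> follow. Two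
  points need care since derivatives are weak. A weak derivative has to be tested with \<open>\<rho>\<^bsub>a+1,b+1\<^esub>\<close> times
  a polynomial, which has no compact support; cutoffs whose derivatives are controlled by the additional
  factor \<open>x (1 - x)\<close> of the weight achieve this (\<open>weak_deriv_weighted_by_parts\<close>). Conversely,
  the series that ought to be the derivative must be shown to be one (\<open>weak_deriv_exists\<close>); this is
  Parseval's identity in both \<open>L\<^sup>2\<close> spaces. Orthogonality and completeness of the Jacobi
  polynomials are proved along the way (\<open>jacobi_orthonormal_basis\<close>).

  \<^emph>\<open>Fractional order.\<close> By the integer case the K-functional is, up to constants, that of a pair
  of weighted \<open>\<ell>\<^sup>2\<close> spaces, whose square is \<open>\<Sum>\<^sub>j (1 + j\<^sup>2)\<^sup>m min(1, t\<^sup>2 (1 + j\<^sup>2)\<^sup>n\<^sup>-\<^sup>m) c\<^sub>j\<^sup>2\<close>. Integrating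
  over \<open>t\<close> term by term yields a multiple of \<open>\<Sum>\<^sub>j (1 + j\<^sup>2)\<^sup>s c\<^sub>j\<^sup>2\<close> (\<open>interp_space_eq_jacobi\<close>).

  \<^emph>\<open>Negative order.\<close> Equal spaces with equivalent norms have the same bounded functionals, with
  equivalent dual norms.
\<close>

section \<open>Square-integrable functions\<close>

definition sq_integrable :: "'a measure \<Rightarrow> ('a \<Rightarrow> real) \<Rightarrow> bool" where
  "sq_integrable M f \<longleftrightarrow> f \<in> borel_measurable M \<and> integrable M (\<lambda>x. (f x)\<^sup>2)"

definition inner_L2 :: "'a measure \<Rightarrow> ('a \<Rightarrow> real) \<Rightarrow> ('a \<Rightarrow> real) \<Rightarrow> real" where
  "inner_L2 M f g = (LINT x|M. f x * g x)"

abbreviation dist_sq_L2 :: "'a measure \<Rightarrow> ('a \<Rightarrow> real) \<Rightarrow> ('a \<Rightarrow> real) \<Rightarrow> real" where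
  "dist_sq_L2 M f g \<equiv> inner_L2 M (\<lambda>x. f x - g x) (\<lambda>x. f x - g x)"

lemma sq_integrable_measurable [measurable_dest]:
  "sq_integrable M f \<Longrightarrow> f \<in> borel_measurable M"
  by (simp add: sq_integrable_def)

lemma sq_integrable_mult:
  assumes "sq_integrable M f" "sq_integrable M g"
  shows "integrable M (\<lambda>x. f x * g x)"
proof (rule Bochner_Integration.integrable_bound)
  show "integrable M (\<lambda>x. (f x)\<^sup>2 + (g x)\<^sup>2)"
    using assms by (auto simp: sq_integrable_def)
  show "(\<lambda>x. f x * g x) \<in> borel_measurable M"
    using assms by (auto simp: sq_integrable_def)
  have "\<bar>y * z\<bar> \<le> y\<^sup>2 + z\<^sup>2" for y z :: real
  proof -
    have "0 \<le> (\<bar>y\<bar> - \<bar>z\<bar>)\<^sup>2" by simp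
    then have "2 * (\<bar>y\<bar> * \<bar>z\<bar>) \<le> y\<^sup>2 + z\<^sup>2" by (simp add: power2_diff)
    moreover have "0 \<le> \<bar>y\<bar> * \<bar>z\<bar>" by simp
    ultimately show ?thesis unfolding abs_mult by linarith
  qed
  then show "AE x in M. norm (f x * g x) \<le> norm ((f x)\<^sup>2 + (g x)\<^sup>2)" by simp
qed

lemma sq_integrable_cmult [intro]:
  "sq_integrable M f \<Longrightarrow> sq_integrable M (\<lambda>x. c * f x)"
  by (auto simp: sq_integrable_def power_mult_distrib)

lemma sq_integrable_add [intro]:
  assumes "sq_integrable M f" "sq_integrable M g"
  shows "sq_integrable M (\<lambda>x. f x + g x)"
  using assms sq_integrable_mult[OF assms]
  by (auto simp: sq_integrable_def power2_sum mult.assoc)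

lemma sq_integrable_diff [intro]:
  assumes "sq_integrable M f" "sq_integrable M g"
  shows "sq_integrable M (\<lambda>x. f x - g x)"
  using sq_integrable_add[OF assms(1) sq_integrable_cmult[OF assms(2), of "-1"]] by simp

lemma sq_integrable_sum [intro]:
  "(\<And>i. i \<in> I \<Longrightarrow> sq_integrable M (f i)) \<Longrightarrow> sq_integrable M (\<lambda>x. \<Sum>i\<in>I. f i x)"
proof (induction I rule: infinite_finite_induct)
  case (insert i I)
  then show ?case using sq_integrable_add[of M "f i" "\<lambda>x. \<Sum>i\<in>I. f i x"] by simp
qed (auto simp: sq_integrable_def)

lemma sq_integrable_bounded:
  assumes "finite_measure M" "f \<in> borel_measurable M" "\<And>x. x \<in> space M \<Longrightarrow> \<bar>f x\<bar> \<le> B"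
  shows "sq_integrable M f"
  unfolding sq_integrable_def
proof
  interpret finite_measure M by fact
  show "integrable M (\<lambda>x. (f x)\<^sup>2)"
  proof (rule integrable_const_bound)
    show "AE x in M. norm ((f x)\<^sup>2) \<le> B\<^sup>2"
      by (intro AE_I2) (use assms(3) power_mono[of "\<bar>f _\<bar>" B 2] in auto)
  qed (use assms(2) in measurable)
qed fact

lemma inner_L2_commute: "inner_L2 M f g = inner_L2 M g f"
  by (simp add: inner_L2_def mult.commute)

lemma inner_L2_cmult: "inner_L2 M (\<lambda>x. c * f x) g = c * inner_L2 M f g"
  by (simp add: inner_L2_def mult.assoc)

lemma inner_L2_add:
  assumes "sq_integrable M f" "sq_integrable M g" "sq_integrable M h"
  shows "inner_L2 M (\<lambda>x. f x + g x) h = inner_L2 M f h + inner_L2 M g h"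
  using sq_integrable_mult[OF assms(1,3)] sq_integrable_mult[OF assms(2,3)]
  by (simp add: inner_L2_def distrib_right)

lemma inner_L2_diff:
  assumes "sq_integrable M f" "sq_integrable M g" "sq_integrable M h"
  shows "inner_L2 M (\<lambda>x. f x - g x) h = inner_L2 M f h - inner_L2 M g h"
  using sq_integrable_mult[OF assms(1,3)] sq_integrable_mult[OF assms(2,3)]
  by (simp add: inner_L2_def left_diff_distrib)

lemma inner_L2_diff_right:
  assumes "sq_integrable M f" "sq_integrable M g" "sq_integrable M h"
  shows "inner_L2 M h (\<lambda>x. f x - g x) = inner_L2 M h f - inner_L2 M h g"
  using inner_L2_diff[OF assms] by (simp add: inner_L2_commute[of M h])

lemma inner_L2_sum:
  assumes "\<And>i. i \<in> I \<Longrightarrow> sq_integrable M (f i)" "sq_integrable M h"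
  shows "inner_L2 M (\<lambda>x. \<Sum>i\<in>I. f i x) h = (\<Sum>i\<in>I. inner_L2 M (f i) h)"
  using sq_integrable_mult[OF assms]
  by (simp add: inner_L2_def sum_distrib_right)

lemma inner_L2_self_nonneg: "0 \<le> inner_L2 M f f"
  by (simp add: inner_L2_def)

lemma inner_L2_cong_AE:
  assumes "f \<in> borel_measurable M" "f' \<in> borel_measurable M" "g \<in> borel_measurable M"
    and "AE x in M. f x = f' x"
  shows "inner_L2 M f g = inner_L2 M f' g"
  unfolding inner_L2_def
  by (rule integral_cong_AE) (use assms in auto)

text \<open>The quadratic polynomial \<open>t \<mapsto> \<parallel>f + t g\<parallel>\<^sup>2\<close> is nonnegative; evaluating it at its minimum gives the claim.\<close>

lemma Cauchy_Schwarz_L2: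
  assumes f: "sq_integrable M f" and g: "sq_integrable M g"
  shows "(inner_L2 M f g)\<^sup>2 \<le> inner_L2 M f f * inner_L2 M g g"
proof -
  let ?A = "inner_L2 M f f" and ?B = "inner_L2 M f g" and ?C = "inner_L2 M g g"
  have quad: "0 \<le> ?A + 2 * t * ?B + t\<^sup>2 * ?C" for t
  proof -
    have "0 \<le> inner_L2 M (\<lambda>x. f x + t * g x) (\<lambda>x. f x + t * g x)"
      by (rule inner_L2_self_nonneg)
    also have "\<dots> = inner_L2 M f (\<lambda>x. f x + t * g x) + t * inner_L2 M g (\<lambda>x. f x + t * g x)"
      using f g by (subst inner_L2_add) (auto simp: inner_L2_cmult)
    also have "\<dots> = ?A + 2 * t * ?B + t\<^sup>2 * ?C"
      using f g by (subst (1 2) inner_L2_commute, subst (1 2) inner_L2_add)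
        (auto simp: inner_L2_cmult power2_eq_square inner_L2_commute[of M g f] algebra_simps)
    finally show ?thesis .
  qed
  show ?thesis
  proof (cases "?C = 0")
    case True
    have "?B = 0"
    proof (rule ccontr)
      assume "?B \<noteq> 0"
      then show False using quad[of "- (?A + 1) / (2 * ?B)"] True by (simp add: field_simps)
    qed
    then show ?thesis using True by simp
  next
    case False
    then have C: "?C > 0" using inner_L2_self_nonneg[of M g] by linarith
    then show ?thesis
      using quad[of "- ?B / ?C"] by (simp add: field_simps power2_eq_square)
  qed
qed

lemma inner_L2_tendsto:
  assumes S: "\<And>n. sq_integrable M (S n)" and f: "sq_integrable M f"
    and g: "sq_integrable M g"
    and lim: "(\<lambda>n. dist_sq_L2 M f (S n)) \<longlonglongrightarrow> 0"
  shows "(\<lambda>n. inner_L2 M (S n) g) \<longlonglongrightarrow> inner_L2 M f g"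
proof -
  have "(\<lambda>n. (inner_L2 M f g - inner_L2 M (S n) g)\<^sup>2) \<longlonglongrightarrow> 0"
  proof (rule tendsto_sandwich[OF _ _ tendsto_const])
    show "\<forall>\<^sub>F n in sequentially. (inner_L2 M f g - inner_L2 M (S n) g)\<^sup>2
        \<le> dist_sq_L2 M f (S n) * inner_L2 M g g"
      using Cauchy_Schwarz_L2[OF sq_integrable_diff[OF f S] g]
      by (auto simp: inner_L2_diff[OF f S g])
    show "(\<lambda>n. dist_sq_L2 M f (S n) * inner_L2 M g g) \<longlonglongrightarrow> 0"
      using tendsto_mult_left_zero[OF lim] by simp
  qed auto
  then have "(\<lambda>n. inner_L2 M f g - inner_L2 M (S n) g) \<longlonglongrightarrow> 0"
    by simp
  then have "(\<lambda>n. inner_L2 M f g - (inner_L2 M f g - inner_L2 M (S n) g)) \<longlonglongrightarrow> inner_L2 M f g - 0"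
    by (intro tendsto_intros)
  then show ?thesis by simp
qed

text \<open>On a finite measure space an \<open>L\<^sup>2\<close> Cauchy sequence is also \<open>L\<^sup>1\<close> Cauchy, so a subsequence converges
  almost everywhere, and Fatou's lemma turns its pointwise limit into an \<open>L\<^sup>2\<close> limit.\<close>

lemma L2_complete:
  assumes M: "finite_measure M" and S: "\<And>n. sq_integrable M (S n)"
    and Cauchy: "\<And>e. e > 0 \<Longrightarrow>
      \<exists>N. \<forall>i\<ge>N. \<forall>j\<ge>N. dist_sq_L2 M (S i) (S j) \<le> e"
  shows "\<exists>f. sq_integrable M f \<and>
    (\<lambda>n. dist_sq_L2 M f (S n)) \<longlonglongrightarrow> 0"
proof -
  interpret finite_measure M by fact
  have S_meas [measurable]: "S n \<in> borel_measurable M" for n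
    using S by (simp add: sq_integrable_def)
  have one: "sq_integrable M (\<lambda>x. 1)" by (simp add: sq_integrable_def)
  have abs_sq: "sq_integrable M (\<lambda>x. \<bar>h x\<bar>)" if "sq_integrable M h" for h
    using that by (auto simp: sq_integrable_def)
  have S_int: "integrable M (S n)" for n
    using sq_integrable_mult[OF S one] by simp
  obtain r where r: "strict_mono r" "AE x in M. Cauchy (\<lambda>i. S (r i) x)"
  proof (rule cauchy_L1_AE_cauchy_subseq[of M S])
    fix e :: real assume "e > 0"
    let ?m = "inner_L2 M (\<lambda>x. 1) (\<lambda>x. 1)"
    have m: "?m \<ge> 0" by (rule inner_L2_self_nonneg)
    \<comment> \<open>Chosen so that the Cauchy-Schwarz inequality against \<open>1\<close> bounds the \<open>L\<^sup>1\<close> distance by \<open>e / 2\<close>.\<close>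
    define e' where "e' = (e/2)\<^sup>2 / (?m + 1)"
    have "e' > 0" using \<open>e > 0\<close> m by (simp add: e'_def)
    with Cauchy obtain N where N: "\<And>i j. i \<ge> N \<Longrightarrow> j \<ge> N \<Longrightarrow>
      dist_sq_L2 M (S i) (S j) \<le> e'" by blast
    have "(LINT x|M. norm (S i x - S j x)) < e" if "i \<ge> N" "j \<ge> N" for i j
    proof -
      have "(LINT x|M. norm (S i x - S j x)) = inner_L2 M (\<lambda>x. \<bar>S i x - S j x\<bar>) (\<lambda>x. 1)"
        by (simp add: inner_L2_def)
      moreover have "(inner_L2 M (\<lambda>x. \<bar>S i x - S j x\<bar>) (\<lambda>x. 1))\<^sup>2
        \<le> dist_sq_L2 M (S i) (S j) * ?m"
        using Cauchy_Schwarz_L2[OF abs_sq[OF sq_integrable_diff[OF S S]] one, of i j]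
        by (simp add: inner_L2_def)
      moreover have "\<dots> \<le> e' * ?m" using N[OF that] m by (intro mult_right_mono)
      moreover have "\<dots> \<le> (e/2)\<^sup>2" using m by (simp add: e'_def field_simps)
      ultimately have "(LINT x|M. norm (S i x - S j x))\<^sup>2 \<le> (e/2)\<^sup>2" by simp
      then have "(LINT x|M. norm (S i x - S j x)) \<le> e/2"
        by (rule power2_le_imp_le) (use \<open>e > 0\<close> in simp)
      then show ?thesis using \<open>e > 0\<close> by linarith
    qed
    then show "\<exists>N. \<forall>i\<ge>N. \<forall>j\<ge>N. (LINT x|M. norm (S i x - S j x)) < e" by blast
  qed (use S_int that in auto)
  define f where "f x = lim (\<lambda>i. S (r i) x)" for x
  have [measurable]: "f \<in> borel_measurable M" unfolding f_def by measurable
  have conv: "AE x in M. (\<lambda>i. S (r i) x) \<longlonglongrightarrow> f x"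
    using r(2) by eventually_elim (auto simp: f_def Cauchy_convergent convergent_LIMSEQ_iff[symmetric])
  \<comment> \<open>Fatou's lemma along the almost everywhere convergent subsequence.\<close>
  have fatou: "(\<integral>\<^sup>+x. ennreal ((f x - S n x)\<^sup>2) \<partial>M) \<le> ennreal e"
    if "e > 0" and N: "\<And>i. i \<ge> N \<Longrightarrow> dist_sq_L2 M (S i) (S n) \<le> e" for e n N
  proof -
    have "(\<integral>\<^sup>+x. ennreal ((f x - S n x)\<^sup>2) \<partial>M)
        = (\<integral>\<^sup>+x. liminf (\<lambda>i. ennreal ((S (r i) x - S n x)\<^sup>2)) \<partial>M)"
    proof (rule nn_integral_cong_AE)
      show "AE x in M. ennreal ((f x - S n x)\<^sup>2) = liminf (\<lambda>i. ennreal ((S (r i) x - S n x)\<^sup>2))"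
        using conv
      proof eventually_elim
        case (elim x)
        have "(\<lambda>i. ennreal ((S (r i) x - S n x)\<^sup>2)) \<longlonglongrightarrow> ennreal ((f x - S n x)\<^sup>2)"
          by (intro tendsto_intros tendsto_ennrealI elim)
        then show ?case by (rule lim_imp_Liminf[OF trivial_limit_sequentially, symmetric])
      qed
    qed
    also have "\<dots> \<le> liminf (\<lambda>i. \<integral>\<^sup>+x. ennreal ((S (r i) x - S n x)\<^sup>2) \<partial>M)"
      by (rule nn_integral_liminf) measurable
    also have "\<dots> \<le> ennreal e"
    proof (rule Liminf_le)
      show "sequentially \<noteq> bot" by simp
      have "(\<integral>\<^sup>+x. ennreal ((S (r i) x - S n x)\<^sup>2) \<partial>M) \<le> ennreal e" if "i \<ge> N" for i
      proof -
        have "r i \<ge> N" using that seq_suble[OF r(1), of i] by linarith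
        moreover have "(\<integral>\<^sup>+x. ennreal ((S (r i) x - S n x)\<^sup>2) \<partial>M)
          = ennreal (LINT x|M. (S (r i) x - S n x)\<^sup>2)"
          using sq_integrable_diff[OF S S, of "r i" n]
          by (intro nn_integral_eq_integral) (auto simp: sq_integrable_def)
        ultimately show ?thesis
          using N[of "r i"] by (auto simp: inner_L2_def power2_eq_square intro: ennreal_leI)
      qed
      then show "\<forall>\<^sub>F i in sequentially. (\<integral>\<^sup>+x. ennreal ((S (r i) x - S n x)\<^sup>2) \<partial>M) \<le> ennreal e"
        by (auto simp: eventually_sequentially)
    qed
    finally show ?thesis .
  qed
  have diff_sq: "sq_integrable M (\<lambda>x. f x - S n x)" if "\<And>i. i \<ge> N \<Longrightarrow>
      dist_sq_L2 M (S i) (S n) \<le> e" "e > 0" for n N e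
    unfolding sq_integrable_def
  proof
    show "integrable M (\<lambda>x. (f x - S n x)\<^sup>2)"
      using fatou[OF that(2) that(1), of N] by (intro integrableI_bounded) (auto simp: le_less_trans)
  qed measurable
  obtain N1 where N1: "\<And>i j. i \<ge> N1 \<Longrightarrow> j \<ge> N1 \<Longrightarrow>
      dist_sq_L2 M (S i) (S j) \<le> 1"
    using Cauchy[of 1] by auto
  have "sq_integrable M (\<lambda>x. (f x - S N1 x) + S N1 x)"
    using diff_sq[of N1 N1 1] N1 S by (intro sq_integrable_add) auto
  then have f: "sq_integrable M f" by simp
  moreover have "(\<lambda>n. dist_sq_L2 M f (S n)) \<longlonglongrightarrow> 0"
  proof (rule LIMSEQ_I)
    fix e :: real assume "e > 0"
    then obtain N where N: "\<And>i j. i \<ge> N \<Longrightarrow> j \<ge> N \<Longrightarrow>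
      dist_sq_L2 M (S i) (S j) \<le> e/2"
      using Cauchy[of "e/2"] by auto
    have "dist_sq_L2 M f (S n) \<le> e/2" if "n \<ge> N" for n
    proof -
      have "ennreal (LINT x|M. (f x - S n x)\<^sup>2) = (\<integral>\<^sup>+x. ennreal ((f x - S n x)\<^sup>2) \<partial>M)"
        using sq_integrable_diff[OF f S, of n]
        by (intro nn_integral_eq_integral[symmetric]) (auto simp: sq_integrable_def)
      also have "\<dots> \<le> ennreal (e/2)" using fatou[of "e/2" N n] N that \<open>e > 0\<close> by auto
      finally show ?thesis using \<open>e > 0\<close> by (simp add: inner_L2_def power2_eq_square)
    qed
    then have "norm (dist_sq_L2 M f (S n) - 0) < e" if "n \<ge> N" for n
      using \<open>e > 0\<close> that by (simp add: abs_of_nonneg inner_L2_self_nonneg le_less_trans[of _ "e/2"])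
    then show "\<exists>no. \<forall>n\<ge>no. norm (dist_sq_L2 M f (S n) - 0) < e" by blast
  qed
  ultimately show ?thesis by blast
qed

text \<open>Totality is stated in the form in which it is verified for Jacobi polynomials: a function
  orthogonal to all basis elements has norm zero. That it implies the expansion theorem is where
  completeness of \<open>L\<^sup>2\<close> enters.\<close>

locale orthonormal_basis_L2 = finite_measure M for M :: "'a measure" +
  fixes e :: "nat \<Rightarrow> 'a \<Rightarrow> real"
  assumes sq_integrable_basis: "sq_integrable M (e j)"
    and orthonormal: "inner_L2 M (e i) (e j) = (if i = j then 1 else 0)"
    and total: "sq_integrable M f \<Longrightarrow> (\<And>j. inner_L2 M f (e j) = 0) \<Longrightarrow> inner_L2 M f f = 0"
begin

lemma sq_integrable_combination: "sq_integrable M (\<lambda>x. \<Sum>j\<in>J. c j * e j x)"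
  by (intro sq_integrable_sum sq_integrable_cmult sq_integrable_basis)

lemma inner_combination:
  assumes "finite J"
  shows "inner_L2 M (\<lambda>x. \<Sum>j\<in>J. c j * e j x) (e k) = (if k \<in> J then c k else 0)"
  using assms sq_integrable_basis
  by (subst inner_L2_sum) (auto simp: inner_L2_cmult orthonormal if_distrib cong: if_cong)

lemma inner_combination_self:
  assumes "finite J"
  shows "inner_L2 M (\<lambda>x. \<Sum>j\<in>J. c j * e j x) (\<lambda>x. \<Sum>j\<in>J. c j * e j x) = (\<Sum>j\<in>J. (c j)\<^sup>2)"
proof -
  have "inner_L2 M (\<lambda>x. \<Sum>j\<in>J. c j * e j x) (\<lambda>x. \<Sum>j\<in>J. c j * e j x)
      = (\<Sum>j\<in>J. inner_L2 M (\<lambda>x. c j * e j x) (\<lambda>x. \<Sum>j\<in>J. c j * e j x))"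
    by (intro inner_L2_sum sq_integrable_combination sq_integrable_cmult sq_integrable_basis)
  also have "\<dots> = (\<Sum>j\<in>J. (c j)\<^sup>2)"
    using assms by (intro sum.cong refl)
      (simp add: inner_L2_cmult inner_L2_commute[of M "e _"] inner_combination power2_eq_square)
  finally show ?thesis .
qed

lemma bessel:
  assumes f: "sq_integrable M f"
  shows "summable (\<lambda>j. (inner_L2 M f (e j))\<^sup>2)"
proof (rule summableI_nonneg_bounded)
  fix n
  let ?c = "\<lambda>j. inner_L2 M f (e j)"
  let ?S = "\<lambda>x. \<Sum>j<n. ?c j * e j x"
  have S: "sq_integrable M ?S" by (rule sq_integrable_combination)
  have fS: "inner_L2 M f ?S = (\<Sum>j<n. (?c j)\<^sup>2)"
    by (subst inner_L2_commute, subst inner_L2_sum)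
      (auto intro: f sq_integrable_basis simp: inner_L2_cmult inner_L2_commute[of M "e _"] power2_eq_square)
  have "0 \<le> dist_sq_L2 M f ?S" by (rule inner_L2_self_nonneg)
  also have "\<dots> = inner_L2 M f (\<lambda>x. f x - ?S x) - inner_L2 M ?S (\<lambda>x. f x - ?S x)"
    by (intro inner_L2_diff f S sq_integrable_diff)
  also have "inner_L2 M f (\<lambda>x. f x - ?S x) = inner_L2 M f f - inner_L2 M f ?S"
    by (intro inner_L2_diff_right f S)
  also have "inner_L2 M ?S (\<lambda>x. f x - ?S x) = inner_L2 M f ?S - inner_L2 M ?S ?S"
    by (subst inner_L2_commute[of M f ?S]) (intro inner_L2_diff_right f S)
  also have "inner_L2 M ?S ?S = (\<Sum>j<n. (?c j)\<^sup>2)" by (simp add: inner_combination_self)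
  also have "inner_L2 M f f - inner_L2 M f ?S - (inner_L2 M f ?S - (\<Sum>j<n. (?c j)\<^sup>2))
    = inner_L2 M f f - (\<Sum>j<n. (?c j)\<^sup>2)" by (simp add: fS)
  finally show "(\<Sum>j<n. (?c j)\<^sup>2) \<le> inner_L2 M f f" by simp
qed auto

lemma riesz_fischer:
  assumes c: "summable (\<lambda>j. (c j)\<^sup>2)"
  obtains f where "sq_integrable M f" "\<And>j. inner_L2 M f (e j) = c j"
    "(\<lambda>n. inner_L2 M (\<lambda>x. f x - (\<Sum>j<n. c j * e j x)) (\<lambda>x. f x - (\<Sum>j<n. c j * e j x))) \<longlonglongrightarrow> 0"
proof -
  let ?S = "\<lambda>n x. \<Sum>j<n. c j * e j x"
  have diff: "dist_sq_L2 M (?S i) (?S j) = (\<Sum>k\<in>{j..<i}. (c k)\<^sup>2)"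
    if "j \<le> i" for i j
  proof -
    have "?S i x - ?S j x = (\<Sum>k\<in>{j..<i}. c k * e k x)" for x
      using sum.atLeastLessThan_concat[of 0 j i "\<lambda>k. c k * e k x"] that
      by (simp add: lessThan_atLeast0)
    then show ?thesis by (simp add: inner_combination_self)
  qed
  have sym: "dist_sq_L2 M (?S i) (?S j)
    = dist_sq_L2 M (?S j) (?S i)" for i j
    by (simp add: inner_L2_def power2_eq_square[symmetric] power2_commute)
  have "\<exists>f. sq_integrable M f \<and> (\<lambda>n. dist_sq_L2 M f (?S n)) \<longlonglongrightarrow> 0"
  proof (rule L2_complete)
    fix \<epsilon> :: real assume "\<epsilon> > 0"
    then obtain N where N: "\<And>m n. m \<ge> N \<Longrightarrow> norm (\<Sum>k\<in>{m..<n}. (c k)\<^sup>2) < \<epsilon>"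
      using c[unfolded summable_Cauchy] by blast
    have "dist_sq_L2 M (?S i) (?S j) \<le> \<epsilon>" if "i \<ge> N" "j \<ge> N" for i j
    proof (cases "j \<le> i")
      case True
      then show ?thesis using N[of j i] that by (simp add: diff)
    next
      case False
      then show ?thesis using N[of i j] that by (subst sym) (simp add: diff)
    qed
    then show "\<exists>N. \<forall>i\<ge>N. \<forall>j\<ge>N. dist_sq_L2 M (?S i) (?S j) \<le> \<epsilon>" by blast
  qed (use sq_integrable_combination finite_measure_axioms in auto)
  then obtain f where f: "sq_integrable M f"
    and lim: "(\<lambda>n. dist_sq_L2 M f (?S n)) \<longlonglongrightarrow> 0" by blast
  have "inner_L2 M f (e j) = c j" for j
  proof (rule LIMSEQ_unique)
    show "(\<lambda>n. inner_L2 M (?S n) (e j)) \<longlonglongrightarrow> inner_L2 M f (e j)"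
      by (rule inner_L2_tendsto[OF sq_integrable_combination f sq_integrable_basis lim])
    have "\<forall>\<^sub>F n in sequentially. inner_L2 M (?S n) (e j) = c j"
      unfolding eventually_sequentially by (rule exI[of _ "Suc j"]) (auto simp: inner_combination)
    then show "(\<lambda>n. inner_L2 M (?S n) (e j)) \<longlonglongrightarrow> c j" by (rule tendsto_eventually)
  qed
  with f lim that show thesis by blast
qed

text \<open>The Riesz-Fischer function with the coefficients of \<open>f\<close> differs from \<open>f\<close> by something orthogonal to
  the whole basis, hence null. So the partial sums of the expansion converge to \<open>f\<close> itself.\<close>

theorem parseval:
  assumes f: "sq_integrable M f" and g: "sq_integrable M g"
  shows "(\<lambda>j. inner_L2 M f (e j) * inner_L2 M g (e j)) sums inner_L2 M f g"
proof -
  let ?c = "\<lambda>j. inner_L2 M f (e j)"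
  let ?S = "\<lambda>n x. \<Sum>j<n. ?c j * e j x"
  obtain f' where f': "sq_integrable M f'" and eq: "\<And>j. inner_L2 M f' (e j) = ?c j"
    and lim: "(\<lambda>n. dist_sq_L2 M f' (?S n)) \<longlonglongrightarrow> 0"
    by (rule riesz_fischer[OF bessel[OF f]]) (rule that)
  have "dist_sq_L2 M f f' = 0"
    using f f' by (intro total) (auto simp: inner_L2_diff sq_integrable_basis eq)
  then have "(inner_L2 M (\<lambda>x. f x - f' x) g)\<^sup>2 \<le> 0"
    using Cauchy_Schwarz_L2[OF sq_integrable_diff[OF f f'] g] by simp
  then have "inner_L2 M f g = inner_L2 M f' g"
    using f f' g by (simp add: inner_L2_diff)
  moreover have "(\<lambda>n. inner_L2 M (?S n) g) \<longlonglongrightarrow> inner_L2 M f' g"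
    by (rule inner_L2_tendsto[OF sq_integrable_combination f' g lim])
  moreover have "inner_L2 M (?S n) g = (\<Sum>j<n. ?c j * inner_L2 M g (e j))" for n
    using g by (subst inner_L2_sum)
      (auto intro: sq_integrable_basis simp: inner_L2_cmult inner_L2_commute[of M g])
  ultimately show ?thesis by (simp add: sums_def)
qed

end

section \<open>Smooth functions\<close>

text \<open>The iterated derivatives are those of the globally defined operator \<^const>\<open>deriv\<close>, as in
  \<^const>\<open>test_function\<close>. For open \<open>S\<close> the notion depends only on the restriction of \<open>f\<close> to \<open>S\<close>.\<close>

definition smooth_on :: "real set \<Rightarrow> (real \<Rightarrow> real) \<Rightarrow> bool" where
  "smooth_on S f \<longleftrightarrow> (\<forall>k. \<forall>x\<in>S. (deriv ^^ k) f field_differentiable (at x))"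

lemma deriv_cong_open:
  fixes f g :: "real \<Rightarrow> real"
  assumes "open S" "x \<in> S" "\<And>y. y \<in> S \<Longrightarrow> f y = g y"
  shows "deriv f x = deriv g x"
  by (rule deriv_cong_ev) (use assms eventually_nhds in blast)+

lemma field_differentiable_cong_open:
  fixes f g :: "real \<Rightarrow> real"
  assumes "open S" "x \<in> S" "\<And>y. y \<in> S \<Longrightarrow> f y = g y" "g field_differentiable (at x)"
  shows "f field_differentiable (at x)"
proof -
  obtain D where "(g has_field_derivative D) (at x)"
    using assms(4) by (auto simp: field_differentiable_def)
  then have "(f has_field_derivative D) (at x)"
    by (rule has_field_derivative_transform_within_open[OF _ assms(1,2)]) (use assms(3) in auto)
  then show ?thesis by (auto simp: field_differentiable_def)
qed

lemma higher_deriv_cong_open: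
  fixes f g :: "real \<Rightarrow> real"
  assumes "open S" "\<And>y. y \<in> S \<Longrightarrow> f y = g y"
  shows "x \<in> S \<Longrightarrow> (deriv ^^ k) f x = (deriv ^^ k) g x"
proof (induction k arbitrary: x)
  case 0
  then show ?case using assms(2) by simp
next
  case (Suc k)
  then show ?case
    using deriv_cong_open[OF assms(1) Suc.prems, of "(deriv ^^ k) f" "(deriv ^^ k) g"] by simp
qed

text \<open>Smoothness by exhibiting a family that is closed under differentiation. Every concrete function
  below (powers, polynomials, \<open>exp (- 1 / x)\<close>) is shown to be smooth by this rule.\<close>

lemma smooth_on_coinduct:
  assumes S: "open S" and f: "f \<in> F"
    and F: "\<And>g. g \<in> F \<Longrightarrow> \<exists>g'\<in>F. \<forall>x\<in>S. (g has_field_derivative g' x) (at x)"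
  shows "smooth_on S f"
proof -
  have "\<exists>h\<in>F. \<forall>x\<in>S. (deriv ^^ k) f x = h x" for k
  proof (induction k)
    case 0
    then show ?case using f by auto
  next
    case (Suc k)
    then obtain h where h: "h \<in> F" "\<And>x. x \<in> S \<Longrightarrow> (deriv ^^ k) f x = h x" by blast
    obtain h' where h': "h' \<in> F" "\<And>x. x \<in> S \<Longrightarrow> (h has_field_derivative h' x) (at x)"
      using F[OF h(1)] by blast
    have "(deriv ^^ Suc k) f x = h' x" if "x \<in> S" for x
      using deriv_cong_open[OF S that h(2)] DERIV_imp_deriv[OF h'(2)[OF that]] by simp
    then show ?case using h'(1) by blast
  qed
  moreover have "h field_differentiable (at x)" if "h \<in> F" "x \<in> S" for h x
    using F[OF that(1)] that(2) by (auto simp: field_differentiable_def)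
  ultimately show ?thesis
    unfolding smooth_on_def by (metis field_differentiable_cong_open[OF S])
qed

lemma smooth_on_deriv: "smooth_on S f \<Longrightarrow> smooth_on S (deriv f)"
  unfolding smooth_on_def by (metis funpow_swap1 funpow.simps(2) o_apply)

lemma smooth_on_has_derivative:
  "smooth_on S f \<Longrightarrow> x \<in> S \<Longrightarrow> (f has_field_derivative deriv f x) (at x)"
  using field_differentiable_derivI by (force simp: smooth_on_def dest: spec[of _ 0])

lemma smooth_on_subset: "smooth_on S f \<Longrightarrow> T \<subseteq> S \<Longrightarrow> smooth_on T f"
  by (auto simp: smooth_on_def)

lemma smooth_on_imp_continuous_on: "smooth_on S f \<Longrightarrow> continuous_on S f"
  by (meson DERIV_isCont continuous_at_imp_continuous_on smooth_on_has_derivative)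

text \<open>Products of two smooth functions are not closed under differentiation, but the algebra generated
  by the smooth functions is, by the Leibniz rule.\<close>

inductive_set smooth_algebra :: "real set \<Rightarrow> (real \<Rightarrow> real) set" for S where
  smooth: "smooth_on S f \<Longrightarrow> f \<in> smooth_algebra S"
| add: "f \<in> smooth_algebra S \<Longrightarrow> g \<in> smooth_algebra S \<Longrightarrow> (\<lambda>x. f x + g x) \<in> smooth_algebra S"
| mult: "f \<in> smooth_algebra S \<Longrightarrow> g \<in> smooth_algebra S \<Longrightarrow> (\<lambda>x. f x * g x) \<in> smooth_algebra S"

lemma smooth_algebra_smooth:
  assumes "open S" "f \<in> smooth_algebra S"
  shows "smooth_on S f"
proof (rule smooth_on_coinduct[OF assms])
  fix g assume "g \<in> smooth_algebra S"
  then show "\<exists>g'\<in>smooth_algebra S. \<forall>x\<in>S. (g has_field_derivative g' x) (at x)"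
  proof induction
    case (smooth f)
    then show ?case
      using smooth_on_has_derivative smooth_on_deriv smooth_algebra.smooth by blast
  next
    case (add f g)
    then obtain f' g' where "f' \<in> smooth_algebra S" "g' \<in> smooth_algebra S"
      "\<forall>x\<in>S. (f has_field_derivative f' x) (at x)" "\<forall>x\<in>S. (g has_field_derivative g' x) (at x)"
      by blast
    then show ?case
      by (intro bexI[of _ "\<lambda>x. f' x + g' x"] smooth_algebra.add) (blast intro: DERIV_add)+
  next
    case (mult f g)
    then obtain f' g' where *: "f' \<in> smooth_algebra S" "g' \<in> smooth_algebra S"
      "\<forall>x\<in>S. (f has_field_derivative f' x) (at x)" "\<forall>x\<in>S. (g has_field_derivative g' x) (at x)"
      by blast
    show ?case
    proof (rule bexI[of _ "\<lambda>x. f' x * g x + g' x * f x"])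
      show "\<forall>x\<in>S. ((\<lambda>x. f x * g x) has_field_derivative f' x * g x + g' x * f x) (at x)"
        using * by (blast intro: DERIV_mult)
      show "(\<lambda>x. f' x * g x + g' x * f x) \<in> smooth_algebra S"
        by (intro smooth_algebra.add smooth_algebra.mult * mult)
    qed
  qed
qed

lemma smooth_on_mult:
  "open S \<Longrightarrow> smooth_on S f \<Longrightarrow> smooth_on S g \<Longrightarrow> smooth_on S (\<lambda>x. f x * g x)"
  by (rule smooth_algebra_smooth, assumption, rule smooth_algebra.mult; rule smooth_algebra.smooth)

lemma smooth_on_poly: "smooth_on UNIV (poly p)"
proof (rule smooth_on_coinduct[of _ _ "range poly"])
  fix g :: "real \<Rightarrow> real" assume "g \<in> range poly"
  then show "\<exists>g'\<in>range poly. \<forall>x\<in>UNIV. (g has_field_derivative g' x) (at x)"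
    using poly_DERIV by blast
qed auto

lemma smooth_on_affine:
  assumes S: "open S" and f: "smooth_on S f"
  shows "smooth_on {x. c * x + d \<in> S} (\<lambda>x. f (c * x + d))"
proof (rule smooth_on_coinduct[of _ _ "{\<lambda>x. k * g (c * x + d) |k g. smooth_on S g}"])
  show "open {x. c * x + d \<in> S}"
  proof -
    have "continuous_on UNIV (\<lambda>x. c * x + d)" by (intro continuous_intros)
    from open_vimage[OF S this] show ?thesis by (simp add: vimage_def)
  qed
  show "(\<lambda>x. f (c * x + d)) \<in> {\<lambda>x. k * g (c * x + d) |k g. smooth_on S g}"
    using f by (auto intro!: exI[of _ 1] exI[of _ f])
  fix h assume "h \<in> {\<lambda>x. k * g (c * x + d) |k g. smooth_on S g}"
  then obtain k g where h: "h = (\<lambda>x. k * g (c * x + d))" and g: "smooth_on S g" by blast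
  have "(h has_field_derivative (k * c) * deriv g (c * x + d)) (at x)" if "c * x + d \<in> S" for x
    unfolding h
    by (auto intro!: derivative_eq_intros DERIV_chain2[where f = g and g = "\<lambda>x. c * x + d"]
        smooth_on_has_derivative[OF g] that)
  moreover have "(\<lambda>x. (k * c) * deriv g (c * x + d)) \<in> {\<lambda>x. k * g (c * x + d) |k g. smooth_on S g}"
    using smooth_on_deriv[OF g] by (intro CollectI exI[of _ "k * c"] exI[of _ "deriv g"] conjI refl)
  ultimately show "\<exists>g'\<in>{\<lambda>x. k * g (c * x + d) |k g. smooth_on S g}.
      \<forall>x\<in>{x. c * x + d \<in> S}. (h has_field_derivative g' x) (at x)"
    by (intro bexI[of _ "\<lambda>x. (k * c) * deriv g (c * x + d)"]) auto
qed

lemma smooth_on_powr: "smooth_on {0<..} (\<lambda>x. x powr \<alpha>)"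
proof (rule smooth_on_coinduct[of _ _ "{\<lambda>x. k * x powr \<alpha> |k \<alpha>. True}"])
  show "(\<lambda>x. x powr \<alpha>) \<in> {\<lambda>x. k * x powr \<alpha> |k \<alpha>. True}"
    by (rule CollectI, rule exI[of _ 1], rule exI[of _ \<alpha>]) simp
  fix h :: "real \<Rightarrow> real" assume "h \<in> {\<lambda>x. k * x powr \<alpha> |k \<alpha>. True}"
  then obtain k \<alpha> where h: "h = (\<lambda>x. k * x powr \<alpha>)" by blast
  have "(h has_field_derivative (k * \<alpha>) * x powr (\<alpha> - 1)) (at x)" if "x > 0" for x
    unfolding h using that by (auto intro!: derivative_eq_intros)
  moreover have "(\<lambda>x::real. (k * \<alpha>) * x powr (\<alpha> - 1)) \<in> {\<lambda>x. k * x powr \<alpha> |k \<alpha>. True}" by blast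
  ultimately show "\<exists>g'\<in>{\<lambda>x. k * x powr \<alpha> |k \<alpha>. True}. \<forall>x\<in>{0<..}. (h has_field_derivative g' x) (at x)"
    by (intro bexI[of _ "\<lambda>x. (k * \<alpha>) * x powr (\<alpha> - 1)"]) auto
qed auto

text \<open>The classical smooth function that vanishes to infinite order at \<open>0\<close>. Its dilations \<open>bump (k x)\<close> stay
  between \<open>0\<close> and \<open>1\<close> and increase to the indicator of the positive half-line, so products of them
  approximate indicators of intervals; this replaces mollification.\<close>

definition bump :: "real \<Rightarrow> real" where
  "bump x = (if x > 0 then exp (- 1 / x) else 0)"

lemma bump_nonneg: "0 \<le> bump x" and bump_le_1: "bump x \<le> 1"
  by (auto simp: bump_def)

lemma bump_nonpos [simp]: "x \<le> 0 \<Longrightarrow> bump x = 0"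
  by (simp add: bump_def)

lemma poly_mult_exp_minus_tendsto_0:
  fixes p :: "real poly"
  shows "((\<lambda>y. poly p y * exp (- y)) \<longlongrightarrow> 0) at_top"
proof -
  have "((\<lambda>y. \<Sum>i\<le>degree p. coeff p i * (y ^ i / exp y)) \<longlongrightarrow> (\<Sum>i\<le>degree p. coeff p i * 0)) at_top"
    by (intro tendsto_intros tendsto_power_div_exp_0)
  then show ?thesis
    by (simp add: poly_altdef exp_minus divide_inverse sum_distrib_right mult.assoc)
qed

text \<open>The functions \<open>p (1 / x) exp (- 1 / x)\<close> with \<open>p\<close> a polynomial, continued by zero, are closed
  under differentiation: the derivative belongs to the polynomial \<open>x\<^sup>2 (p - p')\<close>.\<close>

lemma smooth_on_bump: "smooth_on UNIV bump"
proof -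
  define B where "B p x = (if x > 0 then poly p (1 / x) * exp (- 1 / x) else 0)" for p :: "real poly" and x :: real
  have deriv_pos: "(B p has_field_derivative B (monom 1 2 * (p - pderiv p)) x) (at x)" if "x > 0" for p x
  proof -
    have "((\<lambda>x. poly p (1 / x) * exp (- 1 / x)) has_field_derivative
        poly (pderiv p) (1 / x) * (- 1 / x\<^sup>2) * exp (- 1 / x)
        + poly p (1 / x) * (exp (- 1 / x) * (1 / x\<^sup>2))) (at x)"
      using that
      by (auto intro!: derivative_eq_intros DERIV_chain2[OF poly_DERIV] simp: power2_eq_square field_simps)
    then have "((\<lambda>x. poly p (1 / x) * exp (- 1 / x)) has_field_derivative
        B (monom 1 2 * (p - pderiv p)) x) (at x)"
      using that by (simp add: B_def poly_monom algebra_simps power_divide diff_divide_distrib)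
    then show ?thesis
      by (rule has_field_derivative_transform_within_open[of _ _ _ "{0<..}"]) (use that in \<open>auto simp: B_def\<close>)
  qed
  have deriv_neg: "(B p has_field_derivative 0) (at x)" if "x < 0" for p x
    by (rule has_field_derivative_transform_within_open[of "\<lambda>_. 0" _ _ "{..<0}"])
      (use that in \<open>auto simp: B_def\<close>)
  have deriv_0: "(B p has_field_derivative 0) (at 0)" for p
  proof -
    have "((\<lambda>h. B p h / h) \<longlongrightarrow> 0) (at_right 0)"
    proof -
      have "((\<lambda>h. poly (pCons 0 p) (inverse h) * exp (- inverse h)) \<longlongrightarrow> 0) (at_right (0::real))"
        by (rule filterlim_compose[OF poly_mult_exp_minus_tendsto_0 filterlim_inverse_at_top_right])
      then show ?thesis
        by (rule Lim_transform_eventually)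
          (auto simp: eventually_at_right_less B_def field_simps eventually_at_filter)
    qed
    moreover have "((\<lambda>h. B p h / h) \<longlongrightarrow> 0) (at_left 0)"
      by (rule Lim_transform_eventually[OF tendsto_const]) (auto simp: eventually_at_filter B_def)
    ultimately have "((\<lambda>h. B p h / h) \<longlongrightarrow> 0) (at 0)"
      by (simp add: filterlim_split_at)
    then show ?thesis by (simp add: has_field_derivative_iff B_def)
  qed
  have B_nonpos: "B p x = 0" if "x \<le> 0" for p x using that by (simp add: B_def)
  have "smooth_on UNIV (B 1)"
  proof (rule smooth_on_coinduct[of _ _ "range B"])
    fix g assume "g \<in> range B"
    then obtain p where p: "g = B p" by blast
    have "(B p has_field_derivative B (monom 1 2 * (p - pderiv p)) x) (at x)" for x
      using deriv_pos[of x p] deriv_neg[of x p] deriv_0[of p] B_nonpos[of x]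
      by (cases x "0::real" rule: linorder_cases) auto
    then show "\<exists>g'\<in>range B. \<forall>x\<in>UNIV. (g has_field_derivative g' x) (at x)"
      unfolding p by blast
  qed auto
  moreover have "B 1 = bump" by (auto simp: B_def bump_def fun_eq_iff)
  ultimately show ?thesis by simp
qed

lemma deriv_bump: "deriv bump x = (if x > 0 then bump x / x\<^sup>2 else 0)"
proof (cases "x > 0")
  case True
  have "((\<lambda>x. exp (- 1 / x)) has_field_derivative exp (- 1 / x) / x\<^sup>2) (at x)"
    using True by (auto intro!: derivative_eq_intros simp: power2_eq_square)
  then have "(bump has_field_derivative exp (- 1 / x) / x\<^sup>2) (at x)"
    by (rule has_field_derivative_transform_within_open[of _ _ _ "{0<..}"]) (use True in \<open>auto simp: bump_def\<close>)
  then show ?thesis using True by (simp add: DERIV_imp_deriv bump_def)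
next
  case False
  \<comment> \<open>Every point of the half-line is a minimum of the nonnegative function, hence critical.\<close>
  have "deriv bump x = 0"
    using DERIV_local_min[of bump "deriv bump x" x 1] False
      smooth_on_has_derivative[OF smooth_on_bump UNIV_I] by (simp add: bump_nonneg)
  then show ?thesis using False by simp
qed

lemma bump_tendsto_1: "(bump \<longlongrightarrow> 1) at_top"
proof -
  have "((\<lambda>x::real. exp (- inverse x)) \<longlongrightarrow> exp (- 0)) at_top"
    by (intro tendsto_intros tendsto_inverse_0_at_top filterlim_ident)
  then have "((\<lambda>x::real. exp (- inverse x)) \<longlongrightarrow> 1) at_top" by simp
  then show ?thesis
    by (rule Lim_transform_eventually)
      (use eventually_gt_at_top[of 0] in eventually_elim, simp add: bump_def divide_inverse)
qed

section \<open>Test functions\<close>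

text \<open>Smoothness is only needed inside the interval, since the function vanishes on the open complement
  of \<open>K\<close>, and the two open sets cover the line.\<close>

lemma test_functionI:
  assumes f: "smooth_on unit_ivl f" and K: "compact K" "K \<subseteq> unit_ivl" "\<And>x. x \<notin> K \<Longrightarrow> f x = 0"
  shows "test_function f"
  unfolding test_function_def
proof (intro conjI allI)
  fix k x
  show "(deriv ^^ k) f field_differentiable at x"
  proof (cases "x \<in> unit_ivl")
    case True
    then show ?thesis using f unfolding smooth_on_def by blast
  next
    case False
    then have x: "x \<in> - K" using K(2) by blast
    have "open (- K)" using K(1) by (simp add: compact_imp_closed open_Compl)
    have const: "(deriv ^^ k) (\<lambda>x. 0 :: real) = (\<lambda>x. 0)" by (induction k) auto
    have "(deriv ^^ k) f y = 0" if "y \<in> - K" for y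
    proof -
      have "(deriv ^^ k) f y = (deriv ^^ k) (\<lambda>x. 0) y"
        by (rule higher_deriv_cong_open[OF \<open>open (- K)\<close> _ that]) (use K(3) in simp)
      then show ?thesis unfolding const .
    qed
    then show ?thesis
      by (rule field_differentiable_cong_open[OF \<open>open (- K)\<close> x]) simp_all
  qed
next
  show "\<exists>K. compact K \<and> K \<subseteq> unit_ivl \<and> (\<forall>x. x \<notin> K \<longrightarrow> f x = 0)"
    using K by (intro exI[of _ K] conjI allI impI)
qed

lemma test_function_smooth: "test_function f \<Longrightarrow> smooth_on S f"
  by (simp add: test_function_def smooth_on_def)

lemma test_function_support:
  assumes "test_function \<phi>"
  obtains K where "compact K" "K \<subseteq> unit_ivl" "\<And>x. x \<notin> K \<Longrightarrow> \<phi> x = 0"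
  using assms unfolding test_function_def by blast

lemma test_function_zero:
  assumes "test_function \<phi>" "x \<notin> unit_ivl" shows "\<phi> x = 0"
  by (rule test_function_support[OF assms(1)]) (use assms(2) in blast)

lemma test_function_deriv:
  assumes "test_function \<phi>" shows "test_function (deriv \<phi>)"
proof -
  obtain K where K: "compact K" "K \<subseteq> unit_ivl" "\<And>x. x \<notin> K \<Longrightarrow> \<phi> x = 0"
    by (rule test_function_support[OF assms]) (rule that)
  have "deriv \<phi> x = 0" if "x \<notin> K" for x
  proof -
    have "deriv \<phi> x = deriv (\<lambda>_. 0) x"
      by (rule deriv_cong_open[of "- K"]) (use K that in \<open>simp_all add: compact_imp_closed open_Compl\<close>)
    then show ?thesis by simp
  qed
  then show ?thesis
    by (rule test_functionI[OF smooth_on_deriv[OF test_function_smooth[OF assms]] K(1,2)])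
qed

lemma test_function_mult:
  assumes "test_function \<phi>" "smooth_on unit_ivl f"
  shows "test_function (\<lambda>x. \<phi> x * f x)"
proof -
  obtain K where K: "compact K" "K \<subseteq> unit_ivl" "\<And>x. x \<notin> K \<Longrightarrow> \<phi> x = 0"
    by (rule test_function_support[OF assms(1)]) (rule that)
  show ?thesis
    by (rule test_functionI[OF smooth_on_mult[OF _ test_function_smooth[OF assms(1)] assms(2)] K(1,2)])
      (simp_all add: K(3))
qed

lemma test_function_continuous: "test_function \<phi> \<Longrightarrow> continuous_on S \<phi>"
  by (intro smooth_on_imp_continuous_on test_function_smooth)

lemma test_function_bounded:
  assumes "test_function \<phi>" obtains B where "\<And>x. \<bar>\<phi> x\<bar> \<le> B"
proof -
  have "compact (\<phi> ` {0..1})"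
    by (intro compact_continuous_image test_function_continuous assms compact_Icc)
  then have "bounded (\<phi> ` {0..1})" by (rule compact_imp_bounded)
  then obtain B where "\<And>x. x \<in> {0..1} \<Longrightarrow> \<bar>\<phi> x\<bar> \<le> B"
    unfolding bounded_iff by force
  moreover have "\<phi> x = 0" if "x \<notin> {0..1}" for x
    by (rule test_function_zero[OF assms]) (use that in auto)
  ultimately have "\<bar>\<phi> x\<bar> \<le> max B 0" for x
    by (cases "x \<in> {0..1}") (simp_all add: le_max_iff_disj)
  then show thesis using that by blast
qed

lemma test_function_integral_deriv:
  assumes "test_function \<phi>"
  shows "(LINT x:unit_ivl|lebesgue. deriv \<phi> x) = 0"
proof -
  have "(deriv \<phi> has_integral \<phi> 1 - \<phi> 0) {0..1}"
  proof (rule fundamental_theorem_of_calculus)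
    fix x
    show "(\<phi> has_vector_derivative deriv \<phi> x) (at x within {0..1})"
      unfolding has_real_derivative_iff_has_vector_derivative[symmetric]
      by (rule has_field_derivative_at_within[OF smooth_on_has_derivative[OF test_function_smooth[OF assms] UNIV_I]])
  qed simp
  then have "(deriv \<phi> has_integral 0) {0..1}"
    using test_function_zero[OF assms, of 0] test_function_zero[OF assms, of 1] by simp
  moreover have "set_integrable lebesgue {0..1} (deriv \<phi>)"
    by (intro absolutely_integrable_continuous_real test_function_continuous test_function_deriv assms)
  ultimately have "(LINT x:{0..1}|lebesgue. deriv \<phi> x) = 0"
    by (simp add: set_lebesgue_integral_eq_integral(2) has_integral_iff)
  moreover have "(\<lambda>x. indicat_real {0..1} x *\<^sub>R deriv \<phi> x) = (\<lambda>x. indicat_real unit_ivl x *\<^sub>R deriv \<phi> x)"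
    using test_function_zero[OF test_function_deriv[OF assms]] by (auto simp: indicator_def fun_eq_iff)
  ultimately show ?thesis unfolding set_lebesgue_integral_def by simp
qed

section \<open>Locally integrable functions and weak derivatives\<close>

abbreviation unit_measurable :: "(real \<Rightarrow> real) set" where
  "unit_measurable \<equiv> borel_measurable (lebesgue_on unit_ivl)"

lemma set_lebesgue_integral_unit_ivl:
  fixes f :: "real \<Rightarrow> real"
  shows "(LINT x:unit_ivl|lebesgue. f x) = integral\<^sup>L (lebesgue_on unit_ivl) f"
  by (simp add: set_lebesgue_integral_def integral_restrict_space)

lemma set_integrable_unit_ivl:
  fixes f :: "real \<Rightarrow> real"
  shows "set_integrable lebesgue unit_ivl f \<longleftrightarrow> integrable (lebesgue_on unit_ivl) f"
  by (simp add: set_integrable_def integrable_restrict_space)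

lemma continuous_on_measurable_unit_ivl:
  fixes f :: "real \<Rightarrow> real"
  shows "continuous_on unit_ivl f \<Longrightarrow> f \<in> unit_measurable"
  by (rule continuous_imp_measurable_on_sets_lebesgue) auto

lemma test_function_measurable:
  assumes "test_function \<phi>"
  shows "\<phi> \<in> unit_measurable"
  by (rule continuous_on_measurable_unit_ivl[OF test_function_continuous[OF assms]])

lemma locally_integrableD:
  assumes "locally_integrable f" "compact K" "K \<subseteq> unit_ivl"
  shows "integrable lebesgue (\<lambda>x. indicat_real K x * f x)"
proof -
  have "set_integrable lebesgue K f" using assms unfolding locally_integrable_def by blast
  then show ?thesis by (simp add: set_integrable_def)
qed

lemma locally_integrable_mult_test:
  assumes f: "locally_integrable f" and \<phi>: "test_function \<phi>"
  shows "integrable (lebesgue_on unit_ivl) (\<lambda>x. f x * \<phi> x)"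
proof -
  obtain K where K: "compact K" "K \<subseteq> unit_ivl" "\<And>x. x \<notin> K \<Longrightarrow> \<phi> x = 0"
    by (rule test_function_support[OF \<phi>]) (rule that)
  obtain B where B: "\<And>x. \<bar>\<phi> x\<bar> \<le> B"
    by (rule test_function_bounded[OF \<phi>]) (rule that)
  have int: "integrable lebesgue (\<lambda>x. indicat_real K x * f x)"
    by (rule locally_integrableD[OF f K(1,2)])
  have "\<phi> \<in> borel_measurable borel"
    by (rule borel_measurable_continuous_onI[OF test_function_continuous[OF \<phi>]])
  then have \<phi>_meas: "\<phi> \<in> borel_measurable lebesgue"
    by (intro measurable_completion) simp
  have "integrable lebesgue (\<lambda>x. \<phi> x * (indicat_real K x * f x))"
  proof (rule Bochner_Integration.integrable_bound)
    show "integrable lebesgue (\<lambda>x. B * (indicat_real K x * f x))" using int by simp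
    show "AE x in lebesgue. norm (\<phi> x * (indicat_real K x * f x)) \<le> norm (B * (indicat_real K x * f x))"
    proof (rule AE_I2)
      fix x
      have "\<bar>\<phi> x\<bar> \<le> \<bar>B\<bar>" using B[of x] by linarith
      then show "norm (\<phi> x * (indicat_real K x * f x)) \<le> norm (B * (indicat_real K x * f x))"
        unfolding norm_mult by (intro mult_right_mono) simp_all
    qed
  qed (intro borel_measurable_times borel_measurable_integrable[OF int] \<phi>_meas)
  also have "(\<lambda>x. \<phi> x * (indicat_real K x * f x)) = (\<lambda>x. indicat_real unit_ivl x *\<^sub>R (f x * \<phi> x))"
  proof
    fix x
    show "\<phi> x * (indicat_real K x * f x) = indicat_real unit_ivl x *\<^sub>R (f x * \<phi> x)"
      using K(2) K(3)[of x] by (cases "x \<in> K") (auto simp: indicator_def)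
  qed
  finally show ?thesis by (simp add: integrable_restrict_space)
qed

lemma locally_integrable_measurable:
  assumes f: "locally_integrable f"
  shows "f \<in> unit_measurable"
proof -
  let ?K = "\<lambda>n::nat. {1 / (real n + 1) .. 1 - 1 / (real n + 1)}"
  have K: "?K n \<subseteq> unit_ivl" for n
  proof
    fix x assume x: "x \<in> ?K n"
    have "1 / (real n + 1) > 0" by simp
    then show "x \<in> unit_ivl"
      using x unfolding atLeastAtMost_iff greaterThanLessThan_iff by linarith
  qed
  have "(\<lambda>x. indicat_real (?K n) x * f x) \<in> borel_measurable lebesgue" for n
    by (rule borel_measurable_integrable[OF locally_integrableD[OF f compact_Icc K]])
  then have meas: "(\<lambda>x. indicat_real (?K n) x * f x) \<in> unit_measurable" for n
    by (rule measurable_restrict_space1)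
  show ?thesis
  proof (rule borel_measurable_LIMSEQ_real[OF _ meas])
    fix x assume "x \<in> space (lebesgue_on unit_ivl)"
    then have x: "0 < x" "x < 1" by auto
    have "(\<lambda>n. inverse (real (Suc n))) \<longlonglongrightarrow> 0" by (rule LIMSEQ_inverse_real_of_nat)
    then have "\<forall>\<^sub>F n in sequentially. inverse (real (Suc n)) < min x (1 - x)"
      by (rule order_tendstoD) (use x in simp)
    then have "\<forall>\<^sub>F n in sequentially. indicat_real (?K n) x * f x = f x"
      by eventually_elim (auto simp: indicator_def inverse_eq_divide add.commute)
    then show "(\<lambda>n. indicat_real (?K n) x * f x) \<longlonglongrightarrow> f x" by (rule tendsto_eventually)
  qed
qed

text \<open>The positive and the negative part of \<open>f\<close> are densities of finite measures that agree on all
  half-lines, hence coincide.\<close>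

lemma AE_zero_if_ray_integrals_zero:
  fixes f :: "real \<Rightarrow> real"
  assumes int: "integrable lborel f" and ray: "\<And>x. (LINT y:{x<..}|lborel. f y) = 0"
  shows "AE x in lborel. f x = 0"
proof -
  have [measurable]: "f \<in> borel_measurable borel"
    using borel_measurable_integrable[OF int] by simp
  let ?h = "\<lambda>x y. indicat_real {x<..} y * f y"
  have h_int: "integrable lborel (?h x)" for x
    using integrable_mult_indicator[OF _ int, of "{x<..}"] by simp
  have pos: "emeasure (density lborel (\<lambda>y. ennreal (f y))) {x<..} = (\<integral>\<^sup>+y. ennreal (?h x y) \<partial>lborel)" for x
    by (subst emeasure_density) (auto intro!: nn_integral_cong simp: indicator_def)
  have neg: "emeasure (density lborel (\<lambda>y. ennreal (- f y))) {x<..} = (\<integral>\<^sup>+y. ennreal (- ?h x y) \<partial>lborel)" for x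
    by (subst emeasure_density) (auto intro!: nn_integral_cong simp: indicator_def)
  have fin: "(\<integral>\<^sup>+y. ennreal (?h x y) \<partial>lborel) < \<infinity>" "(\<integral>\<^sup>+y. ennreal (- ?h x y) \<partial>lborel) < \<infinity>" for x
    using h_int[of x] by (simp_all add: real_integrable_def less_top)
  have "(\<integral>\<^sup>+y. ennreal (?h x y) \<partial>lborel) = (\<integral>\<^sup>+y. ennreal (- ?h x y) \<partial>lborel)" for x
  proof -
    have "integral\<^sup>L lborel (?h x) = 0"
      using ray[of x] by (simp add: set_lebesgue_integral_def)
    then have "enn2real (\<integral>\<^sup>+y. ennreal (?h x y) \<partial>lborel) = enn2real (\<integral>\<^sup>+y. ennreal (- ?h x y) \<partial>lborel)"
      using real_lebesgue_integral_def[OF h_int[of x]] by simp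
    then show ?thesis
      using fin[of x] by (metis ennreal_enn2real infinity_ennreal_def)
  qed
  then have "density lborel (\<lambda>y. ennreal (f y)) = density lborel (\<lambda>y. ennreal (- f y))"
    using fin by (intro measure_eqI_lessThan) (simp_all add: pos neg)
  then have "AE y in lborel. ennreal (f y) = ennreal (- f y)"
    by (subst (asm) sigma_finite_measure.density_unique_iff[OF sigma_finite_lborel]) measurable
  then show ?thesis
  proof eventually_elim
    case (elim y)
    then show ?case
      by (cases "f y" "0::real" rule: linorder_cases) (auto simp: ennreal_neg ennreal_eq_0_iff)
  qed
qed

lemma AE_zero_if_ray_integrals_zero_lebesgue:
  fixes f :: "real \<Rightarrow> real"
  assumes int: "integrable lebesgue f" and ray: "\<And>x. (LINT y|lebesgue. indicat_real {x<..} y * f y) = 0"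
  shows "AE x in lebesgue. f x = 0"
proof -
  obtain f' where f' [measurable]: "f' \<in> borel_measurable lborel" and eq: "AE x in lborel. f x = f' x"
    using completion_ex_borel_measurable_real[OF borel_measurable_integrable[OF int]] by blast
  have eq': "AE x in lebesgue. f x = f' x" using eq by (rule AE_completion)
  have [measurable]: "f' \<in> borel_measurable lebesgue" "f \<in> borel_measurable lebesgue"
    using int by (auto intro: measurable_completion)
  have "integrable lebesgue f'"
    using int integrable_cong_AE[of f lebesgue f'] eq' by simp
  then have f'_int: "integrable lborel f'" by (simp add: integrable_completion)
  have "(LINT y:{x<..}|lborel. f' y) = 0" for x
  proof -
    have "(LINT y:{x<..}|lborel. f' y) = (LINT y|lebesgue. indicat_real {x<..} y * f' y)"
      by (simp add: set_lebesgue_integral_def integral_completion)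
    also have "\<dots> = (LINT y|lebesgue. indicat_real {x<..} y * f y)"
      by (rule integral_cong_AE) (use eq' in \<open>auto intro!: borel_measurable_times borel_measurable_indicator\<close>)
    finally show ?thesis using ray by simp
  qed
  from AE_completion[OF AE_zero_if_ray_integrals_zero[OF f'_int this]] eq'
  show ?thesis by eventually_elim simp
qed

lemma bump_interval_test_function:
  assumes "0 < c" "d < 1" "k > 0"
  shows "test_function (\<lambda>x. bump (k * (x - c)) * bump (k * (d - x)))"
proof (rule test_functionI[of _ "{c..d}"])
  have "smooth_on unit_ivl (\<lambda>x. bump (k * x + (- k * c)))" "smooth_on unit_ivl (\<lambda>x. bump ((- k) * x + k * d))"
    using smooth_on_affine[OF open_UNIV smooth_on_bump, of k "- k * c"]
      smooth_on_affine[OF open_UNIV smooth_on_bump, of "- k" "k * d"]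
    by (auto intro: smooth_on_subset)
  from smooth_on_mult[OF _ this] show "smooth_on unit_ivl (\<lambda>x. bump (k * (x - c)) * bump (k * (d - x)))"
    by (simp add: algebra_simps)
  show "bump (k * (x - c)) * bump (k * (d - x)) = 0" if "x \<notin> {c..d}" for x
    using that assms by (auto simp: not_le mult_nonneg_nonpos)
qed (use assms in auto)

lemma bump_scaled_tendsto:
  "(\<lambda>i. bump (real (Suc i) * y)) \<longlonglongrightarrow> (if y > 0 then 1 else 0)"
proof (cases "y > 0")
  case True
  have "filterlim (\<lambda>i. real (Suc i) * y) at_top sequentially"
    using True by (intro filterlim_at_top_mult_tendsto_pos[OF tendsto_const]
        filterlim_compose[OF filterlim_real_sequentially filterlim_Suc])
  from filterlim_compose[OF bump_tendsto_1 this] True show ?thesis by simp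
next
  case False
  then have "bump (real (Suc i) * y) = 0" for i
    by (intro bump_nonpos mult_nonneg_nonpos) auto
  then show ?thesis using False by simp
qed

text \<open>The test functions \<open>bump (k (x - c)) bump (k (d - x))\<close> tend boundedly to the indicator of the
  interval as \<open>k \<rightarrow> \<infinity>\<close>.\<close>

lemma interval_integral_zero_if_test_integrals_zero:
  assumes g: "locally_integrable g"
    and test: "\<And>\<phi>. test_function \<phi> \<Longrightarrow> (LINT x:unit_ivl|lebesgue. g x * \<phi> x) = 0"
    and cd: "0 < c" "d < 1"
  shows "(LINT y|lebesgue. indicat_real {c<..<d} y * g y) = 0"
proof -
  let ?\<phi> = "\<lambda>i x. bump (real (Suc i) * (x - c)) * bump (real (Suc i) * (d - x))"
  have [measurable]: "bump \<in> borel_measurable borel"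
    by (rule borel_measurable_continuous_onI[OF smooth_on_imp_continuous_on[OF smooth_on_bump]])
  have "{c..d} \<subseteq> unit_ivl" using cd by auto
  then have int: "integrable lebesgue (\<lambda>x. indicat_real {c..d} x * g x)"
    by (rule locally_integrableD[OF g compact_Icc])
  have g_meas: "(\<lambda>x. indicat_real {c..d} x * g x) \<in> borel_measurable lebesgue"
    using int by (rule borel_measurable_integrable)
  have \<phi>_meas: "?\<phi> i \<in> borel_measurable lebesgue" for i
    by (rule measurable_completion) measurable
  have ind: "indicat_real {c<..<d} x * g x = indicat_real {c<..<d} x * (indicat_real {c..d} x * g x)" for x
    by (auto simp: indicator_def)
  have "(\<lambda>i. LINT x|lebesgue. (indicat_real {c..d} x * g x) * ?\<phi> i x)
      \<longlonglongrightarrow> (LINT x|lebesgue. indicat_real {c<..<d} x * g x)"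
  proof (rule integral_dominated_convergence[where w = "\<lambda>x. norm (indicat_real {c..d} x * g x)"])
    show "(\<lambda>x. indicat_real {c<..<d} x * g x) \<in> borel_measurable lebesgue"
      unfolding ind by (intro borel_measurable_times borel_measurable_indicator g_meas) simp
    show "integrable lebesgue (\<lambda>x. norm (indicat_real {c..d} x * g x))"
      using int by (rule integrable_norm)
    show "AE x in lebesgue. (\<lambda>i. (indicat_real {c..d} x * g x) * ?\<phi> i x) \<longlonglongrightarrow> indicat_real {c<..<d} x * g x"
    proof (rule AE_I2)
      fix x
      have "(\<lambda>i. (indicat_real {c..d} x * g x) * ?\<phi> i x) \<longlonglongrightarrow>
          (indicat_real {c..d} x * g x) * ((if x - c > 0 then 1 else 0) * (if d - x > 0 then 1 else 0))"
        by (intro tendsto_mult tendsto_const bump_scaled_tendsto)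
      moreover have "(indicat_real {c..d} x * g x) * ((if x - c > 0 then 1 else 0) * (if d - x > 0 then 1 else 0))
          = indicat_real {c<..<d} x * g x"
        by (auto simp: indicator_def)
      ultimately show "(\<lambda>i. (indicat_real {c..d} x * g x) * ?\<phi> i x) \<longlonglongrightarrow> indicat_real {c<..<d} x * g x"
        by (simp only:)
    qed
    show "AE x in lebesgue. norm ((indicat_real {c..d} x * g x) * ?\<phi> i x) \<le> norm (indicat_real {c..d} x * g x)" for i
    proof (rule AE_I2)
      fix x
      have "\<bar>?\<phi> i x\<bar> \<le> 1" by (simp add: abs_mult bump_nonneg bump_le_1 mult_le_one)
      then show "norm ((indicat_real {c..d} x * g x) * ?\<phi> i x) \<le> norm (indicat_real {c..d} x * g x)"
        unfolding real_norm_def abs_mult[of "indicat_real {c..d} x * g x"] by (rule mult_left_le) simp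
    qed
  qed (rule borel_measurable_times[OF g_meas \<phi>_meas])
  moreover have "(LINT x|lebesgue. (indicat_real {c..d} x * g x) * ?\<phi> i x) = 0" for i
  proof -
    have t: "test_function (?\<phi> i)" by (rule bump_interval_test_function) (use cd in auto)
    have "?\<phi> i x = 0" if "x \<notin> {c..d}" for x
      using that by (auto simp: not_le mult_nonneg_nonpos)
    then have "(\<lambda>x. (indicat_real {c..d} x * g x) * ?\<phi> i x) = (\<lambda>x. indicat_real unit_ivl x *\<^sub>R (g x * ?\<phi> i x))"
      using cd by (auto simp: indicator_def fun_eq_iff)
    then show ?thesis using test[OF t] by (simp only: set_lebesgue_integral_def)
  qed
  ultimately show ?thesis by (simp add: LIMSEQ_const_iff)
qed

text \<open>This makes weak derivatives unique up to null sets, so that the choice made in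
  \<^const>\<open>weak_deriv\<close> is harmless. It also yields the completeness of the Jacobi polynomials.\<close>

theorem fundamental_lemma_calculus_of_variations:
  assumes g: "locally_integrable g"
    and test: "\<And>\<phi>. test_function \<phi> \<Longrightarrow> (LINT x:unit_ivl|lebesgue. g x * \<phi> x) = 0"
  shows "AE x in lebesgue_on unit_ivl. g x = 0"
proof -
  let ?K = "\<lambda>n::nat. {1 / (real n + 1) .. 1 - 1 / (real n + 1)}"
  have "AE x in lebesgue. indicat_real (?K n) x * g x = 0" for n
  proof (rule AE_zero_if_ray_integrals_zero_lebesgue)
    let ?d = "1 - 1 / (real n + 1)"
    have pos: "1 / (real n + 1) > 0" by simp
    then have K: "?K n \<subseteq> unit_ivl"
      unfolding subset_iff atLeastAtMost_iff greaterThanLessThan_iff by (intro allI impI) linarith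
    then show int: "integrable lebesgue (\<lambda>x. indicat_real (?K n) x * g x)"
      by (rule locally_integrableD[OF g compact_Icc])
    fix x
    let ?c = "max x (1 / (real n + 1))"
    have "(LINT y|lebesgue. indicat_real {x<..} y * (indicat_real (?K n) y * g y))
        = (LINT y|lebesgue. indicat_real {?c<..<?d} y * g y)"
    proof (rule integral_cong_AE)
      have K_meas: "(\<lambda>x. indicat_real (?K n) x * g x) \<in> borel_measurable lebesgue"
        using int by (rule borel_measurable_integrable)
      show "(\<lambda>y. indicat_real {x<..} y * (indicat_real (?K n) y * g y)) \<in> borel_measurable lebesgue"
        by (intro borel_measurable_times borel_measurable_indicator K_meas) simp
      have "(\<lambda>y. indicat_real {?c<..<?d} y * g y) = (\<lambda>y. indicat_real {?c<..<?d} y * (indicat_real (?K n) y * g y))"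
        by (auto simp: indicator_def fun_eq_iff)
      moreover have "\<dots> \<in> borel_measurable lebesgue"
        by (intro borel_measurable_times borel_measurable_indicator K_meas) simp
      ultimately show "(\<lambda>y. indicat_real {?c<..<?d} y * g y) \<in> borel_measurable lebesgue"
        by simp
      have "AE y in lebesgue. y \<noteq> 1 / (real n + 1) \<and> y \<noteq> ?d"
        by (intro AE_conjI AE_completion AE_lborel_singleton)
      then show "AE y in lebesgue. indicat_real {x<..} y * (indicat_real (?K n) y * g y) = indicat_real {?c<..<?d} y * g y"
        by eventually_elim (auto simp: indicator_def)
    qed
    also have "\<dots> = 0"
      by (rule interval_integral_zero_if_test_integrals_zero[OF g test]) (use pos in \<open>simp_all only: less_max_iff_disj, simp_all\<close>)
    finally show "(LINT y|lebesgue. indicat_real {x<..} y * (indicat_real (?K n) y * g y)) = 0" .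
  qed
  then have "AE x in lebesgue. \<forall>n. indicat_real (?K n) x * g x = 0"
    by (subst AE_all_countable) blast
  then have "AE x in lebesgue. x \<in> unit_ivl \<longrightarrow> g x = 0"
  proof eventually_elim
    case (elim x)
    show ?case
    proof
      assume x: "x \<in> unit_ivl"
      then obtain n where "inverse (real (Suc n)) < min x (1 - x)"
        using reals_Archimedean[of "min x (1 - x)"] by auto
      then have "x \<in> ?K n" by (auto simp: inverse_eq_divide add.commute)
      then show "g x = 0" using elim by (auto simp: indicator_def split: if_splits)
    qed
  qed
  then show ?thesis by (simp add: AE_restrict_space_iff)
qed

lemma locally_integrable_diff:
  assumes "locally_integrable f" "locally_integrable g"
  shows "locally_integrable (\<lambda>x. f x - g x)"
  using assms unfolding locally_integrable_def by (auto intro: set_integral_diff(1))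

lemma has_weak_derivD:
  "has_weak_deriv j v g \<Longrightarrow> test_function \<phi> \<Longrightarrow>
    (LINT x:unit_ivl|lebesgue. v x * (deriv ^^ j) \<phi> x) = (-1) ^ j * (LINT x:unit_ivl|lebesgue. g x * \<phi> x)"
  unfolding has_weak_deriv_def by blast

lemma has_weak_deriv_1D:
  assumes "has_weak_deriv 1 v g" "test_function \<phi>"
  shows "(LINT x:unit_ivl|lebesgue. v x * deriv \<phi> x) = - (LINT x:unit_ivl|lebesgue. g x * \<phi> x)"
  using has_weak_derivD[OF assms] by simp

lemma has_weak_deriv_unique:
  assumes "has_weak_deriv j v g" "has_weak_deriv j v h"
  shows "AE x in lebesgue_on unit_ivl. g x = h x"
proof -
  have loc: "locally_integrable g" "locally_integrable h"
    using assms unfolding has_weak_deriv_def by blast+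
  have "AE x in lebesgue_on unit_ivl. g x - h x = 0"
  proof (rule fundamental_lemma_calculus_of_variations[OF locally_integrable_diff[OF loc]])
    fix \<phi> assume \<phi>: "test_function \<phi>"
    have "(LINT x:unit_ivl|lebesgue. g x * \<phi> x) = (LINT x:unit_ivl|lebesgue. h x * \<phi> x)"
      using has_weak_derivD[OF assms(1) \<phi>] has_weak_derivD[OF assms(2) \<phi>] by simp
    then show "(LINT x:unit_ivl|lebesgue. (g x - h x) * \<phi> x) = 0"
      using locally_integrable_mult_test[OF loc(1) \<phi>] locally_integrable_mult_test[OF loc(2) \<phi>]
      by (simp add: set_lebesgue_integral_unit_ivl left_diff_distrib)
  qed
  then show ?thesis by simp
qed

lemma has_weak_deriv_0_self: "locally_integrable v \<Longrightarrow> has_weak_deriv 0 v v"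
  by (simp add: has_weak_deriv_def)

text \<open>Together with the next lemma this reduces weak derivatives of higher order to iterated first
  ones, which lets all analysis below be done one derivative at a time.\<close>

lemma has_weak_deriv_Suc_compose:
  assumes "has_weak_deriv j v g" "has_weak_deriv 1 g h"
  shows "has_weak_deriv (Suc j) v h"
proof -
  have loc: "locally_integrable v" "locally_integrable h"
    using assms unfolding has_weak_deriv_def by blast+
  have "(LINT x:unit_ivl|lebesgue. v x * (deriv ^^ Suc j) \<phi> x)
      = (-1) ^ Suc j * (LINT x:unit_ivl|lebesgue. h x * \<phi> x)" if \<phi>: "test_function \<phi>" for \<phi>
  proof -
    have "(LINT x:unit_ivl|lebesgue. v x * (deriv ^^ Suc j) \<phi> x)
        = (LINT x:unit_ivl|lebesgue. v x * (deriv ^^ j) (deriv \<phi>) x)"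
      by (simp add: funpow_swap1)
    also have "\<dots> = (-1) ^ j * (LINT x:unit_ivl|lebesgue. g x * deriv \<phi> x)"
      by (rule has_weak_derivD[OF assms(1) test_function_deriv[OF \<phi>]])
    also have "(LINT x:unit_ivl|lebesgue. g x * deriv \<phi> x) = - (LINT x:unit_ivl|lebesgue. h x * \<phi> x)"
      by (rule has_weak_deriv_1D[OF assms(2) \<phi>])
    finally show ?thesis by simp
  qed
  then show ?thesis using loc unfolding has_weak_deriv_def by blast
qed

lemma has_weak_deriv_Suc_decompose:
  assumes "has_weak_deriv j v g" "has_weak_deriv (Suc j) v h"
  shows "has_weak_deriv 1 g h"
proof -
  have loc: "locally_integrable g" "locally_integrable h"
    using assms unfolding has_weak_deriv_def by blast+
  have "(LINT x:unit_ivl|lebesgue. g x * (deriv ^^ 1) \<phi> x)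
      = (-1) ^ 1 * (LINT x:unit_ivl|lebesgue. h x * \<phi> x)" if \<phi>: "test_function \<phi>" for \<phi>
  proof -
    have "(-1) ^ j * (LINT x:unit_ivl|lebesgue. g x * deriv \<phi> x)
        = (LINT x:unit_ivl|lebesgue. v x * (deriv ^^ j) (deriv \<phi>) x)"
      by (rule has_weak_derivD[OF assms(1) test_function_deriv[OF \<phi>], symmetric])
    also have "\<dots> = (LINT x:unit_ivl|lebesgue. v x * (deriv ^^ Suc j) \<phi> x)"
      by (simp add: funpow_swap1)
    also have "\<dots> = (-1) ^ Suc j * (LINT x:unit_ivl|lebesgue. h x * \<phi> x)"
      by (rule has_weak_derivD[OF assms(2) \<phi>])
    finally have "(-1) ^ j * (LINT x:unit_ivl|lebesgue. g x * deriv \<phi> x)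
        = (-1) ^ j * (- (LINT x:unit_ivl|lebesgue. h x * \<phi> x))" by simp
    then show ?thesis by (simp only: mult_cancel_left) simp
  qed
  then show ?thesis using loc unfolding has_weak_deriv_def by blast
qed

lemma has_weak_deriv_smooth:
  assumes v: "smooth_on unit_ivl v"
  shows "has_weak_deriv 1 v (deriv v)"
proof -
  have loc: "locally_integrable f" if "smooth_on unit_ivl f" for f
    unfolding locally_integrable_def
  proof (intro allI impI)
    fix K assume K: "compact K \<and> K \<subseteq> unit_ivl"
    then have "continuous_on K f"
      using smooth_on_imp_continuous_on[OF that] continuous_on_subset by blast
    with K have "integrable lborel (\<lambda>x. indicator K x *\<^sub>R f x)"
      by (intro borel_integrable_compact) auto
    then show "set_integrable lebesgue K f"
      unfolding set_integrable_def by (subst integrable_completion) (auto dest: borel_measurable_integrable)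
  qed
  have "(LINT x:unit_ivl|lebesgue. v x * deriv \<phi> x) = - (LINT x:unit_ivl|lebesgue. deriv v x * \<phi> x)"
    if \<phi>: "test_function \<phi>" for \<phi>
  proof -
    have "(LINT x:unit_ivl|lebesgue. deriv (\<lambda>x. \<phi> x * v x) x) = 0"
      by (rule test_function_integral_deriv[OF test_function_mult[OF \<phi> v]])
    also have "(LINT x:unit_ivl|lebesgue. deriv (\<lambda>x. \<phi> x * v x) x)
        = (LINT x:unit_ivl|lebesgue. v x * deriv \<phi> x + deriv v x * \<phi> x)"
    proof (rule set_lebesgue_integral_cong)
      show "\<forall>x. x \<in> unit_ivl \<longrightarrow> deriv (\<lambda>x. \<phi> x * v x) x = v x * deriv \<phi> x + deriv v x * \<phi> x"
      proof (intro allI impI)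
        fix x assume "x \<in> unit_ivl"
        from DERIV_mult[OF smooth_on_has_derivative[OF test_function_smooth[OF \<phi>] this] smooth_on_has_derivative[OF v this]]
        show "deriv (\<lambda>x. \<phi> x * v x) x = v x * deriv \<phi> x + deriv v x * \<phi> x"
          by (rule DERIV_imp_deriv[THEN trans]) (simp add: mult.commute)
      qed
    qed simp
    also have "\<dots> = (LINT x:unit_ivl|lebesgue. v x * deriv \<phi> x) + (LINT x:unit_ivl|lebesgue. deriv v x * \<phi> x)"
      unfolding set_lebesgue_integral_unit_ivl
      by (intro Bochner_Integration.integral_add locally_integrable_mult_test loc v smooth_on_deriv \<phi> test_function_deriv)
    finally show ?thesis by simp
  qed
  then show ?thesis using loc[OF v] loc[OF smooth_on_deriv[OF v]] unfolding has_weak_deriv_def by simp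
qed

section \<open>The Jacobi weight\<close>

lemma rho_pos: "x \<in> unit_ivl \<Longrightarrow> 0 < rho a b x"
  by (simp add: rho_def)

lemma rho_nonneg: "0 \<le> rho a b x"
  by (simp add: rho_def)

lemma rho_mult: "x \<in> unit_ivl \<Longrightarrow> rho a b x * rho c d x = rho (a + c) (b + d) x"
  by (simp add: rho_def powr_add)

lemma rho_0: "x \<in> unit_ivl \<Longrightarrow> rho 0 0 x = 1"
  by (simp add: rho_def)

lemma rho_plus_1: "x \<in> unit_ivl \<Longrightarrow> rho (a + 1) (b + 1) x = rho a b x * (x * (1 - x))"
  by (simp add: rho_def powr_add)

lemma smooth_on_rho: "smooth_on unit_ivl (rho a b)"
proof -
  have "smooth_on unit_ivl (\<lambda>x. ((- 1) * x + 1) powr a)" "smooth_on unit_ivl (\<lambda>x. (1 * x + 0) powr b)"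
    using smooth_on_affine[OF open_greaterThan smooth_on_powr, of "-1" 1 a]
      smooth_on_affine[OF open_greaterThan smooth_on_powr, of 1 0 b]
    by (auto intro: smooth_on_subset)
  from smooth_on_mult[OF _ this] have "smooth_on unit_ivl (\<lambda>x. (- x + 1) powr a * x powr b)" by simp
  moreover have "(\<lambda>x. (- x + 1) powr a * x powr b) = rho a b" by (simp add: rho_def fun_eq_iff)
  ultimately show ?thesis by simp
qed

text \<open>With the weight absorbed into the measure, the weighted spaces are the \<open>L\<^sup>2\<close> spaces of finite
  measures, to which the expansion theorem applies.\<close>

definition jacobi_measure :: "real \<Rightarrow> real \<Rightarrow> real measure" where
  "jacobi_measure a b = density (lebesgue_on unit_ivl) (\<lambda>x. ennreal (rho a b x))"

abbreviation jacobi_L2 :: "real \<Rightarrow> real \<Rightarrow> (real \<Rightarrow> real) \<Rightarrow> bool" where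
  "jacobi_L2 a b \<equiv> sq_integrable (jacobi_measure a b)"

abbreviation jacobi_inner :: "real \<Rightarrow> real \<Rightarrow> (real \<Rightarrow> real) \<Rightarrow> (real \<Rightarrow> real) \<Rightarrow> real" where
  "jacobi_inner a b \<equiv> inner_L2 (jacobi_measure a b)"

lemma rho_measurable: "rho a b \<in> unit_measurable"
  by (rule continuous_on_measurable_unit_ivl[OF smooth_on_imp_continuous_on[OF smooth_on_rho]])

lemma space_jacobi_measure [simp]: "space (jacobi_measure a b) = unit_ivl"
  by (simp add: jacobi_measure_def)

lemma measurable_jacobi_measure [simp]:
  "borel_measurable (jacobi_measure a b) = unit_measurable"
  by (rule measurable_cong_sets) (simp_all add: jacobi_measure_def)

lemma integral_jacobi_measure:
  fixes f :: "real \<Rightarrow> real"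
  assumes "f \<in> unit_measurable"
  shows "integral\<^sup>L (jacobi_measure a b) f = (LINT x|lebesgue_on unit_ivl. rho a b x * f x)"
  unfolding jacobi_measure_def
  using integral_density[OF assms rho_measurable AE_I2, of a b] by (simp add: rho_nonneg)

lemma integrable_jacobi_measure:
  fixes f :: "real \<Rightarrow> real"
  assumes "f \<in> unit_measurable"
  shows "integrable (jacobi_measure a b) f \<longleftrightarrow> integrable (lebesgue_on unit_ivl) (\<lambda>x. rho a b x * f x)"
  unfolding jacobi_measure_def
  using integrable_density[OF assms rho_measurable AE_I2, of a b] by (simp add: rho_nonneg)

lemma AE_jacobi_measure:
  "(AE x in jacobi_measure a b. P x) \<longleftrightarrow> (AE x in lebesgue_on unit_ivl. P x)"
proof -
  have "(AE x in jacobi_measure a b. P x) \<longleftrightarrow> (AE x in lebesgue_on unit_ivl. 0 < ennreal (rho a b x) \<longrightarrow> P x)"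
    unfolding jacobi_measure_def using rho_measurable by (intro AE_density) simp
  also have "\<dots> \<longleftrightarrow> (AE x in lebesgue_on unit_ivl. P x)"
    by (rule AE_cong) (use rho_pos in auto)
  finally show ?thesis .
qed

lemma finite_measure_jacobi:
  assumes "a > -1" "b > -1"
  shows "finite_measure (jacobi_measure a b)"
proof
  have "set_integrable lborel {0..1} (\<lambda>t. t powr ((b + 1) - 1) * (1 - t) powr ((a + 1) - 1))"
    using assms by (intro integrable_Beta) auto
  then have "integrable lborel (\<lambda>x. indicat_real {0..1} x * rho a b x)"
    by (simp add: set_integrable_def rho_def mult.commute)
  then have "integrable lebesgue (\<lambda>x. indicat_real {0..1} x * rho a b x)"
    by (subst integrable_completion) (auto dest: borel_measurable_integrable)
  then have "integrable lebesgue (\<lambda>x. indicat_real unit_ivl x *\<^sub>R (indicat_real {0..1} x * rho a b x))"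
    by (intro integrable_mult_indicator) auto
  moreover have "(\<lambda>x. indicat_real unit_ivl x *\<^sub>R (indicat_real {0..1} x * rho a b x))
      = (\<lambda>x. indicat_real unit_ivl x *\<^sub>R rho a b x)"
    by (auto simp: indicator_def fun_eq_iff)
  ultimately have "integrable (lebesgue_on unit_ivl) (rho a b)"
    by (simp add: integrable_restrict_space)
  then have "integrable (jacobi_measure a b) (\<lambda>x. 1 :: real)"
    by (simp add: integrable_jacobi_measure)
  then show "emeasure (jacobi_measure a b) (space (jacobi_measure a b)) \<noteq> \<infinity>"
    by (simp add: integrable_iff_bounded less_top)
qed

lemma sq_integrable_jacobi:
  "jacobi_L2 a b f \<longleftrightarrow> f \<in> weighted_L2 (rho a b)"
proof -
  have "(\<lambda>x. (f x)\<^sup>2) \<in> unit_measurable"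
    if "f \<in> unit_measurable" using that by measurable
  then show ?thesis
    unfolding sq_integrable_def weighted_L2_def set_integrable_unit_ivl
    by (auto simp: integrable_jacobi_measure)
qed

lemma weighted_norm_jacobi:
  assumes "f \<in> unit_measurable"
  shows "weighted_norm (rho a b) f = sqrt (jacobi_inner a b f f)"
proof -
  have "(\<lambda>x. f x * f x) \<in> unit_measurable"
    using assms by measurable
  then show ?thesis
    by (simp add: weighted_norm_def inner_L2_def set_lebesgue_integral_unit_ivl integral_jacobi_measure power2_eq_square)
qed

lemma jacobi_L2_measurable:
  "jacobi_L2 a b f \<Longrightarrow> f \<in> unit_measurable"
  by (simp add: sq_integrable_def)

lemma inner_jacobi:
  assumes "f \<in> unit_measurable" "g \<in> unit_measurable"
  shows "jacobi_inner a b f g = (LINT x|lebesgue_on unit_ivl. rho a b x * (f x * g x))"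
  unfolding inner_L2_def using assms by (intro integral_jacobi_measure) measurable

lemma sq_integrable_AE_cong:
  assumes "sq_integrable M f" "g \<in> borel_measurable M" "AE x in M. f x = g x"
  shows "sq_integrable M g"
  unfolding sq_integrable_def
proof
  have "integrable M (\<lambda>x. (f x)\<^sup>2) \<longleftrightarrow> integrable M (\<lambda>x. (g x)\<^sup>2)"
    by (rule integrable_cong_AE) (use assms in \<open>auto simp: sq_integrable_def\<close>)
  then show "integrable M (\<lambda>x. (g x)\<^sup>2)" using assms(1) by (simp add: sq_integrable_def)
qed fact

text \<open>On compact subsets of the open interval the weight is bounded below by some \<open>c > 0\<close>, and
  \<open>\<bar>f\<bar> \<le> 1 + f\<^sup>2 \<le> 1 + \<rho> f\<^sup>2 / c\<close>.\<close>

lemma jacobi_L2_locally_integrable: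
  assumes f: "jacobi_L2 a b f"
  shows "locally_integrable f"
  unfolding locally_integrable_def
proof (intro allI impI)
  fix K assume K: "compact K \<and> K \<subseteq> unit_ivl"
  have "continuous_on K (rho a b)"
    using K smooth_on_imp_continuous_on[OF smooth_on_rho] continuous_on_subset by blast
  have "\<exists>c>0. \<forall>x\<in>K. c \<le> rho a b x"
  proof (cases "K = {}")
    case False
    then obtain x where "x \<in> K" "\<forall>y\<in>K. rho a b x \<le> rho a b y"
      using continuous_attains_inf[of K "rho a b"] K \<open>continuous_on K (rho a b)\<close> by blast
    then show ?thesis using K rho_pos[of x a b] by blast
  qed (auto intro: exI[of _ 1])
  then obtain c where c: "c > 0" "\<And>x. x \<in> K \<Longrightarrow> c \<le> rho a b x" by blast
  have KL: "K \<in> sets lebesgue" using K borel_compact[of K] sets_completionI_sets[of K lborel] by simp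
  have fm: "f \<in> unit_measurable" by (rule jacobi_L2_measurable[OF f])
  have int: "integrable lebesgue (\<lambda>x. indicat_real unit_ivl x * (rho a b x * (f x)\<^sup>2))"
    using f unfolding sq_integrable_jacobi weighted_L2_def set_integrable_def by simp
  have meas: "(\<lambda>x. indicat_real K x *\<^sub>R f x) \<in> borel_measurable lebesgue"
  proof -
    have "(\<lambda>x. indicat_real unit_ivl x *\<^sub>R f x) \<in> borel_measurable lebesgue"
      using fm by (simp add: borel_measurable_restrict_space_iff)
    then have "(\<lambda>x. indicat_real K x * (indicat_real unit_ivl x *\<^sub>R f x)) \<in> borel_measurable lebesgue"
      using KL by (intro borel_measurable_times borel_measurable_indicator)
    moreover have "(\<lambda>x. indicat_real K x * (indicat_real unit_ivl x *\<^sub>R f x)) = (\<lambda>x. indicat_real K x *\<^sub>R f x)"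
      using K by (auto simp: indicator_def fun_eq_iff)
    ultimately show ?thesis by simp
  qed
  show "set_integrable lebesgue K f"
    unfolding set_integrable_def
  proof (rule Bochner_Integration.integrable_bound[OF _ meas])
    have "integrable lebesgue (indicat_real unit_ivl)"
      by (simp add: integrable_indicator_iff)
    then show "integrable lebesgue (\<lambda>x. indicat_real unit_ivl x + inverse c * (indicat_real unit_ivl x * (rho a b x * (f x)\<^sup>2)))"
      using int by (intro Bochner_Integration.integrable_add integrable_mult_right)
    show "AE x in lebesgue. norm (indicat_real K x *\<^sub>R f x)
        \<le> norm (indicat_real unit_ivl x + inverse c * (indicat_real unit_ivl x * (rho a b x * (f x)\<^sup>2)))"
    proof (rule AE_I2)
      fix x
      show "norm (indicat_real K x *\<^sub>R f x)
        \<le> norm (indicat_real unit_ivl x + inverse c * (indicat_real unit_ivl x * (rho a b x * (f x)\<^sup>2)))"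
      proof (cases "x \<in> K")
        case True
        then have x: "x \<in> unit_ivl" using K by blast
        have "0 \<le> (\<bar>f x\<bar> - 1)\<^sup>2" by simp
        then have "2 * \<bar>f x\<bar> \<le> 1 + (f x)\<^sup>2" by (simp add: power2_diff)
        moreover have "0 \<le> \<bar>f x\<bar>" by simp
        ultimately have "\<bar>f x\<bar> \<le> 1 + (f x)\<^sup>2" by linarith
        moreover have "(f x)\<^sup>2 \<le> inverse c * (rho a b x * (f x)\<^sup>2)"
        proof -
          have "c * (f x)\<^sup>2 \<le> rho a b x * (f x)\<^sup>2" using c(2)[OF True] by (intro mult_right_mono) auto
          then show ?thesis using c(1) by (simp add: field_simps)
        qed
        moreover have "0 \<le> inverse c * (rho a b x * (f x)\<^sup>2)" using c(1) rho_nonneg[of a b x] by simp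
        ultimately show ?thesis using True x by simp
      qed simp
    qed
  qed
qed

text \<open>Unweighted pairings with test functions are inner products with \<open>\<phi> / \<rho>\<close>, so they can be computed by
  Parseval's identity.\<close>

lemma jacobi_test_pairing:
  assumes ab: "a > -1" "b > -1" and \<phi>: "test_function \<phi>"
  shows "jacobi_L2 a b (\<lambda>x. \<phi> x * rho (- a) (- b) x)"
    and "f \<in> unit_measurable \<Longrightarrow>
      jacobi_inner a b f (\<lambda>x. \<phi> x * rho (- a) (- b) x) = (LINT x:unit_ivl|lebesgue. f x * \<phi> x)"
proof -
  let ?\<psi> = "\<lambda>x. \<phi> x * rho (- a) (- b) x"
  have t: "test_function ?\<psi>" by (rule test_function_mult[OF \<phi> smooth_on_rho])
  obtain B where "\<And>x. \<bar>?\<psi> x\<bar> \<le> B"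
    by (rule test_function_bounded[OF t]) (rule that)
  then show "jacobi_L2 a b ?\<psi>"
    by (intro sq_integrable_bounded[OF finite_measure_jacobi[OF ab]])
      (simp_all add: test_function_measurable[OF t])
  assume "f \<in> unit_measurable"
  then have "jacobi_inner a b f ?\<psi> = (LINT x|lebesgue_on unit_ivl. rho a b x * (f x * ?\<psi> x))"
    by (rule inner_jacobi[OF _ test_function_measurable[OF t]])
  also have "\<dots> = (LINT x|lebesgue_on unit_ivl. f x * \<phi> x)"
  proof (rule Bochner_Integration.integral_cong[OF refl])
    fix x assume "x \<in> space (lebesgue_on unit_ivl)"
    then have x: "x \<in> unit_ivl" by simp
    have "rho a b x * (f x * ?\<psi> x) = f x * \<phi> x * (rho a b x * rho (- a) (- b) x)" by simp
    also have "rho a b x * rho (- a) (- b) x = 1" using rho_mult[OF x, of a b "-a" "-b"] rho_0[OF x] by simp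
    finally show "rho a b x * (f x * ?\<psi> x) = f x * \<phi> x" by simp
  qed
  finally show "jacobi_inner a b f ?\<psi> = (LINT x:unit_ivl|lebesgue. f x * \<phi> x)"
    by (simp add: set_lebesgue_integral_unit_ivl)
qed

section \<open>Integration by parts against the weight\<close>

text \<open>With \<open>z = 1 / y\<close> the expression is \<open>(z + z\<^sup>2) exp (- z)\<close>, and \<open>z + z\<^sup>2 \<le> 2 exp z\<close>.\<close>

lemma bump_deriv_bounds:
  assumes "y > -1"
  shows "0 \<le> (y + 1) * deriv bump y" "(y + 1) * deriv bump y \<le> 2"
    "y > 0 \<Longrightarrow> (y + 1) * deriv bump y \<le> inverse y + inverse y * inverse y"
proof -
  show nonneg: "0 \<le> (y + 1) * deriv bump y"
    using assms by (simp add: deriv_bump bump_nonneg)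
  have eq: "(y + 1) * deriv bump y = (inverse y + inverse y * inverse y) * bump y" if "y > 0"
    using that by (simp add: deriv_bump field_simps power2_eq_square)
  show "(y + 1) * deriv bump y \<le> 2"
  proof (cases "y > 0")
    case True
    define z where "z = inverse y"
    have z: "z > 0" using True by (simp add: z_def)
    have "z + z * z \<le> 2 * exp z"
      using exp_lower_Taylor_quadratic[of z] z by (simp add: power2_eq_square)
    then have "(z + z * z) * exp (- z) \<le> 2 * exp z * exp (- z)"
      by (intro mult_right_mono) auto
    also have "\<dots> = 2" by (simp add: exp_minus)
    finally show ?thesis using True eq by (simp add: z_def bump_def inverse_eq_divide)
  qed (simp add: deriv_bump)
  show "(y + 1) * deriv bump y \<le> inverse y + inverse y * inverse y" if "y > 0"
    unfolding eq[OF that] using that bump_le_1[of y] by (intro mult_left_le) auto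
qed

lemma bump_deriv_tendsto_0: "((\<lambda>y. (y + 1) * deriv bump y) \<longlongrightarrow> 0) at_top"
proof (rule tendsto_sandwich[OF _ _ tendsto_const])
  show "\<forall>\<^sub>F y in at_top. 0 \<le> (y + 1) * deriv bump y"
    using eventually_gt_at_top[of "-1"] by eventually_elim (rule bump_deriv_bounds(1))
  show "\<forall>\<^sub>F y in at_top. (y + 1) * deriv bump y \<le> inverse y + inverse y * inverse y"
    using eventually_gt_at_top[of 0] by eventually_elim (rule bump_deriv_bounds(3), auto)
  have "((\<lambda>y::real. inverse y + inverse y * inverse y) \<longlongrightarrow> 0 + 0 * 0) at_top"
    by (intro tendsto_intros tendsto_inverse_0_at_top filterlim_ident)
  then show "((\<lambda>y::real. inverse y + inverse y * inverse y) \<longlongrightarrow> 0) at_top" by simp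
qed

text \<open>As \<open>n \<rightarrow> \<infinity>\<close> the cutoffs tend to \<open>1\<close> on the interval while each has compact support in it.\<close>

definition cutoff :: "real \<Rightarrow> real \<Rightarrow> real" where
  "cutoff n x = bump (n * x - 1) * bump (n * (1 - x) - 1)"

text \<open>This is \<open>x (1 - x)\<close> times the derivative of the cutoff. The derivative itself is of size \<open>n\<close> near
  the end points; the factor \<open>x (1 - x)\<close>, which is the quotient of the weights for \<open>(a + 1, b + 1)\<close> and
  \<open>(a, b)\<close>, compensates this. The expressions \<open>n x - 1 + 1\<close> are left as they are to display the
  bounded quantity \<open>(y + 1) deriv bump y\<close>.\<close>

definition cutoff_deriv :: "real \<Rightarrow> real \<Rightarrow> real" where
  "cutoff_deriv n x = (1 - x) * ((n * x - 1 + 1) * deriv bump (n * x - 1)) * bump (n * (1 - x) - 1)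
     - x * bump (n * x - 1) * ((n * (1 - x) - 1 + 1) * deriv bump (n * (1 - x) - 1))"

lemma smooth_on_cutoff: "smooth_on UNIV (cutoff n)"
proof -
  have "smooth_on UNIV (\<lambda>x. bump (n * x + (- 1)))" "smooth_on UNIV (\<lambda>x. bump ((- n) * x + (n - 1)))"
    using smooth_on_affine[OF open_UNIV smooth_on_bump, of n "- 1"]
      smooth_on_affine[OF open_UNIV smooth_on_bump, of "- n" "n - 1"] by simp_all
  from smooth_on_mult[OF _ this] have "smooth_on UNIV (\<lambda>x. bump (n * x + (- 1)) * bump ((- n) * x + (n - 1)))"
    by simp
  moreover have "(\<lambda>x. bump (n * x + (- 1)) * bump ((- n) * x + (n - 1))) = cutoff n"
    by (simp add: cutoff_def fun_eq_iff algebra_simps)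
  ultimately show ?thesis by simp
qed

lemma cutoff_has_derivative: "x * (1 - x) * deriv (cutoff n) x = cutoff_deriv n x"
proof -
  note bump_deriv = DERIV_chain2[where f = bump, OF smooth_on_has_derivative[OF smooth_on_bump UNIV_I]]
  have 1: "((\<lambda>x. bump (n * x - 1)) has_field_derivative deriv bump (n * x - 1) * n) (at x)"
    by (rule bump_deriv[where g = "\<lambda>x. n * x - 1"]) (auto intro!: derivative_eq_intros)
  have 2: "((\<lambda>x. bump (n * (1 - x) - 1)) has_field_derivative deriv bump (n * (1 - x) - 1) * (- n)) (at x)"
    by (rule bump_deriv[where g = "\<lambda>x. n * (1 - x) - 1"]) (auto intro!: derivative_eq_intros)
  have "deriv (cutoff n) x = deriv bump (n * x - 1) * n * bump (n * (1 - x) - 1)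
      + deriv bump (n * (1 - x) - 1) * (- n) * bump (n * x - 1)"
    unfolding cutoff_def[abs_def] by (rule DERIV_imp_deriv[OF DERIV_mult[OF 1 2]])
  moreover have "x * (1 - x) * (A * n * B + C * (- n) * D) = (1 - x) * (n * x * A) * B - x * D * (n * (1 - x) * C)"
    for A B C D
    by (simp add: algebra_simps)
  ultimately show ?thesis
    unfolding cutoff_deriv_def by (simp only: diff_add_cancel)
qed

lemma cutoff_zero:
  assumes "n > 0" "x \<notin> {1 / n .. 1 - 1 / n}" shows "cutoff n x = 0"
proof -
  have "n * x - 1 \<le> 0 \<or> n * (1 - x) - 1 \<le> 0"
    using assms by (auto simp: field_simps not_le)
  then show ?thesis by (auto simp: cutoff_def)
qed

lemma cutoff_bounds: "\<bar>cutoff n x\<bar> \<le> 1"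
  by (simp add: cutoff_def abs_mult bump_nonneg bump_le_1 mult_le_one)

lemma cutoff_deriv_bounds:
  assumes "n > 0" "x \<in> unit_ivl" shows "\<bar>cutoff_deriv n x\<bar> \<le> 4"
proof -
  have y: "n * x - 1 > -1" "n * (1 - x) - 1 > -1" using assms by auto
  have bound: "\<bar>u * v * w\<bar> \<le> 2" if "0 \<le> u" "u \<le> 1" "0 \<le> v" "v \<le> 1" "0 \<le> w" "w \<le> 2" for u v w :: real
  proof -
    have "\<bar>u * v * w\<bar> = (u * v) * w" using that by (simp add: abs_mult)
    also have "\<dots> \<le> 1 * 2" using that by (intro mult_mono mult_le_one) auto
    finally show ?thesis by simp
  qed
  have "\<bar>(1 - x) * bump (n * (1 - x) - 1) * ((n * x - 1 + 1) * deriv bump (n * x - 1))\<bar> \<le> 2"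
    by (rule bound) (use assms bump_deriv_bounds(1,2)[OF y(1)] bump_nonneg bump_le_1 in auto)
  moreover have "\<bar>x * bump (n * x - 1) * ((n * (1 - x) - 1 + 1) * deriv bump (n * (1 - x) - 1))\<bar> \<le> 2"
    by (rule bound) (use assms bump_deriv_bounds(1,2)[OF y(2)] bump_nonneg bump_le_1 in auto)
  ultimately show ?thesis
    by (simp add: cutoff_deriv_def abs_le_iff mult.assoc mult.commute mult.left_commute del: add_uminus_conv_diff)
qed

lemma cutoff_limits:
  assumes x: "x \<in> unit_ivl"
  shows "(\<lambda>i. cutoff (real (Suc i)) x) \<longlonglongrightarrow> 1" "(\<lambda>i. cutoff_deriv (real (Suc i)) x) \<longlonglongrightarrow> 0"
proof -
  have lim: "filterlim (\<lambda>i. real (Suc i) * y - 1) at_top sequentially" if "y > 0" for y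
  proof -
    have "filterlim (\<lambda>i. - 1 + real (Suc i) * y) at_top sequentially"
      using that by (intro filterlim_tendsto_add_at_top[OF tendsto_const]
        filterlim_at_top_mult_tendsto_pos[OF tendsto_const]
        filterlim_compose[OF filterlim_real_sequentially filterlim_Suc])
    then show ?thesis by (simp add: add.commute)
  qed
  have b: "(\<lambda>i. bump (real (Suc i) * y - 1)) \<longlonglongrightarrow> 1" if "y > 0" for y
    by (rule filterlim_compose[OF bump_tendsto_1 lim[OF that]])
  have d: "(\<lambda>i. (real (Suc i) * y - 1 + 1) * deriv bump (real (Suc i) * y - 1)) \<longlonglongrightarrow> 0" if "y > 0" for y
    by (rule filterlim_compose[OF bump_deriv_tendsto_0 lim[OF that]])
  have pos: "x > 0" "1 - x > 0" using x by auto
  show "(\<lambda>i. cutoff (real (Suc i)) x) \<longlonglongrightarrow> 1"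
    unfolding cutoff_def using tendsto_mult[OF b[OF pos(1)] b[OF pos(2)]] by simp
  have "(\<lambda>i. cutoff_deriv (real (Suc i)) x) \<longlonglongrightarrow> (1 - x) * 0 * 1 - x * 1 * 0"
    unfolding cutoff_deriv_def by (intro tendsto_diff tendsto_mult tendsto_const b d pos)
  then show "(\<lambda>i. cutoff_deriv (real (Suc i)) x) \<longlonglongrightarrow> 0" by simp
qed

text \<open>The weak derivative is tested with \<open>\<rho>\<^bsub>a+1,b+1\<^esub> p\<close>, which has no compact support, and
  whose derivative may be unbounded. Multiply by the cutoffs: the term in which the cutoff is
  differentiated is \<open>\<rho>\<^bsub>a,b\<^esub> p\<close> times \<^const>\<open>cutoff_deriv\<close>, which is bounded and tends to zero, so
  dominated convergence removes it. No boundary term survives, because the weight has gained one power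
  at each end point.\<close>

theorem weak_deriv_weighted_by_parts:
  assumes ab: "a > -1" "b > -1"
    and v: "jacobi_L2 a b v"
    and g: "jacobi_L2 (a + 1) (b + 1) g"
    and vg: "has_weak_deriv 1 v g"
    and p: "smooth_on unit_ivl p" "\<And>x. x \<in> unit_ivl \<Longrightarrow> \<bar>p x\<bar> \<le> B"
    and q: "continuous_on unit_ivl q" "\<And>x. x \<in> unit_ivl \<Longrightarrow> \<bar>q x\<bar> \<le> C"
    and pq: "\<And>x. x \<in> unit_ivl \<Longrightarrow>
      ((\<lambda>x. rho (a + 1) (b + 1) x * p x) has_field_derivative rho a b x * q x) (at x)"
  shows "jacobi_inner (a + 1) (b + 1) g p = - jacobi_inner a b v q"
proof -
  let ?L = "lebesgue_on unit_ivl"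
  let ?r = "rho (a + 1) (b + 1)"
  let ?n = "\<lambda>i. real (Suc i)"
  have vm: "v \<in> borel_measurable ?L" and gm: "g \<in> borel_measurable ?L"
    using v g by (auto intro: jacobi_L2_measurable)
  have pm: "p \<in> borel_measurable ?L"
    by (rule continuous_on_measurable_unit_ivl[OF smooth_on_imp_continuous_on[OF p(1)]])
  have qm: "q \<in> borel_measurable ?L"
    by (rule continuous_on_measurable_unit_ivl[OF q(1)])
  have cm: "cutoff n \<in> borel_measurable ?L" for n
    by (rule continuous_on_measurable_unit_ivl[OF smooth_on_imp_continuous_on[OF smooth_on_subset[OF smooth_on_cutoff]]]) simp
  have cdm: "cutoff_deriv n \<in> borel_measurable ?L" for n
  proof -
    have "(\<lambda>x. x * (1 - x) * deriv (cutoff n) x) \<in> borel_measurable ?L"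
    proof (rule continuous_on_measurable_unit_ivl)
      have "continuous_on unit_ivl (deriv (cutoff n))"
        by (rule smooth_on_imp_continuous_on[OF smooth_on_subset[OF smooth_on_deriv[OF smooth_on_cutoff]]]) simp
      then show "continuous_on unit_ivl (\<lambda>x. x * (1 - x) * deriv (cutoff n) x)"
        by (intro continuous_intros)
    qed
    then show ?thesis by (simp add: cutoff_has_derivative)
  qed
  have int1: "integrable ?L (\<lambda>x. \<bar>rho a b x * h x\<bar>)"
    if "a > -1" "b > -1" "jacobi_L2 a b h" for a b h
  proof -
    have "jacobi_L2 a b (\<lambda>x. 1)"
      by (rule sq_integrable_bounded[OF finite_measure_jacobi[OF that(1,2)], of _ 1]) auto
    from sq_integrable_mult[OF that(3) this] have "integrable (jacobi_measure a b) h" by simp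
    then show ?thesis
      using integrable_jacobi_measure[OF jacobi_L2_measurable[OF that(3)]] by (auto intro: integrable_abs)
  qed
  let ?\<phi> = "\<lambda>i x. cutoff (?n i) x * (?r x * p x)"
  have \<phi>: "test_function (?\<phi> i)" for i
  proof (rule test_functionI[of _ "{1 / ?n i .. 1 - 1 / ?n i}"])
    show "smooth_on unit_ivl (?\<phi> i)"
      by (intro smooth_on_mult smooth_on_rho p smooth_on_subset[OF smooth_on_cutoff]) auto
    show "?\<phi> i x = 0" if "x \<notin> {1 / ?n i .. 1 - 1 / ?n i}" for x
      using cutoff_zero[OF _ that] by simp
    have "1 / ?n i > 0" by simp
    then show "{1 / ?n i .. 1 - 1 / ?n i} \<subseteq> unit_ivl"
      unfolding subset_iff atLeastAtMost_iff greaterThanLessThan_iff by (intro allI impI) linarith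
  qed simp
  have \<phi>': "deriv (?\<phi> i) x = rho a b x * (q x * cutoff (?n i) x + p x * cutoff_deriv (?n i) x)"
    if x: "x \<in> unit_ivl" for i x
  proof -
    have "deriv (?\<phi> i) x = deriv (cutoff (?n i)) x * (?r x * p x) + rho a b x * q x * cutoff (?n i) x"
      by (rule DERIV_imp_deriv[OF DERIV_mult[OF smooth_on_has_derivative[OF smooth_on_cutoff UNIV_I] pq[OF x]]])
    also have "\<dots> = rho a b x * (q x * cutoff (?n i) x + p x * (x * (1 - x) * deriv (cutoff (?n i)) x))"
      unfolding rho_plus_1[OF x] by algebra
    finally show ?thesis by (simp only: cutoff_has_derivative)
  qed
  have eq: "(LINT x|?L. v x * deriv (?\<phi> i) x) = - (LINT x|?L. g x * ?\<phi> i x)" for i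
    using has_weak_deriv_1D[OF vg \<phi>[of i]] by (simp only: set_lebesgue_integral_unit_ivl)
  have lim_g: "(\<lambda>i. LINT x|?L. g x * ?\<phi> i x) \<longlonglongrightarrow> (LINT x|?L. g x * (1 * (?r x * p x)))"
  proof (rule integral_dominated_convergence[where w = "\<lambda>x. \<bar>B\<bar> * \<bar>?r x * g x\<bar>"])
    show "integrable ?L (\<lambda>x. \<bar>B\<bar> * \<bar>?r x * g x\<bar>)"
      using ab by (intro integrable_mult_right int1 g) auto
    show "AE x in ?L. (\<lambda>i. g x * ?\<phi> i x) \<longlonglongrightarrow> g x * (1 * (?r x * p x))"
      by (rule AE_I2) (intro tendsto_mult tendsto_const cutoff_limits, simp)
    show "AE x in ?L. norm (g x * ?\<phi> i x) \<le> \<bar>B\<bar> * \<bar>?r x * g x\<bar>" for i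
    proof (rule AE_I2)
      fix x assume "x \<in> space ?L"
      then have x: "\<bar>p x\<bar> \<le> \<bar>B\<bar>" using p(2)[of x] by fastforce
      have "norm (g x * ?\<phi> i x) = (\<bar>cutoff (?n i) x\<bar> * \<bar>p x\<bar>) * \<bar>?r x * g x\<bar>"
        by (simp add: abs_mult)
      also have "\<dots> \<le> (1 * \<bar>B\<bar>) * \<bar>?r x * g x\<bar>"
        using x cutoff_bounds by (intro mult_right_mono mult_mono) auto
      finally show "norm (g x * ?\<phi> i x) \<le> \<bar>B\<bar> * \<bar>?r x * g x\<bar>" by simp
    qed
  qed (intro borel_measurable_times borel_measurable_const gm pm cm rho_measurable)+
  have lim_v: "(\<lambda>i. LINT x|?L. v x * (rho a b x * (q x * cutoff (?n i) x + p x * cutoff_deriv (?n i) x)))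
      \<longlonglongrightarrow> (LINT x|?L. v x * (rho a b x * (q x * 1 + p x * 0)))"
  proof (rule integral_dominated_convergence[where w = "\<lambda>x. (\<bar>C\<bar> + \<bar>B\<bar> * 4) * \<bar>rho a b x * v x\<bar>"])
    show "integrable ?L (\<lambda>x. (\<bar>C\<bar> + \<bar>B\<bar> * 4) * \<bar>rho a b x * v x\<bar>)"
      using ab by (intro integrable_mult_right int1 v) auto
    show "AE x in ?L. (\<lambda>i. v x * (rho a b x * (q x * cutoff (?n i) x + p x * cutoff_deriv (?n i) x)))
        \<longlonglongrightarrow> v x * (rho a b x * (q x * 1 + p x * 0))"
      by (rule AE_I2) (intro tendsto_mult tendsto_add tendsto_const cutoff_limits, simp_all)
    show "AE x in ?L. norm (v x * (rho a b x * (q x * cutoff (?n i) x + p x * cutoff_deriv (?n i) x)))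
        \<le> (\<bar>C\<bar> + \<bar>B\<bar> * 4) * \<bar>rho a b x * v x\<bar>" for i
    proof (rule AE_I2)
      fix x assume "x \<in> space ?L"
      then have x: "x \<in> unit_ivl" by simp
      have "\<bar>p x\<bar> \<le> \<bar>B\<bar>" "\<bar>q x\<bar> \<le> \<bar>C\<bar>" using p(2)[OF x] q(2)[OF x] by linarith+
      then have "\<bar>q x\<bar> * \<bar>cutoff (?n i) x\<bar> \<le> \<bar>C\<bar> * 1" "\<bar>p x\<bar> * \<bar>cutoff_deriv (?n i) x\<bar> \<le> \<bar>B\<bar> * 4"
        using cutoff_bounds cutoff_deriv_bounds[OF _ x, of "?n i"] by (intro mult_mono; simp)+
      then have "\<bar>q x * cutoff (?n i) x + p x * cutoff_deriv (?n i) x\<bar> \<le> \<bar>C\<bar> + \<bar>B\<bar> * 4"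
        unfolding abs_mult[symmetric] by linarith
      then have "\<bar>q x * cutoff (?n i) x + p x * cutoff_deriv (?n i) x\<bar> * \<bar>rho a b x * v x\<bar>
          \<le> (\<bar>C\<bar> + \<bar>B\<bar> * 4) * \<bar>rho a b x * v x\<bar>"
        by (rule mult_right_mono) simp
      then show "norm (v x * (rho a b x * (q x * cutoff (?n i) x + p x * cutoff_deriv (?n i) x)))
        \<le> (\<bar>C\<bar> + \<bar>B\<bar> * 4) * \<bar>rho a b x * v x\<bar>"
        by (simp add: abs_mult mult_ac)
    qed
  qed (intro borel_measurable_times borel_measurable_add borel_measurable_const vm pm qm cm cdm rho_measurable)+
  have "(LINT x|?L. v x * deriv (?\<phi> i) x)
      = (LINT x|?L. v x * (rho a b x * (q x * cutoff (?n i) x + p x * cutoff_deriv (?n i) x)))" for i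
    by (rule Bochner_Integration.integral_cong[OF refl], subst \<phi>') simp_all
  with eq lim_v have "(\<lambda>i. - (LINT x|?L. g x * ?\<phi> i x)) \<longlonglongrightarrow> (LINT x|?L. v x * (rho a b x * (q x * 1 + p x * 0)))"
    by (simp only:)
  with tendsto_minus[OF lim_g] have "(LINT x|?L. v x * (rho a b x * (q x * 1 + p x * 0)))
      = - (LINT x|?L. g x * (1 * (?r x * p x)))"
    by (rule LIMSEQ_unique[rotated])
  then show ?thesis
    by (simp add: inner_jacobi[OF gm pm] inner_jacobi[OF vm qm] mult_ac)
qed

section \<open>Jacobi polynomials\<close>

lemma gbinomial_Suc_mult:
  "of_nat (Suc k) * (a gchoose Suc k) = (a - of_nat k) * (a gchoose k)"
  for a :: "'a :: field_char_0"
  by (simp only: gbinomial_absorption gbinomial_absorb_comp)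

lemma jacobi_G_sum:
  "jacobi_G a b j x = (\<Sum>k\<le>j. ((real j + a) gchoose (j - k)) * ((real j + b) gchoose k) *
     ((x - 1) ^ k * x ^ (j - k)))"
  by (simp add: jacobi_G_def jacobi_P_def mult.assoc diff_divide_distrib add_divide_distrib)

lemma jacobi_G_0: "jacobi_G a b 0 x = 1"
  by (simp add: jacobi_G_sum)

lemma jacobi_G_poly: "\<exists>p. jacobi_G a b j = poly p"
proof
  show "jacobi_G a b j = poly (\<Sum>k\<le>j. Polynomial.smult (((real j + a) gchoose (j - k)) * ((real j + b) gchoose k))
     ([:-1, 1:] ^ k * [:0, 1:] ^ (j - k)))"
    by (simp add: jacobi_G_sum poly_sum fun_eq_iff)
qed

lemma smooth_on_jacobi_G: "smooth_on S (jacobi_G a b j)"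
  using jacobi_G_poly[of a b j] smooth_on_subset[OF smooth_on_poly] by auto

lemma poly_bounded_on_unit_ivl:
  fixes p :: "real poly"
  obtains B where "\<And>x. x \<in> unit_ivl \<Longrightarrow> \<bar>poly p x\<bar> \<le> B"
proof -
  have "compact (poly p ` {0..1})" by (intro compact_continuous_image continuous_intros compact_Icc)
  then have "bounded (poly p ` {0..1})" by (rule compact_imp_bounded)
  then obtain B where "\<And>x. x \<in> {0..1} \<Longrightarrow> \<bar>poly p x\<bar> \<le> B"
    unfolding bounded_iff by force
  then show thesis using that[of B] by force
qed

lemma jacobi_G_bounded: obtains B where "\<And>x. x \<in> unit_ivl \<Longrightarrow> \<bar>jacobi_G a b j x\<bar> \<le> B"
proof -
  obtain p where p: "jacobi_G a b j = poly p" using jacobi_G_poly by blast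
  show thesis
    by (rule poly_bounded_on_unit_ivl[of p], rule that) (simp add: p)
qed

lemma sq_integrable_poly:
  assumes "a > -1" "b > -1"
  shows "jacobi_L2 a b (poly p)"
proof -
  obtain B where "\<And>x. x \<in> unit_ivl \<Longrightarrow> \<bar>poly p x\<bar> \<le> B"
    by (rule poly_bounded_on_unit_ivl) (rule that)
  then show ?thesis
    by (intro sq_integrable_bounded[OF finite_measure_jacobi[OF assms]])
      (simp_all add: continuous_on_measurable_unit_ivl continuous_on_poly)
qed

lemma sq_integrable_jacobi_G:
  assumes "a > -1" "b > -1"
  shows "jacobi_L2 a b (jacobi_G a' b' j)"
  using jacobi_G_poly[of a' b' j] sq_integrable_poly[OF assms] by auto

lemma jacobi_G_measurable: "jacobi_G a b j \<in> unit_measurable"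
  by (rule continuous_on_measurable_unit_ivl[OF smooth_on_imp_continuous_on[OF smooth_on_jacobi_G]])

lemma monomial_derivative:
  "((\<lambda>x::real. (x - 1) ^ k * x ^ l) has_field_derivative
     real k * ((x - 1) ^ (k - 1) * x ^ l) + real l * ((x - 1) ^ k * x ^ (l - 1))) (at x)"
  by (auto intro!: derivative_eq_intros)

text \<open>Differentiated termwise, both contributions to the monomial \<open>(x - 1)\<^sup>k x\<^sup>n\<^sup>-\<^sup>k\<close> are multiples of the coefficient
  \<open>d\<^sub>k\<close> of the Jacobi polynomial for \<open>(a + 1, b + 1)\<close>, and the factors add up to \<open>n + a + b + 2\<close>.\<close>

lemma jacobi_G_has_derivative:
  "(jacobi_G a b (Suc n) has_field_derivative (real n + a + b + 2) * jacobi_G (a + 1) (b + 1) n x) (at x)"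
proof -
  let ?A = "real (Suc n) + a" and ?B = "real (Suc n) + b"
  define c where "c k = (?A gchoose (Suc n - k)) * (?B gchoose k)" for k
  define d where "d k = (?A gchoose (n - k)) * (?B gchoose k)" for k
  let ?m = "\<lambda>k. (x - 1) ^ k * x ^ (n - k)"
  have "((\<lambda>x. \<Sum>k\<le>Suc n. c k * ((x - 1) ^ k * x ^ (Suc n - k))) has_field_derivative
      (\<Sum>k\<le>Suc n. c k * (real k * ((x - 1) ^ (k - 1) * x ^ (Suc n - k))
        + real (Suc n - k) * ((x - 1) ^ k * x ^ (Suc n - k - 1))))) (at x)"
    by (intro DERIV_sum DERIV_cmult monomial_derivative)
  also have "(\<lambda>x. \<Sum>k\<le>Suc n. c k * ((x - 1) ^ k * x ^ (Suc n - k))) = jacobi_G a b (Suc n)"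
    by (rule ext) (simp only: jacobi_G_sum c_def)
  also have "(\<Sum>k\<le>Suc n. c k * (real k * ((x - 1) ^ (k - 1) * x ^ (Suc n - k))
        + real (Suc n - k) * ((x - 1) ^ k * x ^ (Suc n - k - 1))))
      = (\<Sum>k\<le>Suc n. c k * (real k * ((x - 1) ^ (k - 1) * x ^ (Suc n - k))))
        + (\<Sum>k\<le>Suc n. c k * (real (Suc n - k) * ((x - 1) ^ k * x ^ (n - k))))"
    by (simp only: distrib_left sum.distrib) simp
  also have "(\<Sum>k\<le>Suc n. c k * (real k * ((x - 1) ^ (k - 1) * x ^ (Suc n - k))))
      = (\<Sum>k\<le>n. real (Suc k) * c (Suc k) * ?m k)"
    by (simp only: sum.atMost_Suc_shift) (simp add: algebra_simps)
  also have "(\<Sum>k\<le>Suc n. c k * (real (Suc n - k) * ((x - 1) ^ k * x ^ (n - k))))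
      = (\<Sum>k\<le>n. real (Suc n - k) * c k * ?m k)"
    by (simp add: mult_ac)
  also have "(\<Sum>k\<le>n. real (Suc k) * c (Suc k) * ?m k) + (\<Sum>k\<le>n. real (Suc n - k) * c k * ?m k)
      = (\<Sum>k\<le>n. (real n + a + b + 2) * (d k * ?m k))"
    unfolding sum.distrib[symmetric]
  proof (rule sum.cong[OF refl])
    fix k assume "k \<in> {..n}"
    then have k: "k \<le> n" by simp
    have 1: "real (Suc k) * c (Suc k) = (?B - real k) * d k"
      using gbinomial_Suc_mult[of k ?B] by (simp add: c_def d_def mult_ac)
    have "real (Suc (n - k)) * (?A gchoose Suc (n - k)) = (?A - real (n - k)) * (?A gchoose (n - k))"
      by (rule gbinomial_Suc_mult)
    then have 2: "real (Suc n - k) * c k = (?A - real (n - k)) * d k"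
      using k by (simp add: c_def d_def Suc_diff_le mult_ac)
    have "?B - real k + (?A - real (n - k)) = real n + a + b + 2"
      using k by (simp add: of_nat_diff)
    then show "real (Suc k) * c (Suc k) * ?m k + real (Suc n - k) * c k * ?m k
        = (real n + a + b + 2) * (d k * ?m k)"
      unfolding 1 2 by (metis distrib_right mult.assoc)
  qed
  also have "\<dots> = (real n + a + b + 2) * jacobi_G (a + 1) (b + 1) n x"
    by (simp add: jacobi_G_sum d_def sum_distrib_left add_ac)
  finally show ?thesis .
qed

text \<open>One step of Rodrigues' formula, again by comparing coefficients. It is the adjoint counterpart of
  the previous lemma; the two together give orthogonality, ratios of norms and the action of derivatives on
  coefficients, without recourse to the differential equation.\<close>

lemma weighted_jacobi_G_has_derivative:
  assumes x: "x \<in> unit_ivl"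
  shows "((\<lambda>x. rho (a + 1) (b + 1) x * jacobi_G (a + 1) (b + 1) n x) has_field_derivative
    rho a b x * (- (real (Suc n) * jacobi_G a b (Suc n) x))) (at x)"
proof -
  let ?A = "real (Suc n) + a" and ?B = "real (Suc n) + b"
  define d where "d k = (?A gchoose (n - k)) * (?B gchoose k)" for k
  define c where "c k = (?A gchoose (Suc n - k)) * (?B gchoose k)" for k
  let ?M = "\<lambda>k. (x - 1) ^ k * x ^ (Suc n - k)"
  have G: "jacobi_G (a + 1) (b + 1) n = (\<lambda>x. \<Sum>k\<le>n. d k * ((x - 1) ^ k * x ^ (n - k)))"
    by (simp add: jacobi_G_sum d_def fun_eq_iff add_ac)
  have rho: "(rho (a + 1) (b + 1) has_field_derivative rho a b x * ((b + 1) * (1 - x) - (a + 1) * x)) (at x)"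
  proof -
    have "((\<lambda>x. (1 - x) powr (a + 1) * x powr (b + 1)) has_field_derivative
        ((a + 1) * (1 - x) powr (a + 1 - 1) * (- 1)) * x powr (b + 1)
        + ((b + 1) * x powr (b + 1 - 1)) * (1 - x) powr (a + 1)) (at x)"
      using x by (intro DERIV_mult) (auto intro!: derivative_eq_intros)
    moreover have "((a + 1) * (1 - x) powr (a + 1 - 1) * (- 1)) * x powr (b + 1)
        + ((b + 1) * x powr (b + 1 - 1)) * (1 - x) powr (a + 1)
        = rho a b x * ((b + 1) * (1 - x) - (a + 1) * x)"
      using x by (simp add: rho_def powr_add algebra_simps)
    ultimately show ?thesis by (simp add: rho_def[abs_def])
  qed
  define D where "D = (\<Sum>k\<le>n. d k * (real k * ((x - 1) ^ (k - 1) * x ^ (n - k))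
        + real (n - k) * ((x - 1) ^ k * x ^ (n - k - 1))))"
  have D: "(jacobi_G (a + 1) (b + 1) n has_field_derivative D) (at x)"
    unfolding G D_def by (intro DERIV_sum DERIV_cmult monomial_derivative)
  have "x * (1 - x) * D + ((b + 1) * (1 - x) - (a + 1) * x) * jacobi_G (a + 1) (b + 1) n x
      = (\<Sum>k\<le>n. - (real (Suc n - k) * c k * ?M k) - real (Suc k) * c (Suc k) * ?M (Suc k))"
    unfolding D_def G sum_distrib_left sum.distrib[symmetric]
  proof (rule sum.cong[OF refl])
    fix k assume "k \<in> {..n}"
    then have k: "k \<le> n" by simp
    have 1: "real (Suc k) * c (Suc k) = (?B - real k) * d k"
      using gbinomial_Suc_mult[of k ?B] by (simp add: c_def d_def mult_ac)
    have "real (Suc (n - k)) * (?A gchoose Suc (n - k)) = (?A - real (n - k)) * (?A gchoose (n - k))"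
      by (rule gbinomial_Suc_mult)
    then have 2: "real (Suc n - k) * c k = (?A - real (n - k)) * d k"
      using k by (simp add: c_def d_def Suc_diff_le mult_ac)
    have e1: "(1 - x) * (real k * (x - 1) ^ (k - 1)) = - real k * (x - 1) ^ k"
      by (cases k) (auto simp: algebra_simps)
    have e2: "x * (real (n - k) * x ^ (n - k - 1)) = real (n - k) * x ^ (n - k)"
      by (cases "n - k") auto
    have "x * (1 - x) * (d k * (real k * ((x - 1) ^ (k - 1) * x ^ (n - k))
          + real (n - k) * ((x - 1) ^ k * x ^ (n - k - 1))))
        = d k * (((1 - x) * (real k * (x - 1) ^ (k - 1))) * (x * x ^ (n - k))
          + (1 - x) * (x - 1) ^ k * (x * (real (n - k) * x ^ (n - k - 1))))"
      by (simp add: algebra_simps)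
    also have "\<dots> = d k * ((- real k * (x - 1) ^ k) * (x * x ^ (n - k))
          + (1 - x) * (x - 1) ^ k * (real (n - k) * x ^ (n - k)))"
      by (simp only: e1 e2)
    finally have "x * (1 - x) * (d k * (real k * ((x - 1) ^ (k - 1) * x ^ (n - k))
          + real (n - k) * ((x - 1) ^ k * x ^ (n - k - 1))))
        + ((b + 1) * (1 - x) - (a + 1) * x) * (d k * ((x - 1) ^ k * x ^ (n - k)))
        = - ((a + 1 + real k) * d k * ((x - 1) ^ k * (x * x ^ (n - k))))
          - (b + 1 + real (n - k)) * d k * ((x - 1) * (x - 1) ^ k * x ^ (n - k))"
      by (simp add: algebra_simps)
    also have "a + 1 + real k = ?A - real (n - k)" using k by (simp add: of_nat_diff)
    also have "b + 1 + real (n - k) = ?B - real k" using k by (simp add: of_nat_diff)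
    also have "x * x ^ (n - k) = x ^ (Suc n - k)" using k by (simp add: Suc_diff_le)
    finally show "x * (1 - x) * (d k * (real k * ((x - 1) ^ (k - 1) * x ^ (n - k))
          + real (n - k) * ((x - 1) ^ k * x ^ (n - k - 1))))
        + ((b + 1) * (1 - x) - (a + 1) * x) * (d k * ((x - 1) ^ k * x ^ (n - k)))
        = - (real (Suc n - k) * c k * ?M k) - real (Suc k) * c (Suc k) * ?M (Suc k)"
      unfolding 1 2 by simp
  qed
  also have "\<dots> = - ((\<Sum>k\<le>n. real (Suc n - k) * c k * ?M k) + (\<Sum>k\<le>n. real (Suc k) * c (Suc k) * ?M (Suc k)))"
    by (simp add: sum_subtractf sum_negf)
  also have "(\<Sum>k\<le>n. real (Suc n - k) * c k * ?M k) = (\<Sum>k\<le>Suc n. real (Suc n - k) * c k * ?M k)"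
    by simp
  also have "(\<Sum>k\<le>n. real (Suc k) * c (Suc k) * ?M (Suc k)) = (\<Sum>k\<le>Suc n. real k * c k * ?M k)"
    by (subst sum.atMost_Suc_shift) simp
  also have "(\<Sum>k\<le>Suc n. real (Suc n - k) * c k * ?M k) + (\<Sum>k\<le>Suc n. real k * c k * ?M k)
      = (\<Sum>k\<le>Suc n. real (Suc n) * (c k * ?M k))"
    unfolding sum.distrib[symmetric] by (intro sum.cong refl) (auto simp: of_nat_diff algebra_simps)
  also have "\<dots> = real (Suc n) * jacobi_G a b (Suc n) x"
    by (simp only: jacobi_G_sum c_def sum_distrib_left)
  finally have main: "x * (1 - x) * D + ((b + 1) * (1 - x) - (a + 1) * x) * jacobi_G (a + 1) (b + 1) n x
      = - (real (Suc n) * jacobi_G a b (Suc n) x)" .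
  have "((\<lambda>x. rho (a + 1) (b + 1) x * jacobi_G (a + 1) (b + 1) n x) has_field_derivative
      rho a b x * ((b + 1) * (1 - x) - (a + 1) * x) * jacobi_G (a + 1) (b + 1) n x
      + D * rho (a + 1) (b + 1) x) (at x)"
    by (rule DERIV_mult[OF rho D])
  also have "rho a b x * ((b + 1) * (1 - x) - (a + 1) * x) * jacobi_G (a + 1) (b + 1) n x
      + D * rho (a + 1) (b + 1) x = rho a b x * (- (real (Suc n) * jacobi_G a b (Suc n) x))"
    unfolding main[symmetric] rho_plus_1[OF x] by (simp add: algebra_simps)
  finally show ?thesis .
qed

section \<open>Orthogonality and completeness\<close>

text \<open>The key relation between the expansions of a function and of its weak derivative.\<close>

lemma inner_jacobi_weak_deriv:
  assumes ab: "a > -1" "b > -1"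
    and v: "jacobi_L2 a b v"
    and g: "jacobi_L2 (a + 1) (b + 1) g"
    and vg: "has_weak_deriv 1 v g"
  shows "jacobi_inner (a + 1) (b + 1) g (jacobi_G (a + 1) (b + 1) n)
    = real (Suc n) * jacobi_inner a b v (jacobi_G a b (Suc n))"
proof -
  obtain B where B: "\<And>x. x \<in> unit_ivl \<Longrightarrow> \<bar>jacobi_G (a + 1) (b + 1) n x\<bar> \<le> B"
    by (rule jacobi_G_bounded) (rule that)
  obtain C where C: "\<And>x. x \<in> unit_ivl \<Longrightarrow> \<bar>jacobi_G a b (Suc n) x\<bar> \<le> C"
    by (rule jacobi_G_bounded) (rule that)
  have "jacobi_inner (a + 1) (b + 1) g (jacobi_G (a + 1) (b + 1) n)
      = - jacobi_inner a b v (\<lambda>x. - (real (Suc n) * jacobi_G a b (Suc n) x))"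
  proof (rule weak_deriv_weighted_by_parts[OF ab v g vg smooth_on_jacobi_G B])
    show "continuous_on unit_ivl (\<lambda>x. - (real (Suc n) * jacobi_G a b (Suc n) x))"
      by (intro continuous_intros smooth_on_imp_continuous_on[OF smooth_on_jacobi_G])
    show "\<bar>- (real (Suc n) * jacobi_G a b (Suc n) x)\<bar> \<le> real (Suc n) * C" if "x \<in> unit_ivl" for x
      unfolding abs_minus_cancel abs_mult using C[OF that] by (intro mult_mono) auto
  qed (use weighted_jacobi_G_has_derivative in auto)
  also have "(\<lambda>x. - (real (Suc n) * jacobi_G a b (Suc n) x)) = (\<lambda>x. (- real (Suc n)) * jacobi_G a b (Suc n) x)"
    by (simp only: mult_minus_left)
  finally show ?thesis
    unfolding inner_L2_commute[of _ v] inner_L2_cmult by (simp add: algebra_simps)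
qed

lemma has_weak_deriv_jacobi_G:
  "has_weak_deriv 1 (jacobi_G a b (Suc n)) (\<lambda>x. (real n + a + b + 2) * jacobi_G (a + 1) (b + 1) n x)"
proof -
  have "deriv (jacobi_G a b (Suc n)) = (\<lambda>x. (real n + a + b + 2) * jacobi_G (a + 1) (b + 1) n x)"
    by (rule ext) (rule DERIV_imp_deriv[OF jacobi_G_has_derivative])
  then show ?thesis using has_weak_deriv_smooth[OF smooth_on_jacobi_G] by metis
qed

lemma inner_jacobi_G_deriv:
  assumes ab: "a > -1" "b > -1"
  shows "real (Suc n) * jacobi_inner a b (jacobi_G a b (Suc i)) (jacobi_G a b (Suc n))
    = (real i + a + b + 2) * jacobi_inner (a + 1) (b + 1) (jacobi_G (a + 1) (b + 1) i) (jacobi_G (a + 1) (b + 1) n)"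
proof -
  have ab1: "a + 1 > -1" "b + 1 > -1" using ab by auto
  show ?thesis
    using inner_jacobi_weak_deriv[OF ab sq_integrable_jacobi_G[OF ab]
        sq_integrable_cmult[OF sq_integrable_jacobi_G[OF ab1]] has_weak_deriv_jacobi_G[of a b i], of n]
    by (simp only: inner_L2_cmult)
qed

text \<open>Induction over the degree: applied to Jacobi polynomials, the key relation lowers both degrees by
  one while raising both parameters.\<close>

lemma jacobi_G_orthogonal_less:
  "a > -1 \<Longrightarrow> b > -1 \<Longrightarrow> i < j \<Longrightarrow> jacobi_inner a b (jacobi_G a b i) (jacobi_G a b j) = 0"
proof (induction j arbitrary: i a b)
  case (Suc n)
  show ?case
  proof (cases i)
    case 0
    have G0: "jacobi_G a b 0 = (\<lambda>x. 1)" by (simp add: jacobi_G_0 fun_eq_iff)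
    have "has_weak_deriv 1 (jacobi_G a b 0) (\<lambda>x. 0)"
      using has_weak_deriv_smooth[OF smooth_on_jacobi_G, of a b 0] unfolding G0 by simp
    then have "jacobi_inner (a + 1) (b + 1) (\<lambda>x. 0) (jacobi_G (a + 1) (b + 1) n)
      = real (Suc n) * jacobi_inner a b (jacobi_G a b 0) (jacobi_G a b (Suc n))"
      by (intro inner_jacobi_weak_deriv sq_integrable_jacobi_G)
        (use Suc.prems in \<open>auto simp: sq_integrable_def\<close>)
    then show ?thesis using 0 by (simp add: inner_L2_def)
  next
    case (Suc i')
    then show ?thesis
      using inner_jacobi_G_deriv[OF Suc.prems(1,2), of n i'] Suc.IH[of "a + 1" "b + 1" i'] Suc.prems
      by simp
  qed
qed simp

lemma jacobi_G_orthogonal: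
  assumes "a > -1" "b > -1" "i \<noteq> j"
  shows "jacobi_inner a b (jacobi_G a b i) (jacobi_G a b j) = 0"
  using assms jacobi_G_orthogonal_less[of a b i j] jacobi_G_orthogonal_less[of a b j i]
  by (cases i j rule: linorder_cases) (auto simp: inner_L2_commute)

definition jacobi_norm_sq :: "real \<Rightarrow> real \<Rightarrow> nat \<Rightarrow> real" where
  "jacobi_norm_sq a b j = jacobi_inner a b (jacobi_G a b j) (jacobi_G a b j)"

text \<open>Besides positivity, only the ratio of norms at neighbouring parameters matters below, so closed forms in terms of
  the Gamma function are avoided.\<close>

lemma jacobi_norm_sq_Suc:
  assumes ab: "a > -1" "b > -1"
  shows "real (Suc n) * jacobi_norm_sq a b (Suc n) = (real n + a + b + 2) * jacobi_norm_sq (a + 1) (b + 1) n"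
  unfolding jacobi_norm_sq_def by (rule inner_jacobi_G_deriv[OF ab])

lemma jacobi_norm_sq_pos: "a > -1 \<Longrightarrow> b > -1 \<Longrightarrow> 0 < jacobi_norm_sq a b j"
proof (induction j arbitrary: a b)
  case 0
  interpret finite_measure "jacobi_measure a b" by (rule finite_measure_jacobi[OF 0])
  have "jacobi_norm_sq a b 0 = measure (jacobi_measure a b) unit_ivl"
    by (simp add: jacobi_norm_sq_def inner_L2_def jacobi_G_0)
  moreover have "measure (jacobi_measure a b) unit_ivl \<noteq> 0"
  proof
    assume "measure (jacobi_measure a b) unit_ivl = 0"
    then have "emeasure (jacobi_measure a b) (space (jacobi_measure a b)) = 0"
      by (simp add: emeasure_eq_measure)
    then have "AE x in jacobi_measure a b. False"
      using sets.top[of "jacobi_measure a b"] by (intro AE_I[of _ _ "space (jacobi_measure a b)"]) auto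
    then have "AE x in lebesgue_on unit_ivl. False" unfolding AE_jacobi_measure .
    then have "emeasure (lebesgue_on unit_ivl) unit_ivl = 0"
      using ae_filter_eq_bot_iff[of "lebesgue_on unit_ivl"] by (simp add: eventually_False)
    then show False by (simp add: emeasure_restrict_space)
  qed
  ultimately show ?case using measure_nonneg[of "jacobi_measure a b" unit_ivl] by linarith
next
  case (Suc n)
  have "0 < (real n + a + b + 2) * jacobi_norm_sq (a + 1) (b + 1) n"
    using Suc.prems by (intro mult_pos_pos Suc.IH) auto
  then have "0 < real (Suc n) * jacobi_norm_sq a b (Suc n)"
    unfolding jacobi_norm_sq_Suc[OF Suc.prems] .
  then show ?case by (simp add: zero_less_mult_iff)
qed

lemma jacobi_G_normalized_eq:
  "jacobi_G_normalized a b j = (\<lambda>x. inverse (sqrt (jacobi_norm_sq a b j)) * jacobi_G a b j x)"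
  by (simp add: jacobi_G_normalized_def weighted_norm_jacobi[OF jacobi_G_measurable] jacobi_norm_sq_def
      fun_eq_iff field_simps)

text \<open>Integrate the expansion of \<open>x\<^sup>n\<close> for the parameters \<open>(a + 1, b + 1)\<close>; the constant of integration is a
  multiple of the polynomial of degree zero.\<close>

lemma monomial_in_span_jacobi_G:
  "a > -1 \<Longrightarrow> b > -1 \<Longrightarrow> \<exists>c. \<forall>x. x ^ n = (\<Sum>j\<le>n. c j * jacobi_G a b j x)"
proof (induction n arbitrary: a b)
  case 0
  then show ?case by (intro exI[of _ "\<lambda>_. 1"]) (simp add: jacobi_G_0)
next
  case (Suc n)
  then have "\<exists>c. \<forall>x. x ^ n = (\<Sum>j\<le>n. c j * jacobi_G (a + 1) (b + 1) j x)"
    by (intro Suc.IH) auto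
  then obtain c where c: "\<And>x. x ^ n = (\<Sum>j\<le>n. c j * jacobi_G (a + 1) (b + 1) j x)"
    by blast
  \<comment> \<open>The factors by which differentiation multiplies the Jacobi polynomials are divided out.\<close>
  define c' where "c' j = real (Suc n) * c j / (real j + a + b + 2)" for j
  define F where "F x = x ^ Suc n - (\<Sum>j\<le>n. c' j * jacobi_G a b (Suc j) x)" for x
  have nz: "real j + a + b + 2 \<noteq> 0" for j using Suc.prems by simp
  have "(F has_field_derivative 0) (at x)" for x
  proof -
    have "(F has_field_derivative real (Suc n) * x ^ n
        - (\<Sum>j\<le>n. c' j * ((real j + a + b + 2) * jacobi_G (a + 1) (b + 1) j x))) (at x)"
      unfolding F_def[abs_def] using DERIV_pow[of "Suc n" x UNIV]
      by (intro DERIV_diff DERIV_sum DERIV_cmult jacobi_G_has_derivative)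
        (simp only: diff_Suc_Suc diff_zero)
    moreover have "(\<Sum>j\<le>n. c' j * ((real j + a + b + 2) * jacobi_G (a + 1) (b + 1) j x)) = real (Suc n) * x ^ n"
      unfolding c sum_distrib_left by (intro sum.cong refl) (simp add: c'_def nz)
    ultimately show ?thesis by simp
  qed
  then have const: "F x = F 0" for x by (rule DERIV_isconst_all[rule_format])
  show ?case
  proof (intro exI[of _ "case_nat (F 0) c'"] allI)
    fix x
    show "x ^ Suc n = (\<Sum>j\<le>Suc n. case_nat (F 0) c' j * jacobi_G a b j x)"
      using const[of x] unfolding sum.atMost_Suc_shift F_def[of x] by (simp add: jacobi_G_0)
  qed
qed

text \<open>Such an \<open>f\<close> is orthogonal to all monomials, hence by Weierstrass approximation to all continuous
  functions, in particular to all test functions; then \<open>\<rho> f\<close> vanishes almost everywhere.\<close>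

lemma jacobi_G_total:
  assumes ab: "a > -1" "b > -1" and f: "jacobi_L2 a b f"
    and zero: "\<And>j. jacobi_inner a b f (jacobi_G a b j) = 0"
  shows "AE x in lebesgue_on unit_ivl. f x = 0"
proof -
  let ?J = "jacobi_measure a b"
  have fm: "f \<in> unit_measurable" by (rule jacobi_L2_measurable[OF f])
  have one: "sq_integrable ?J (\<lambda>x. 1)"
    by (rule sq_integrable_bounded[OF finite_measure_jacobi[OF ab], of _ 1]) auto
  have f_int: "integrable ?J f" using sq_integrable_mult[OF f one] by simp
  have mono_sq: "sq_integrable ?J (\<lambda>x. c * x ^ n)" for c n
  proof -
    have "poly (monom c n) = (\<lambda>x. c * x ^ n)" by (simp add: poly_monom fun_eq_iff)
    then show ?thesis using sq_integrable_poly[OF ab, of "monom c n"] by simp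
  qed
  have mono_zero: "inner_L2 ?J f (\<lambda>x. x ^ n) = 0" for n
  proof -
    obtain c where c: "\<And>x. x ^ n = (\<Sum>j\<le>n. c j * jacobi_G a b j x)"
      using monomial_in_span_jacobi_G[OF ab] by blast
    show ?thesis
      unfolding c inner_L2_commute[of ?J f]
      by (subst inner_L2_sum)
        (auto intro: f sq_integrable_jacobi_G[OF ab] simp: inner_L2_cmult inner_L2_commute[of ?J _ f] zero)
  qed
  have poly_zero: "inner_L2 ?J f (\<lambda>x. \<Sum>i\<le>n. c i * x ^ i) = 0" for c n
    unfolding inner_L2_commute[of ?J f]
    by (subst inner_L2_sum)
      (auto intro: f mono_sq simp: inner_L2_cmult inner_L2_commute[of ?J _ f] mono_zero)
  have "AE x in lebesgue_on unit_ivl. rho a b x * f x = 0"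
  proof (rule fundamental_lemma_calculus_of_variations)
    have L_int: "integrable (lebesgue_on unit_ivl) (\<lambda>x. rho a b x * f x)"
      using f_int fm by (simp add: integrable_jacobi_measure)
    show "locally_integrable (\<lambda>x. rho a b x * f x)"
      unfolding locally_integrable_def
    proof (intro allI impI)
      fix K assume K: "compact K \<and> K \<subseteq> unit_ivl"
      have "set_integrable lebesgue unit_ivl (\<lambda>x. rho a b x * f x)"
        using L_int by (simp add: set_integrable_unit_ivl)
      then show "set_integrable lebesgue K (\<lambda>x. rho a b x * f x)"
        by (rule set_integrable_subset) (use K borel_compact[of K] sets_completionI_sets[of K lborel] in auto)
    qed
    fix \<phi> assume \<phi>: "test_function \<phi>"
    have \<phi>m: "\<phi> \<in> unit_measurable" by (rule test_function_measurable[OF \<phi>])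
    obtain B where B: "\<And>x. \<bar>\<phi> x\<bar> \<le> B" by (rule test_function_bounded[OF \<phi>]) (rule that)
    have \<phi>_sq: "sq_integrable ?J \<phi>"
      by (rule sq_integrable_bounded[OF finite_measure_jacobi[OF ab]]) (use \<phi>m B in auto)
    have "\<bar>inner_L2 ?J f \<phi>\<bar> \<le> e" if "e > 0" for e
    proof -
      let ?I = "LINT x|?J. \<bar>f x\<bar>"
      have I: "0 \<le> ?I" by simp
      define \<delta> where "\<delta> = e / (?I + 1)"
      have I1: "0 < ?I + 1" using I by linarith
      then have \<delta>: "\<delta> > 0" using \<open>e > 0\<close> unfolding \<delta>_def by (rule divide_pos_pos[rotated])
      have "\<delta> * ?I \<le> \<delta> * (?I + 1)" using \<delta> by (intro mult_left_mono) auto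
      also have "\<dots> = e" using I1 unfolding \<delta>_def by simp
      finally have \<delta>_I: "\<delta> * ?I \<le> e" .
      obtain h where h: "real_polynomial_function h" "\<And>x. x \<in> {0..1} \<Longrightarrow> \<bar>\<phi> x - h x\<bar> < \<delta>"
        using Stone_Weierstrass_real_polynomial_function[OF compact_Icc test_function_continuous[OF \<phi>] \<delta>]
        by blast
      obtain c n where hc: "h = (\<lambda>x. \<Sum>i\<le>n. c i * x ^ i)"
        using h(1) unfolding real_polynomial_function_iff_sum by blast
      have h_sq: "sq_integrable ?J h"
        unfolding hc by (intro sq_integrable_sum mono_sq)
      have "inner_L2 ?J f \<phi> = inner_L2 ?J f (\<lambda>x. \<phi> x - h x)"
        using poly_zero[of c n] inner_L2_diff_right[OF \<phi>_sq h_sq f] by (simp add: hc)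
      also have "\<bar>\<dots>\<bar> \<le> (LINT x|?J. \<bar>f x * (\<phi> x - h x)\<bar>)"
        unfolding inner_L2_def by (rule integral_abs_bound)
      also have "\<dots> \<le> (LINT x|?J. \<delta> * \<bar>f x\<bar>)"
      proof (rule integral_mono)
        show "integrable ?J (\<lambda>x. \<bar>f x * (\<phi> x - h x)\<bar>)"
          by (intro integrable_abs sq_integrable_mult f sq_integrable_diff \<phi>_sq h_sq)
        show "integrable ?J (\<lambda>x. \<delta> * \<bar>f x\<bar>)" using f_int by simp
        fix x assume "x \<in> space ?J"
        then have "\<bar>\<phi> x - h x\<bar> \<le> \<delta>" using h(2)[of x] by simp
        then show "\<bar>f x * (\<phi> x - h x)\<bar> \<le> \<delta> * \<bar>f x\<bar>"
          unfolding abs_mult by (subst mult.commute) (rule mult_right_mono, auto)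
      qed
      also have "\<dots> = \<delta> * ?I" by simp
      finally show ?thesis using \<delta>_I by linarith
    qed
    then have "inner_L2 ?J f \<phi> = 0"
      using field_le_epsilon[of "\<bar>inner_L2 ?J f \<phi>\<bar>" 0] by simp
    then show "(LINT x:unit_ivl|lebesgue. rho a b x * f x * \<phi> x) = 0"
      using inner_jacobi[OF fm \<phi>m, of a b] by (simp add: set_lebesgue_integral_unit_ivl mult.assoc)
  qed
  moreover have "AE x in lebesgue_on unit_ivl. x \<in> unit_ivl" by (rule AE_I2) simp
  ultimately show ?thesis
  proof eventually_elim
    case (elim x)
    then show ?case using rho_pos[of x a b] by simp
  qed
qed

theorem jacobi_orthonormal_basis:
  assumes ab: "a > -1" "b > -1"
  shows "orthonormal_basis_L2 (jacobi_measure a b) (jacobi_G_normalized a b)"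
proof -
  let ?J = "jacobi_measure a b"
  note sq = sq_integrable_jacobi_G[OF ab]
  have pos: "jacobi_norm_sq a b j > 0" for j by (rule jacobi_norm_sq_pos[OF ab])
  have inner: "inner_L2 ?J f (jacobi_G_normalized a b j)
      = inverse (sqrt (jacobi_norm_sq a b j)) * inner_L2 ?J f (jacobi_G a b j)" for f j
    unfolding jacobi_G_normalized_eq inner_L2_commute[of ?J f] inner_L2_cmult ..
  show ?thesis
  proof (intro orthonormal_basis_L2.intro orthonormal_basis_L2_axioms.intro)
    show "finite_measure ?J" by (rule finite_measure_jacobi[OF ab])
    show "sq_integrable ?J (jacobi_G_normalized a b j)" for j
      unfolding jacobi_G_normalized_eq by (intro sq_integrable_cmult sq)
    show "inner_L2 ?J (jacobi_G_normalized a b i) (jacobi_G_normalized a b j) = (if i = j then 1 else 0)" for i j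
    proof -
      have "inner_L2 ?J (jacobi_G_normalized a b i) (jacobi_G_normalized a b j)
          = inverse (sqrt (jacobi_norm_sq a b j)) * (inverse (sqrt (jacobi_norm_sq a b i))
            * inner_L2 ?J (jacobi_G a b i) (jacobi_G a b j))"
        unfolding inner unfolding jacobi_G_normalized_eq inner_L2_cmult ..
      then show ?thesis
        using pos[of j] jacobi_G_orthogonal[OF ab, of i j]
        by (auto simp: jacobi_norm_sq_def[symmetric] field_simps)
    qed
    show "inner_L2 ?J f f = 0" if f: "sq_integrable ?J f"
      and zero: "\<And>j. inner_L2 ?J f (jacobi_G_normalized a b j) = 0" for f
    proof -
      have "inner_L2 ?J f (jacobi_G a b j) = 0" for j
        using zero[of j] pos[of j] unfolding inner by simp
      then have "AE x in lebesgue_on unit_ivl. f x = 0" by (rule jacobi_G_total[OF ab f])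
      then have "AE x in ?J. f x * f x = 0" unfolding AE_jacobi_measure by eventually_elim simp
      then show ?thesis unfolding inner_L2_def by (rule integral_eq_zero_AE)
    qed
  qed
qed

section \<open>Jacobi coefficients of weak derivatives\<close>

lemma jacobi_G_normalized_smooth: "smooth_on S (jacobi_G_normalized a b j)"
proof -
  obtain p where p: "jacobi_G a b j = poly p" using jacobi_G_poly by blast
  have "jacobi_G_normalized a b j = poly (Polynomial.smult (inverse (sqrt (jacobi_norm_sq a b j))) p)"
    unfolding jacobi_G_normalized_eq p by (simp add: fun_eq_iff)
  then show ?thesis using smooth_on_subset[OF smooth_on_poly] by auto
qed

lemma jacobi_G_normalized_measurable:
  "jacobi_G_normalized a b j \<in> unit_measurable"
  by (rule continuous_on_measurable_unit_ivl[OF smooth_on_imp_continuous_on[OF jacobi_G_normalized_smooth]])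

lemma jacobi_coeff_inner:
  assumes "v \<in> unit_measurable"
  shows "jacobi_coeff a b v j = jacobi_inner a b v (jacobi_G_normalized a b j)"
  unfolding inner_jacobi[OF assms jacobi_G_normalized_measurable]
  by (simp add: jacobi_coeff_def set_lebesgue_integral_unit_ivl mult.assoc)

lemma jacobi_coeff_inner_G:
  assumes "v \<in> unit_measurable"
  shows "jacobi_coeff a b v j
    = inverse (sqrt (jacobi_norm_sq a b j)) * jacobi_inner a b v (jacobi_G a b j)"
  unfolding jacobi_coeff_inner[OF assms] jacobi_G_normalized_eq inner_L2_commute[of _ v] inner_L2_cmult ..

text \<open>The square root of the eigenvalue of the Jacobi differential operator for degree \<open>n + 1\<close>: the
  factor by which differentiation multiplies normalized coefficients.\<close>

definition jacobi_deriv_factor :: "real \<Rightarrow> real \<Rightarrow> nat \<Rightarrow> real" where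
  "jacobi_deriv_factor a b n = sqrt (real (Suc n) * (real n + a + b + 2))"

lemma jacobi_norm_ratio:
  assumes ab: "a > -1" "b > -1"
  shows "sqrt (jacobi_norm_sq a b (Suc n)) * jacobi_deriv_factor a b n
      = (real n + a + b + 2) * sqrt (jacobi_norm_sq (a + 1) (b + 1) n)"
    and "sqrt (jacobi_norm_sq (a + 1) (b + 1) n) * jacobi_deriv_factor a b n
      = real (Suc n) * sqrt (jacobi_norm_sq a b (Suc n))"
proof -
  have pos: "real n + a + b + 2 > 0" using ab by linarith
  have "sqrt (jacobi_norm_sq a b (Suc n)) * jacobi_deriv_factor a b n
      = sqrt ((real n + a + b + 2) * (real (Suc n) * jacobi_norm_sq a b (Suc n)))"
    by (simp only: jacobi_deriv_factor_def real_sqrt_mult[symmetric] mult_ac)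
  also have "\<dots> = sqrt ((real n + a + b + 2) * (real n + a + b + 2) * jacobi_norm_sq (a + 1) (b + 1) n)"
    by (simp only: jacobi_norm_sq_Suc[OF ab] mult.assoc)
  also have "\<dots> = (real n + a + b + 2) * sqrt (jacobi_norm_sq (a + 1) (b + 1) n)"
    using pos by (simp add: real_sqrt_mult)
  finally show "sqrt (jacobi_norm_sq a b (Suc n)) * jacobi_deriv_factor a b n
      = (real n + a + b + 2) * sqrt (jacobi_norm_sq (a + 1) (b + 1) n)" .
  have "sqrt (jacobi_norm_sq (a + 1) (b + 1) n) * jacobi_deriv_factor a b n
      = sqrt (real (Suc n) * ((real n + a + b + 2) * jacobi_norm_sq (a + 1) (b + 1) n))"
    by (simp only: jacobi_deriv_factor_def real_sqrt_mult[symmetric] mult_ac)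
  also have "\<dots> = sqrt (real (Suc n) * real (Suc n) * jacobi_norm_sq a b (Suc n))"
    by (simp only: jacobi_norm_sq_Suc[OF ab, symmetric] mult.assoc)
  also have "\<dots> = real (Suc n) * sqrt (jacobi_norm_sq a b (Suc n))"
    by (simp only: real_sqrt_mult real_sqrt_mult_self abs_of_nat)
  finally show "sqrt (jacobi_norm_sq (a + 1) (b + 1) n) * jacobi_deriv_factor a b n
      = real (Suc n) * sqrt (jacobi_norm_sq a b (Suc n))" .
qed

lemma jacobi_coeff_weak_deriv:
  assumes ab: "a > -1" "b > -1"
    and v: "jacobi_L2 a b v"
    and g: "jacobi_L2 (a + 1) (b + 1) g"
    and vg: "has_weak_deriv 1 v g"
  shows "jacobi_coeff (a + 1) (b + 1) g n = jacobi_deriv_factor a b n * jacobi_coeff a b v (Suc n)"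
proof -
  have pos: "jacobi_norm_sq a b (Suc n) > 0" "jacobi_norm_sq (a + 1) (b + 1) n > 0"
    using ab by (auto intro: jacobi_norm_sq_pos)
  then have "jacobi_deriv_factor a b n * inverse (sqrt (jacobi_norm_sq a b (Suc n)))
      = real (Suc n) * inverse (sqrt (jacobi_norm_sq (a + 1) (b + 1) n))"
    using jacobi_norm_ratio(2)[OF ab, of n] by (simp add: field_simps)
  then show ?thesis
    unfolding jacobi_coeff_inner_G[OF jacobi_L2_measurable[OF v]] jacobi_coeff_inner_G[OF jacobi_L2_measurable[OF g]]
      inner_jacobi_weak_deriv[OF ab v g vg]
    by (simp add: mult_ac)
qed

lemma deriv_jacobi_G_normalized:
  assumes ab: "a > -1" "b > -1"
  shows "deriv (jacobi_G_normalized a b (Suc n))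
    = (\<lambda>x. jacobi_deriv_factor a b n * jacobi_G_normalized (a + 1) (b + 1) n x)"
proof
  fix x
  have pos: "jacobi_norm_sq a b (Suc n) > 0" "jacobi_norm_sq (a + 1) (b + 1) n > 0"
    using ab by (auto intro: jacobi_norm_sq_pos)
  have "deriv (jacobi_G_normalized a b (Suc n)) x
      = inverse (sqrt (jacobi_norm_sq a b (Suc n))) * ((real n + a + b + 2) * jacobi_G (a + 1) (b + 1) n x)"
    unfolding jacobi_G_normalized_eq by (rule DERIV_imp_deriv[OF DERIV_cmult[OF jacobi_G_has_derivative]])
  also have "\<dots> = inverse (sqrt (jacobi_norm_sq a b (Suc n))) * (real n + a + b + 2) * jacobi_G (a + 1) (b + 1) n x"
    by simp
  also have "inverse (sqrt (jacobi_norm_sq a b (Suc n))) * (real n + a + b + 2)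
      = jacobi_deriv_factor a b n * inverse (sqrt (jacobi_norm_sq (a + 1) (b + 1) n))"
    using jacobi_norm_ratio(1)[OF ab, of n] pos by (simp add: field_simps)
  finally show "deriv (jacobi_G_normalized a b (Suc n)) x
      = jacobi_deriv_factor a b n * jacobi_G_normalized (a + 1) (b + 1) n x"
    unfolding jacobi_G_normalized_eq by simp
qed

text \<open>The candidate \<open>g\<close> is the Riesz-Fischer function of the coefficients that a derivative must have.
  For a test function \<open>\<phi>\<close>, Parseval's identity expands both \<open>\<integral> v \<phi>'\<close> and \<open>\<integral> g \<phi>\<close>, and the two series
  agree up to sign because the basis polynomials can be integrated by parts classically.\<close>

lemma weak_deriv_exists:
  assumes ab: "a > -1" "b > -1"
    and v: "jacobi_L2 a b v"
    and sum: "summable (\<lambda>n. (jacobi_deriv_factor a b n * jacobi_coeff a b v (Suc n))\<^sup>2)"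
  shows "\<exists>g. jacobi_L2 (a + 1) (b + 1) g \<and> has_weak_deriv 1 v g"
proof -
  have ab1: "a + 1 > -1" "b + 1 > -1" using ab by auto
  let ?J = "jacobi_measure a b" and ?J1 = "jacobi_measure (a + 1) (b + 1)"
  let ?e = "jacobi_G_normalized a b" and ?e1 = "jacobi_G_normalized (a + 1) (b + 1)"
  interpret J: orthonormal_basis_L2 ?J ?e by (rule jacobi_orthonormal_basis[OF ab])
  interpret J1: orthonormal_basis_L2 ?J1 ?e1 by (rule jacobi_orthonormal_basis[OF ab1])
  have vm: "v \<in> unit_measurable" by (rule jacobi_L2_measurable[OF v])
  obtain g where g: "sq_integrable ?J1 g"
    and gc: "\<And>n. inner_L2 ?J1 g (?e1 n) = jacobi_deriv_factor a b n * jacobi_coeff a b v (Suc n)"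
    by (rule J1.riesz_fischer[OF sum]) (rule that)
  have gm: "g \<in> unit_measurable" by (rule jacobi_L2_measurable[OF g])
  have "(LINT x:unit_ivl|lebesgue. v x * (deriv ^^ 1) \<phi> x) = (-1) ^ 1 * (LINT x:unit_ivl|lebesgue. g x * \<phi> x)"
    if \<phi>: "test_function \<phi>" for \<phi>
  proof -
    note \<phi>' = test_function_deriv[OF \<phi>]
    let ?\<psi> = "\<lambda>x. deriv \<phi> x * rho (- a) (- b) x"
    let ?\<psi>1 = "\<lambda>x. \<phi> x * rho (- (a + 1)) (- (b + 1)) x"
    note \<psi> = jacobi_test_pairing[OF ab \<phi>'] and \<psi>1 = jacobi_test_pairing[OF ab1 \<phi>]
    have classical: "inner_L2 ?J ?\<psi> (?e j) = - (LINT x:unit_ivl|lebesgue. deriv (?e j) x * \<phi> x)" for j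
      using \<psi>(2)[OF jacobi_G_normalized_measurable]
        has_weak_deriv_1D[OF has_weak_deriv_smooth[OF jacobi_G_normalized_smooth] \<phi>, of a b j]
      by (simp add: inner_L2_commute[of ?J ?\<psi>])
    have "?e 0 = (\<lambda>x. inverse (sqrt (jacobi_norm_sq a b 0)))"
      by (simp add: jacobi_G_normalized_eq jacobi_G_0)
    \<comment> \<open>Degree zero is lost under differentiation, which shifts the series by one.\<close>
    then have head: "inner_L2 ?J ?\<psi> (?e 0) = 0"
      unfolding classical by (simp add: set_lebesgue_integral_def)
    have tail: "inner_L2 ?J ?\<psi> (?e (Suc n)) = - (jacobi_deriv_factor a b n * inner_L2 ?J1 ?\<psi>1 (?e1 n))" for n
    proof -
      have "(LINT x:unit_ivl|lebesgue. deriv (?e (Suc n)) x * \<phi> x)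
          = jacobi_deriv_factor a b n * (LINT x:unit_ivl|lebesgue. ?e1 n x * \<phi> x)"
        unfolding deriv_jacobi_G_normalized[OF ab] set_lebesgue_integral_unit_ivl by (simp add: mult.assoc)
      also have "(LINT x:unit_ivl|lebesgue. ?e1 n x * \<phi> x) = inner_L2 ?J1 ?\<psi>1 (?e1 n)"
        unfolding inner_L2_commute[of ?J1 ?\<psi>1] by (rule \<psi>1(2)[OF jacobi_G_normalized_measurable, symmetric])
      finally show ?thesis unfolding classical by simp
    qed
    have "(\<lambda>j. inner_L2 ?J v (?e j) * inner_L2 ?J ?\<psi> (?e j)) sums inner_L2 ?J v ?\<psi>"
      by (rule J.parseval[OF v \<psi>(1)])
    then have "(\<lambda>n. inner_L2 ?J v (?e (Suc n)) * inner_L2 ?J ?\<psi> (?e (Suc n))) sums inner_L2 ?J v ?\<psi>"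
      by (subst sums_Suc_iff) (simp add: head)
    then have "(\<lambda>n. - (inner_L2 ?J1 g (?e1 n) * inner_L2 ?J1 ?\<psi>1 (?e1 n))) sums inner_L2 ?J v ?\<psi>"
      unfolding tail gc jacobi_coeff_inner[OF vm] by (simp add: mult_ac)
    moreover have "(\<lambda>n. - (inner_L2 ?J1 g (?e1 n) * inner_L2 ?J1 ?\<psi>1 (?e1 n))) sums (- inner_L2 ?J1 g ?\<psi>1)"
      by (rule sums_minus[OF J1.parseval[OF g \<psi>1(1)]])
    ultimately have "inner_L2 ?J v ?\<psi> = - inner_L2 ?J1 g ?\<psi>1" by (rule sums_unique2)
    then show ?thesis using \<psi>(2)[OF vm] \<psi>1(2)[OF gm] by simp
  qed
  then have "has_weak_deriv 1 v g"
    using jacobi_L2_locally_integrable[OF v] jacobi_L2_locally_integrable[OF g]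
    unfolding has_weak_deriv_def by blast
  then show ?thesis using g by blast
qed

section \<open>Sobolev spaces of integer order\<close>

lemma summable_weighted_mono:
  fixes c V W :: "nat \<Rightarrow> real"
  assumes "summable (\<lambda>j. W j * (c j)\<^sup>2)" "\<And>j. 0 \<le> V j" "\<And>j. V j \<le> C * W j"
  shows "summable (\<lambda>j. V j * (c j)\<^sup>2)"
proof (rule summable_comparison_test')
  show "summable (\<lambda>j. C * (W j * (c j)\<^sup>2))" by (intro summable_mult assms)
  show "norm (V j * (c j)\<^sup>2) \<le> C * (W j * (c j)\<^sup>2)" for j
    unfolding mult.assoc[symmetric] using assms(2,3)[of j] by (simp add: mult_right_mono)
qed

text \<open>The ratio of the squared Jacobi coefficients, with respect to the weight for \<open>(a + i, b + i)\<close>, of the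
  \<open>i\<close>-th derivative to those of the function of degree higher by \<open>i\<close>. The factor for \<open>l = j\<close> makes it vanish for \<open>j < i\<close>, as it
  must since the derivative kills these degrees.\<close>

definition deriv_weight :: "real \<Rightarrow> real \<Rightarrow> nat \<Rightarrow> nat \<Rightarrow> real" where
  "deriv_weight a b i j = (\<Prod>l<i. (real j - real l) * (real j + real l + a + b + 1))"

lemma deriv_weight_Suc:
  "deriv_weight a b (Suc i) (k + Suc i)
    = (jacobi_deriv_factor (a + real i) (b + real i) k)\<^sup>2 * deriv_weight a b i (Suc k + i)"
  if "a > -1" "b > -1"
proof -
  have "real (Suc k) * (real k + (a + real i) + (b + real i) + 2) \<ge> 0"
    using that by (intro mult_nonneg_nonneg) auto
  then show ?thesis
    by (simp add: deriv_weight_def jacobi_deriv_factor_def algebra_simps)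
qed

lemma deriv_weight_eq_0: "j < i \<Longrightarrow> deriv_weight a b i j = 0"
  by (auto simp: deriv_weight_def)

lemma deriv_weight_nonneg:
  assumes "a > -1" "b > -1" shows "0 \<le> deriv_weight a b i j"
proof (cases "j < i")
  case False
  show ?thesis unfolding deriv_weight_def
  proof (intro prod_nonneg mult_nonneg_nonneg)
    fix l assume "l \<in> {..<i}"
    then have "l < j" using False by simp
    then have "real j \<ge> 1" "real l \<le> real j" by auto
    then show "0 \<le> real j - real l" "0 \<le> real j + real l + a + b + 1"
      using assms by linarith+
  qed
qed (simp add: deriv_weight_eq_0)

abbreviation freq :: "nat \<Rightarrow> real" where
  "freq j \<equiv> 1 + (real j)\<^sup>2"

lemma deriv_weight_upper: "\<exists>C>0. \<forall>j. \<bar>deriv_weight a b i j\<bar> \<le> C * freq j ^ i"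
proof (induction i)
  case 0
  then show ?case by (intro exI[of _ 1]) (simp add: deriv_weight_def)
next
  case (Suc i)
  then obtain C where C: "C > 0" "\<And>j. \<bar>deriv_weight a b i j\<bar> \<le> C * freq j ^ i" by blast
  define M where "M = real i + \<bar>a\<bar> + \<bar>b\<bar> + 1"
  have M: "M > 0" by (simp add: M_def)
  have factor: "\<bar>(real j - real i) * (real j + real i + a + b + 1)\<bar> \<le> (2 * (1 + M) * (1 + M)) * freq j" for j
  proof -
    have "\<bar>real j - real i\<bar> \<le> real j + M" "\<bar>real j + real i + a + b + 1\<bar> \<le> real j + M"
      by (auto simp: M_def abs_le_iff)
    then have "\<bar>(real j - real i) * (real j + real i + a + b + 1)\<bar> \<le> (real j + M) * (real j + M)"
      unfolding abs_mult using M by (intro mult_mono) auto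
    also have "\<dots> \<le> ((1 + M) * (1 + real j)) * ((1 + M) * (1 + real j))"
      using M by (intro mult_mono) (auto simp: algebra_simps)
    also have "\<dots> = (1 + M) * (1 + M) * ((1 + real j) * (1 + real j))" by (simp add: mult_ac)
    also have "\<dots> \<le> (1 + M) * (1 + M) * (2 * freq j)"
    proof (rule mult_left_mono)
      have "0 \<le> (1 - real j)\<^sup>2" by simp
      then show "(1 + real j) * (1 + real j) \<le> 2 * freq j"
        by (simp add: power2_eq_square algebra_simps)
    qed (use M in simp)
    finally show ?thesis by (simp only: mult_ac)
  qed
  have "\<bar>deriv_weight a b (Suc i) j\<bar> \<le> (C * (2 * (1 + M) * (1 + M))) * freq j ^ Suc i" for j
  proof -
    have "\<bar>deriv_weight a b (Suc i) j\<bar>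
        = \<bar>deriv_weight a b i j\<bar> * \<bar>(real j - real i) * (real j + real i + a + b + 1)\<bar>"
      by (simp add: deriv_weight_def abs_mult)
    also have "\<dots> \<le> (C * freq j ^ i) * ((2 * (1 + M) * (1 + M)) * freq j)"
      using C factor by (intro mult_mono) auto
    finally show ?thesis by (simp add: mult_ac)
  qed
  moreover have "C * (2 * (1 + M) * (1 + M)) > 0" using C M by simp
  ultimately show ?case by blast
qed

text \<open>For \<open>l < n \<le> j\<close> one has \<open>j - l \<ge> j / n\<close> and \<open>j + l + a + b + 1 \<ge> \<delta> j\<close>, so that every factor is
  comparable to \<open>j\<^sup>2\<close>. Positivity of \<open>\<delta>\<close> is where \<open>a, b > -1\<close> is used.\<close>

lemma deriv_weight_lower:
  assumes ab: "a > -1" "b > -1"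
  shows "\<exists>c>0. \<forall>j\<ge>n. c * freq j ^ n \<le> deriv_weight a b n j"
proof (cases "n = 0")
  case True
  then show ?thesis by (intro exI[of _ 1]) (simp add: deriv_weight_def)
next
  case False
  define \<delta> where "\<delta> = min 1 (a + b + 2)"
  have \<delta>: "\<delta> > 0" "\<delta> \<le> 1" "\<delta> \<le> a + b + 2" using ab by (auto simp: \<delta>_def)
  have "(\<delta> / (2 * real n)) ^ n * freq j ^ n \<le> deriv_weight a b n j" if j: "n \<le> j" for j
  proof -
    have j1: "real j \<ge> 1" "real n \<ge> 1" using False j by auto
    have "(\<delta> / (2 * real n)) * freq j \<le> (real j - real l) * (real j + real l + a + b + 1)"
      if l: "l < n" for l
    proof -
      have "real j / real n \<le> real j - real l"
      proof -
        have "0 \<le> (real n - 1) * (real j - real n)" using j j1 by (intro mult_nonneg_nonneg) auto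
        then have "real j \<le> (real j - (real n - 1)) * real n" by (simp add: algebra_simps)
        also have "\<dots> \<le> (real j - real l) * real n" using l j1 by (intro mult_right_mono) auto
        finally show ?thesis using j1 by (simp add: field_simps)
      qed
      moreover have "\<delta> * real j \<le> real j + real l + a + b + 1"
      proof -
        have "0 \<le> (1 - \<delta>) * (real j - 1)" using \<delta> j1 by (intro mult_nonneg_nonneg) auto
        then have "\<delta> * real j \<le> real j - 1 + \<delta>" by (simp add: algebra_simps)
        then show ?thesis using \<delta>(3) of_nat_0_le_iff[of l, where 'a = real] by linarith
      qed
      ultimately have "(real j / real n) * (\<delta> * real j) \<le> (real j - real l) * (real j + real l + a + b + 1)"
        using \<delta> j1 j l by (intro mult_mono) auto
      moreover have "(\<delta> / (2 * real n)) * freq j \<le> (real j / real n) * (\<delta> * real j)"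
      proof -
        have "1 + (real j)\<^sup>2 \<le> 2 * (real j * real j)" using j1 mult_mono[of 1 "real j" 1 "real j"]
          by (simp add: power2_eq_square)
        then have "(\<delta> / (2 * real n)) * freq j \<le> (\<delta> / (2 * real n)) * (2 * (real j * real j))"
          using \<delta> j1 by (intro mult_left_mono) auto
        then show ?thesis using j1 by (simp add: field_simps)
      qed
      ultimately show ?thesis by linarith
    qed
    then have "(\<Prod>l<n. (\<delta> / (2 * real n)) * freq j) \<le> deriv_weight a b n j"
      unfolding deriv_weight_def using \<delta> j1 by (intro prod_mono) auto
    then show ?thesis by (simp only: prod_constant card_lessThan power_mult_distrib)
  qed
  moreover have "(\<delta> / (2 * real n)) ^ n > 0" using \<delta> False by simp
  ultimately show ?thesis by blast
qed

definition sobolev_weight :: "real \<Rightarrow> real \<Rightarrow> nat \<Rightarrow> nat \<Rightarrow> real" where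
  "sobolev_weight a b n j = (\<Sum>i\<le>n. deriv_weight a b i j)"

text \<open>The derivative of order \<open>n\<close> controls the degrees \<open>j \<ge> n\<close>; the finitely many lower ones are controlled
  by the term of order zero.\<close>

lemma sobolev_weight_bounds:
  assumes ab: "a > -1" "b > -1"
  obtains c C where "c > 0" "C > 0"
    "\<And>j. c * freq j ^ n \<le> sobolev_weight a b n j"
    "\<And>j. sobolev_weight a b n j \<le> C * freq j ^ n"
proof -
  have "\<exists>C>0. \<forall>j. sobolev_weight a b n j \<le> C * freq j ^ n"
  proof -
    obtain C where C: "\<And>i. C i > 0" "\<And>i j. \<bar>deriv_weight a b i j\<bar> \<le> C i * freq j ^ i"
      using deriv_weight_upper[of a b] by metis
    have "sobolev_weight a b n j \<le> (\<Sum>i\<le>n. C i) * freq j ^ n" for j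
      unfolding sobolev_weight_def sum_distrib_right
    proof (rule sum_mono)
      fix i assume "i \<in> {..n}"
      then have "freq j ^ i \<le> freq j ^ n" by (intro power_increasing) auto
      then have "C i * freq j ^ i \<le> C i * freq j ^ n"
        using C(1)[of i] by (intro mult_left_mono) auto
      then show "deriv_weight a b i j \<le> C i * freq j ^ n"
        using C(2)[where i = i and j = j] by linarith
    qed
    moreover have "(\<Sum>i\<le>n. C i) > 0" using C(1) by (intro sum_pos) auto
    ultimately show ?thesis by blast
  qed
  moreover have "\<exists>c>0. \<forall>j. c * freq j ^ n \<le> sobolev_weight a b n j"
  proof -
    obtain c where c: "c > 0" "\<And>j. n \<le> j \<Longrightarrow> c * freq j ^ n \<le> deriv_weight a b n j"
      using deriv_weight_lower[OF ab, of n] by blast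
    let ?c = "min c (inverse (freq n ^ n))"
    have N: "freq n ^ n > 0" by (intro zero_less_power) (simp add: add_pos_nonneg)
    have "?c * freq j ^ n \<le> sobolev_weight a b n j" for j
    proof (cases "n \<le> j")
      case True
      have "?c * freq j ^ n \<le> c * freq j ^ n"
        by (intro mult_right_mono) auto
      also have "\<dots> \<le> deriv_weight a b n j" by (rule c(2)[OF True])
      also have "\<dots> \<le> sobolev_weight a b n j"
        unfolding sobolev_weight_def by (rule member_le_sum) (auto intro: deriv_weight_nonneg[OF ab])
      finally show ?thesis .
    next
      case False
      have "freq j ^ n \<le> freq n ^ n"
        using False by (intro power_mono add_left_mono) auto
      then have "?c * freq j ^ n \<le> inverse (freq n ^ n) * freq n ^ n"
        using N by (intro mult_mono) auto
      also have "\<dots> = 1" using N by (intro left_inverse) linarith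
      also have "1 = deriv_weight a b 0 j" by (simp add: deriv_weight_def)
      also have "\<dots> \<le> sobolev_weight a b n j"
        unfolding sobolev_weight_def by (rule member_le_sum) (auto intro: deriv_weight_nonneg[OF ab])
      finally show ?thesis .
    qed
    moreover have "?c > 0" using c(1) N by simp
    ultimately show ?thesis by blast
  qed
  ultimately show thesis using that by blast
qed

text \<open>On the level of coefficients, \<open>g\<close> is the \<open>i\<close>-th derivative of \<open>v\<close>. Squares suffice for the norms, so
  signs need not be tracked.\<close>

definition coeffs_match :: "real \<Rightarrow> real \<Rightarrow> (real \<Rightarrow> real) \<Rightarrow> nat \<Rightarrow> (real \<Rightarrow> real) \<Rightarrow> bool" where
  "coeffs_match a b v i g \<longleftrightarrow> jacobi_L2 (a + real i) (b + real i) g \<and>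
     (\<forall>k. (jacobi_coeff (a + real i) (b + real i) g k)\<^sup>2
        = deriv_weight a b i (k + i) * (jacobi_coeff a b v (k + i))\<^sup>2)"

lemma coeffs_match_Suc:
  assumes ab: "a > -1" "b > -1" and g: "coeffs_match a b v i g"
    and h: "jacobi_L2 (a + real (Suc i)) (b + real (Suc i)) h"
    and gh: "has_weak_deriv 1 g h"
  shows "coeffs_match a b v (Suc i) h"
proof -
  have ai: "a + real (Suc i) = a + real i + 1" "b + real (Suc i) = b + real i + 1" by auto
  have abi: "a + real i > -1" "b + real i > -1" using ab by auto
  have "(jacobi_coeff (a + real (Suc i)) (b + real (Suc i)) h k)\<^sup>2
      = deriv_weight a b (Suc i) (k + Suc i) * (jacobi_coeff a b v (k + Suc i))\<^sup>2" for k
    unfolding ai deriv_weight_Suc[OF ab]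
    using jacobi_coeff_weak_deriv[OF abi _ h[unfolded ai] gh, of k] g[unfolded coeffs_match_def]
    by (simp add: power_mult_distrib)
  then show ?thesis using h unfolding coeffs_match_def by blast
qed

lemma coeffs_match_sums:
  assumes ab: "a > -1" "b > -1" and g: "coeffs_match a b v i g"
  shows "(\<lambda>j. deriv_weight a b i j * (jacobi_coeff a b v j)\<^sup>2) sums
    (weighted_norm (rho (a + real i) (b + real i)) g)\<^sup>2"
proof -
  have abi: "a + real i > -1" "b + real i > -1" using ab by auto
  let ?J = "jacobi_measure (a + real i) (b + real i)"
  interpret orthonormal_basis_L2 ?J "jacobi_G_normalized (a + real i) (b + real i)"
    by (rule jacobi_orthonormal_basis[OF abi])
  have sq: "sq_integrable ?J g" using g by (simp add: coeffs_match_def)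
  have gm: "g \<in> unit_measurable" by (rule jacobi_L2_measurable[OF sq])
  have "(\<lambda>k. (jacobi_coeff (a + real i) (b + real i) g k)\<^sup>2) sums inner_L2 ?J g g"
    using parseval[OF sq sq] by (simp add: jacobi_coeff_inner[OF gm] power2_eq_square)
  then have "(\<lambda>k. deriv_weight a b i (k + i) * (jacobi_coeff a b v (k + i))\<^sup>2) sums inner_L2 ?J g g"
    using g by (simp add: coeffs_match_def)
  then have "(\<lambda>j. deriv_weight a b i j * (jacobi_coeff a b v j)\<^sup>2) sums inner_L2 ?J g g"
    by (subst (asm) sums_iff_shift) (simp add: deriv_weight_eq_0)
  then show ?thesis
    by (simp add: weighted_norm_jacobi[OF gm] inner_L2_self_nonneg)
qed

lemma coeffs_match_0:
  assumes "jacobi_L2 a b v" "g \<in> unit_measurable"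
    "AE x in lebesgue_on unit_ivl. v x = g x"
  shows "coeffs_match a b v 0 g"
proof -
  have vm: "v \<in> unit_measurable" by (rule jacobi_L2_measurable[OF assms(1)])
  have "jacobi_L2 a b g"
    by (rule sq_integrable_AE_cong[OF assms(1)]) (simp_all add: assms AE_jacobi_measure)
  moreover have "jacobi_coeff a b g k = jacobi_coeff a b v k" for k
    unfolding jacobi_coeff_inner[OF vm] jacobi_coeff_inner[OF assms(2)]
    by (rule inner_L2_cong_AE[symmetric])
      (simp_all add: vm assms AE_jacobi_measure jacobi_G_normalized_measurable)
  ultimately show ?thesis by (simp add: coeffs_match_def deriv_weight_def)
qed

lemma has_weak_deriv_weak_deriv: "has_weak_deriv j v g \<Longrightarrow> has_weak_deriv j v (weak_deriv j v)"
  unfolding weak_deriv_def by (rule someI[of "has_weak_deriv j v"])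

lemma has_weak_deriv_measurable:
  assumes "has_weak_deriv j v g"
  shows "v \<in> unit_measurable" "g \<in> unit_measurable"
  using assms locally_integrable_measurable unfolding has_weak_deriv_def by blast+

lemma sobolev_space_D:
  assumes "v \<in> sobolev_space a b n" "j \<le> n"
  shows "has_weak_deriv j v (weak_deriv j v)"
    "jacobi_L2 (a + real j) (b + real j) (weak_deriv j v)"
  using assms has_weak_deriv_weak_deriv unfolding sobolev_space_def sq_integrable_jacobi by blast+

lemma sobolev_space_coeffs_match:
  assumes ab: "a > -1" "b > -1" and v: "v \<in> sobolev_space a b n"
  shows "jacobi_L2 a b v"
    and "i \<le> n \<Longrightarrow> coeffs_match a b v i (weak_deriv i v)"
proof -
  note wd = sobolev_space_D[OF v]
  have wd0: "has_weak_deriv 0 v (weak_deriv 0 v)" by (rule wd) simp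
  have loc: "locally_integrable v" using wd0 unfolding has_weak_deriv_def by blast
  have ae: "AE x in lebesgue_on unit_ivl. weak_deriv 0 v x = v x"
    by (rule has_weak_deriv_unique[OF wd0 has_weak_deriv_0_self[OF loc]])
  have sq0: "jacobi_L2 a b (weak_deriv 0 v)"
    using wd(2)[of 0] by simp
  show sq: "jacobi_L2 a b v"
    by (rule sq_integrable_AE_cong[OF sq0])
      (simp_all add: ae AE_jacobi_measure locally_integrable_measurable[OF loc])
  show "i \<le> n \<Longrightarrow> coeffs_match a b v i (weak_deriv i v)"
  proof (induction i)
    case 0
    show ?case
      by (rule coeffs_match_0[OF sq has_weak_deriv_measurable(2)[OF wd0]])
        (use ae in eventually_elim, simp)
  next
    case (Suc i)
    then have "coeffs_match a b v i (weak_deriv i v)" by simp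
    then show ?case
    proof (rule coeffs_match_Suc[OF ab])
      show "has_weak_deriv 1 (weak_deriv i v) (weak_deriv (Suc i) v)"
        using Suc.prems by (intro has_weak_deriv_Suc_decompose[of i v] wd) auto
    qed (rule wd(2)[OF Suc.prems])
  qed
qed

lemma sobolev_norm_sums:
  assumes ab: "a > -1" "b > -1" and v: "v \<in> sobolev_space a b n"
  shows "(\<lambda>j. sobolev_weight a b n j * (jacobi_coeff a b v j)\<^sup>2) sums (sobolev_norm a b n v)\<^sup>2"
proof -
  have "(\<lambda>j. \<Sum>i\<le>n. deriv_weight a b i j * (jacobi_coeff a b v j)\<^sup>2) sums
      (\<Sum>i\<le>n. (weighted_norm (rho (a + real i) (b + real i)) (weak_deriv i v))\<^sup>2)"
    by (intro sums_sum coeffs_match_sums[OF ab] sobolev_space_coeffs_match(2)[OF ab v]) simp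
  then show ?thesis
    by (simp add: sobolev_norm_def sobolev_weight_def sum_distrib_right sum_nonneg)
qed

text \<open>From left to right the weak derivatives have the expected coefficients. From right to left the
  derivatives are constructed one after another, each existing because its coefficients are square
  summable.\<close>

lemma sobolev_space_eq_jacobi:
  assumes ab: "a > -1" "b > -1"
  shows "sobolev_space a b n = H_jacobi_space a b (real n)"
proof -
  obtain c C where cC: "c > 0" "C > 0"
    "\<And>j. c * freq j ^ n \<le> sobolev_weight a b n j"
    "\<And>j. sobolev_weight a b n j \<le> C * freq j ^ n"
    by (rule sobolev_weight_bounds[OF ab, of n]) (rule that)
  have powr: "freq j powr real n = freq j ^ n" for j
    by (rule powr_realpow) (simp add: add_pos_nonneg)
  show ?thesis
  proof (intro equalityI subsetI)
    fix v assume v: "v \<in> sobolev_space a b n"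
    have "summable (\<lambda>j. freq j ^ n * (jacobi_coeff a b v j)\<^sup>2)"
    proof (rule summable_weighted_mono[OF sums_summable[OF sobolev_norm_sums[OF ab v]]])
      show "freq j ^ n \<le> inverse c * sobolev_weight a b n j" for j
        using cC(3)[of j] cC(1) by (simp add: field_simps)
    qed simp
    then show "v \<in> H_jacobi_space a b (real n)"
      using sobolev_space_coeffs_match(1)[OF ab v]
      unfolding H_jacobi_space_def sq_integrable_jacobi powr by simp
  next
    fix v assume v: "v \<in> H_jacobi_space a b (real n)"
    then have sq: "jacobi_L2 a b v"
      and sum: "summable (\<lambda>j. freq j ^ n * (jacobi_coeff a b v j)\<^sup>2)"
      unfolding H_jacobi_space_def sq_integrable_jacobi powr by auto
    have ex: "i \<le> n \<Longrightarrow> \<exists>g. has_weak_deriv i v g \<and> coeffs_match a b v i g" for i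
    proof (induction i)
      case 0
      have "coeffs_match a b v 0 v"
        by (rule coeffs_match_0[OF sq jacobi_L2_measurable[OF sq]]) simp
      then show ?case using has_weak_deriv_0_self[OF jacobi_L2_locally_integrable[OF sq]] by blast
    next
      case (Suc i)
      then obtain g where g: "has_weak_deriv i v g" "coeffs_match a b v i g" by auto
      have abi: "a + real i > -1" "b + real i > -1" using ab by auto
      have sqg: "jacobi_L2 (a + real i) (b + real i) g"
        using g(2) by (simp add: coeffs_match_def)
      have terms: "(jacobi_deriv_factor (a + real i) (b + real i) k * jacobi_coeff (a + real i) (b + real i) g (Suc k))\<^sup>2
          = deriv_weight a b (Suc i) (k + Suc i) * (jacobi_coeff a b v (k + Suc i))\<^sup>2" for k
        using g(2) unfolding deriv_weight_Suc[OF ab] power_mult_distrib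
        by (simp add: coeffs_match_def)
      have "summable (\<lambda>j. deriv_weight a b (Suc i) j * (jacobi_coeff a b v j)\<^sup>2)"
      proof (rule summable_weighted_mono[OF sum deriv_weight_nonneg[OF ab]])
        fix j
        have "deriv_weight a b (Suc i) j \<le> sobolev_weight a b n j"
          unfolding sobolev_weight_def using Suc.prems
          by (intro member_le_sum) (auto intro: deriv_weight_nonneg[OF ab])
        then show "deriv_weight a b (Suc i) j \<le> C * freq j ^ n" using cC(4)[of j] by linarith
      qed
      then have "summable (\<lambda>k. (jacobi_deriv_factor (a + real i) (b + real i) k
          * jacobi_coeff (a + real i) (b + real i) g (Suc k))\<^sup>2)"
        unfolding terms by (subst summable_iff_shift)
      from weak_deriv_exists[OF abi sqg this] obtain h
        where h: "jacobi_L2 (a + real i + 1) (b + real i + 1) h" "has_weak_deriv 1 g h"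
        by blast
      have ai: "a + real (Suc i) = a + real i + 1" "b + real (Suc i) = b + real i + 1" by auto
      have "coeffs_match a b v (Suc i) h"
        by (rule coeffs_match_Suc[OF ab g(2) _ h(2)]) (use h(1) in \<open>simp only: ai\<close>)
      then show ?case using has_weak_deriv_Suc_compose[OF g(1) h(2)] by blast
    qed
    show "v \<in> sobolev_space a b n"
      unfolding sobolev_space_def
    proof (intro CollectI allI impI conjI)
      fix i assume "i \<le> n"
      then obtain g where g: "has_weak_deriv i v g" "coeffs_match a b v i g" using ex by blast
      then show "\<exists>g. has_weak_deriv i v g" by blast
      have wd: "has_weak_deriv i v (weak_deriv i v)" by (rule has_weak_deriv_weak_deriv[OF g(1)])
      have sqg: "jacobi_L2 (a + real i) (b + real i) g"
        using g(2) by (simp add: coeffs_match_def)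
      show "weak_deriv i v \<in> weighted_L2 (rho (a + real i) (b + real i))"
        unfolding sq_integrable_jacobi[symmetric]
        by (rule sq_integrable_AE_cong[OF sqg])
          (simp_all add: has_weak_deriv_measurable(2)[OF wd] AE_jacobi_measure has_weak_deriv_unique[OF g(1) wd])
    qed
  qed
qed

text \<open>The square of the norm; two-sided estimates are proved for squares, which can be
  compared term by term, and square roots are taken at the end.\<close>

definition jacobi_sum :: "real \<Rightarrow> real \<Rightarrow> real \<Rightarrow> (real \<Rightarrow> real) \<Rightarrow> real" where
  "jacobi_sum a b s v = (\<Sum>j. freq j powr s * (jacobi_coeff a b v j)\<^sup>2)"

lemma sobolev_norm_equivalent:
  assumes ab: "a > -1" "b > -1"
  obtains c C where "c > 0" "C > 0"
    "\<And>v. v \<in> sobolev_space a b n \<Longrightarrow> c * jacobi_sum a b (real n) v \<le> (sobolev_norm a b n v)\<^sup>2"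
    "\<And>v. v \<in> sobolev_space a b n \<Longrightarrow> (sobolev_norm a b n v)\<^sup>2 \<le> C * jacobi_sum a b (real n) v"
proof -
  obtain c C where cC: "c > 0" "C > 0"
    "\<And>j. c * freq j ^ n \<le> sobolev_weight a b n j"
    "\<And>j. sobolev_weight a b n j \<le> C * freq j ^ n"
    by (rule sobolev_weight_bounds[OF ab, of n]) (rule that)
  have powr: "freq j powr real n = freq j ^ n" for j
    by (rule powr_realpow) (simp add: add_pos_nonneg)
  have sum: "(\<lambda>j. freq j ^ n * (jacobi_coeff a b v j)\<^sup>2) sums jacobi_sum a b (real n) v"
    if "v \<in> sobolev_space a b n" for v
    using that unfolding sobolev_space_eq_jacobi[OF ab] H_jacobi_space_def jacobi_sum_def powr
    by (auto intro: summable_sums)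
  have "c * jacobi_sum a b (real n) v \<le> (sobolev_norm a b n v)\<^sup>2" if v: "v \<in> sobolev_space a b n" for v
  proof (rule sums_le[OF _ sums_mult[OF sum[OF v]] sobolev_norm_sums[OF ab v]])
    fix j show "c * (freq j ^ n * (jacobi_coeff a b v j)\<^sup>2) \<le> sobolev_weight a b n j * (jacobi_coeff a b v j)\<^sup>2"
      unfolding mult.assoc[symmetric] using cC(3) by (intro mult_right_mono) auto
  qed
  moreover have "(sobolev_norm a b n v)\<^sup>2 \<le> C * jacobi_sum a b (real n) v" if v: "v \<in> sobolev_space a b n" for v
  proof (rule sums_le[OF _ sobolev_norm_sums[OF ab v] sums_mult[OF sum[OF v]]])
    fix j show "sobolev_weight a b n j * (jacobi_coeff a b v j)\<^sup>2 \<le> C * (freq j ^ n * (jacobi_coeff a b v j)\<^sup>2)"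
      unfolding mult.assoc[symmetric] using cC(4) by (intro mult_right_mono) auto
  qed
  ultimately show thesis using that cC(1,2) by blast
qed

section \<open>Spaces defined by Jacobi coefficients\<close>

lemma H_jacobi_space_iff:
  "v \<in> H_jacobi_space a b s \<longleftrightarrow> jacobi_L2 a b v \<and>
    summable (\<lambda>j. freq j powr s * (jacobi_coeff a b v j)\<^sup>2)"
  by (simp add: H_jacobi_space_def sq_integrable_jacobi)

lemma jacobi_sum_sums:
  "v \<in> H_jacobi_space a b s \<Longrightarrow>
    (\<lambda>j. freq j powr s * (jacobi_coeff a b v j)\<^sup>2) sums jacobi_sum a b s v"
  by (simp add: H_jacobi_space_iff jacobi_sum_def summable_sums)

lemma jacobi_sum_nonneg: "v \<in> H_jacobi_space a b s \<Longrightarrow> 0 \<le> jacobi_sum a b s v"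
  by (rule sums_le[OF _ sums_zero jacobi_sum_sums]) auto

lemma jacobi_coeff_diff:
  assumes ab: "a > -1" "b > -1"
    and u: "jacobi_L2 a b u" and v: "jacobi_L2 a b v"
  shows "jacobi_coeff a b (\<lambda>x. u x - v x) j = jacobi_coeff a b u j - jacobi_coeff a b v j"
proof -
  interpret orthonormal_basis_L2 "jacobi_measure a b" "jacobi_G_normalized a b"
    by (rule jacobi_orthonormal_basis[OF ab])
  have "(\<lambda>x. u x - v x) \<in> unit_measurable"
    by (rule jacobi_L2_measurable[OF sq_integrable_diff[OF u v]])
  then show ?thesis
    using inner_L2_diff[OF u v sq_integrable_basis]
    by (simp add: jacobi_coeff_inner jacobi_L2_measurable[OF u] jacobi_L2_measurable[OF v])
qed

lemma jacobi_coeff_cmult: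
  assumes "jacobi_L2 a b u"
  shows "jacobi_coeff a b (\<lambda>x. c * u x) j = c * jacobi_coeff a b u j"
  using jacobi_L2_measurable[OF assms] jacobi_L2_measurable[OF sq_integrable_cmult[OF assms, of c]]
  by (simp add: jacobi_coeff_inner inner_L2_cmult)

lemma H_jacobi_space_cmult:
  assumes "u \<in> H_jacobi_space a b s" shows "(\<lambda>x. c * u x) \<in> H_jacobi_space a b s"
proof -
  have "summable (\<lambda>j. c\<^sup>2 * (freq j powr s * (jacobi_coeff a b u j)\<^sup>2))"
    using assms by (intro summable_mult) (simp add: H_jacobi_space_iff)
  then show ?thesis
    using assms by (auto simp: H_jacobi_space_iff jacobi_coeff_cmult power_mult_distrib mult_ac)
qed

lemma H_jacobi_norm_sqrt: "H_jacobi_norm a b s v = sqrt (jacobi_sum a b s v)"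
  by (simp add: H_jacobi_norm_def jacobi_sum_def)

lemma H_jacobi_norm_cmult:
  assumes "u \<in> H_jacobi_space a b s"
  shows "H_jacobi_norm a b s (\<lambda>x. c * u x) = \<bar>c\<bar> * H_jacobi_norm a b s u"
proof -
  have "jacobi_sum a b s (\<lambda>x. c * u x) = c\<^sup>2 * jacobi_sum a b s u"
    using assms unfolding jacobi_sum_def
    by (subst suminf_mult[symmetric]) (auto simp: H_jacobi_space_iff jacobi_coeff_cmult power_mult_distrib mult_ac)
  then show ?thesis by (simp add: H_jacobi_norm_sqrt real_sqrt_mult)
qed

lemma H_jacobi_space_antimono:
  assumes "r \<le> s" shows "H_jacobi_space a b s \<subseteq> H_jacobi_space a b r"
proof
  fix v assume v: "v \<in> H_jacobi_space a b s"
  have "summable (\<lambda>j. freq j powr r * (jacobi_coeff a b v j)\<^sup>2)"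
  proof (rule summable_weighted_mono[where C = 1])
    show "summable (\<lambda>j. freq j powr s * (jacobi_coeff a b v j)\<^sup>2)"
      using v by (simp add: H_jacobi_space_iff)
    show "freq j powr r \<le> 1 * freq j powr s" for j
      using assms powr_mono[of r s "freq j"] by simp
  qed simp
  then show "v \<in> H_jacobi_space a b r" using v by (simp add: H_jacobi_space_iff)
qed

lemma H_jacobi_space_diff:
  assumes ab: "a > -1" "b > -1" and u: "u \<in> H_jacobi_space a b s" and v: "v \<in> H_jacobi_space a b s"
  shows "(\<lambda>x. u x - v x) \<in> H_jacobi_space a b s"
proof -
  have "summable (\<lambda>j. freq j powr s * (jacobi_coeff a b u j - jacobi_coeff a b v j)\<^sup>2)"
  proof (rule summable_comparison_test')
    show "summable (\<lambda>j. 2 * (freq j powr s * (jacobi_coeff a b u j)\<^sup>2)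
        + 2 * (freq j powr s * (jacobi_coeff a b v j)\<^sup>2))"
      using u v by (intro summable_add summable_mult) (simp_all add: H_jacobi_space_iff)
    fix j
    have "(x - y)\<^sup>2 \<le> 2 * x\<^sup>2 + 2 * y\<^sup>2" for x y :: real
      using zero_le_power2[of "x + y"] by (simp add: power2_sum power2_diff)
    then have "freq j powr s * (jacobi_coeff a b u j - jacobi_coeff a b v j)\<^sup>2
        \<le> freq j powr s * (2 * (jacobi_coeff a b u j)\<^sup>2 + 2 * (jacobi_coeff a b v j)\<^sup>2)"
      by (intro mult_left_mono) auto
    then show "norm (freq j powr s * (jacobi_coeff a b u j - jacobi_coeff a b v j)\<^sup>2)
        \<le> 2 * (freq j powr s * (jacobi_coeff a b u j)\<^sup>2)
        + 2 * (freq j powr s * (jacobi_coeff a b v j)\<^sup>2)"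
      by (simp add: algebra_simps)
  qed
  then show ?thesis
    using u v by (auto simp: H_jacobi_space_iff jacobi_coeff_diff[OF ab])
qed

section \<open>The K-functional\<close>

text \<open>The squared K-functional of the two weighted sequence spaces: there the best splitting of \<open>u\<close>
  can be chosen separately for every degree, up to a constant factor.\<close>

definition K_sum :: "real \<Rightarrow> real \<Rightarrow> nat \<Rightarrow> nat \<Rightarrow> real \<Rightarrow> (real \<Rightarrow> real) \<Rightarrow> real" where
  "K_sum a b m n t u = (\<Sum>j. freq j powr real m * min 1 (t\<^sup>2 * freq j powr (real n - real m))
     * (jacobi_coeff a b u j)\<^sup>2)"

lemma K_sum_sums:
  assumes "u \<in> H_jacobi_space a b (real m)"
  shows "(\<lambda>j. freq j powr real m * min 1 (t\<^sup>2 * freq j powr (real n - real m)) * (jacobi_coeff a b u j)\<^sup>2)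
    sums K_sum a b m n t u"
  unfolding K_sum_def
proof (rule summable_sums, rule summable_weighted_mono[where C = 1])
  show "summable (\<lambda>j. freq j powr real m * (jacobi_coeff a b u j)\<^sup>2)"
    using assms by (simp add: H_jacobi_space_iff)
  show "freq j powr real m * min 1 (t\<^sup>2 * freq j powr (real n - real m)) \<le> 1 * freq j powr real m" for j
    by (simp add: mult_left_le)
qed simp

lemma sobolev_norm_nonneg: "0 \<le> sobolev_norm a b n v"
  by (simp add: sobolev_norm_def sum_nonneg)

lemma K_functional_bdd_below:
  assumes "t \<ge> 0"
  shows "bdd_below ((\<lambda>v. sobolev_norm a b m (\<lambda>x. u x - v x) + t * sobolev_norm a b n v) ` sobolev_space a b n)"
  by (rule bdd_belowI2[of _ 0]) (use assms sobolev_norm_nonneg in \<open>simp add: add_nonneg_nonneg\<close>)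

lemma K_functional_le:
  assumes "t \<ge> 0" "v \<in> sobolev_space a b n"
  shows "K_functional a b m n t u \<le> sobolev_norm a b m (\<lambda>x. u x - v x) + t * sobolev_norm a b n v"
  unfolding K_functional_def by (rule cINF_lower[OF K_functional_bdd_below[OF assms(1)] assms(2)])

lemma sobolev_space_nonempty:
  assumes ab: "a > -1" "b > -1" shows "sobolev_space a b n \<noteq> {}"
proof -
  have "(\<lambda>x. 0) \<in> sobolev_space a b n"
    unfolding sobolev_space_eq_jacobi[OF ab] H_jacobi_space_iff
    by (simp add: sq_integrable_def jacobi_coeff_def set_lebesgue_integral_def)
  then show ?thesis by blast
qed

lemma K_functional_ge:
  assumes ab: "a > -1" "b > -1"
    and "\<And>v. v \<in> sobolev_space a b n \<Longrightarrow> B \<le> sobolev_norm a b m (\<lambda>x. u x - v x) + t * sobolev_norm a b n v"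
  shows "B \<le> K_functional a b m n t u"
  unfolding K_functional_def by (rule cINF_greatest[OF sobolev_space_nonempty[OF ab] assms(3)])

lemma K_functional_nonneg:
  assumes ab: "a > -1" "b > -1" and "t \<ge> 0"
  shows "0 \<le> K_functional a b m n t u"
  by (rule K_functional_ge[OF ab]) (use assms(3) sobolev_norm_nonneg in \<open>simp add: add_nonneg_nonneg\<close>)

lemma K_functional_mono:
  assumes ab: "a > -1" "b > -1" and "0 \<le> t" "t \<le> t'"
  shows "K_functional a b m n t u \<le> K_functional a b m n t' u"
proof (rule K_functional_ge[OF ab])
  fix v assume "v \<in> sobolev_space a b n"
  then have "K_functional a b m n t u \<le> sobolev_norm a b m (\<lambda>x. u x - v x) + t * sobolev_norm a b n v"
    by (rule K_functional_le[OF assms(3)])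
  also have "t * sobolev_norm a b n v \<le> t' * sobolev_norm a b n v"
    using assms(4) sobolev_norm_nonneg by (intro mult_right_mono) auto
  finally show "K_functional a b m n t u \<le> sobolev_norm a b m (\<lambda>x. u x - v x) + t' * sobolev_norm a b n v"
    by simp
qed

text \<open>Compare with the splitting that moves exactly the finitely many degrees with
  \<open>t\<^sup>2 (1 + j\<^sup>2)\<^sup>n\<^sup>-\<^sup>m \<le> 1\<close> into the smooth part, which then is a polynomial.\<close>

lemma K_functional_upper:
  assumes ab: "a > -1" "b > -1" and mn: "m < n"
  obtains C where "C > 0"
    "\<And>t u. t > 0 \<Longrightarrow> u \<in> sobolev_space a b m \<Longrightarrow> (K_functional a b m n t u)\<^sup>2 \<le> C * K_sum a b m n t u"
proof -
  let ?q = "real n - real m"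
  obtain Cm where Cm: "Cm > 0"
    "\<And>v. v \<in> sobolev_space a b m \<Longrightarrow> (sobolev_norm a b m v)\<^sup>2 \<le> Cm * jacobi_sum a b (real m) v"
    by (rule sobolev_norm_equivalent[OF ab, of m]) (rule that)
  obtain Cn where Cn: "Cn > 0"
    "\<And>v. v \<in> sobolev_space a b n \<Longrightarrow> (sobolev_norm a b n v)\<^sup>2 \<le> Cn * jacobi_sum a b (real n) v"
    by (rule sobolev_norm_equivalent[OF ab, of n]) (rule that)
  interpret orthonormal_basis_L2 "jacobi_measure a b" "jacobi_G_normalized a b"
    by (rule jacobi_orthonormal_basis[OF ab])
  have "(K_functional a b m n t u)\<^sup>2 \<le> (2 * (Cm + Cn)) * K_sum a b m n t u"
    if t: "t > 0" and u: "u \<in> sobolev_space a b m" for t u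
  proof -
    let ?c = "jacobi_coeff a b u"
    have uH: "u \<in> H_jacobi_space a b (real m)" using u by (simp add: sobolev_space_eq_jacobi[OF ab])
    then have u_sq: "jacobi_L2 a b u" by (simp add: H_jacobi_space_iff)
    \<comment> \<open>The exponent \<open>n - m\<close> is at least \<open>1\<close>, so only degrees up to \<open>1 / t\<^sup>2\<close> occur.\<close>
    define F where "F = {j. t\<^sup>2 * freq j powr ?q \<le> 1}"
    have "finite F"
    proof (rule finite_subset)
      show "F \<subseteq> {..nat \<lceil>1 / t\<^sup>2\<rceil>}"
      proof
        fix j assume "j \<in> F"
        then have le: "freq j powr ?q \<le> 1 / t\<^sup>2" using t by (simp add: F_def field_simps)
        have "real j \<le> real (j * j)" unfolding of_nat_le_iff by (cases j) auto
        then have "real j \<le> freq j powr 1" by (simp add: power2_eq_square add_nonneg_nonneg)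
        also have "\<dots> \<le> freq j powr ?q" using mn by (intro powr_mono) auto
        finally have "real j \<le> 1 / t\<^sup>2" using le by linarith
        then show "j \<in> {..nat \<lceil>1 / t\<^sup>2\<rceil>}" by (simp add: le_nat_iff le_ceiling_iff)
      qed
    qed simp
    define v where "v x = (\<Sum>j\<in>F. ?c j * jacobi_G_normalized a b j x)" for x
    have v_sq: "jacobi_L2 a b v"
      unfolding v_def[abs_def] by (rule sq_integrable_combination)
    have v_coeff: "jacobi_coeff a b v j = (if j \<in> F then ?c j else 0)" for j
      unfolding jacobi_coeff_inner[OF jacobi_L2_measurable[OF v_sq]] unfolding v_def[abs_def]
      by (rule inner_combination[OF \<open>finite F\<close>])
    have vH: "v \<in> H_jacobi_space a b r" for r
      unfolding H_jacobi_space_iff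
      using v_sq summable_finite[OF \<open>finite F\<close>, of "\<lambda>j. freq j powr r * (jacobi_coeff a b v j)\<^sup>2"]
      by (simp add: v_coeff)
    have diffH: "(\<lambda>x. u x - v x) \<in> H_jacobi_space a b (real m)"
      by (rule H_jacobi_space_diff[OF ab uH vH])
    note K_sums = K_sum_sums[OF uH, of t n]
    have 1: "jacobi_sum a b (real m) (\<lambda>x. u x - v x) \<le> K_sum a b m n t u"
    proof (rule sums_le[OF _ jacobi_sum_sums[OF diffH] K_sums])
      fix j
      show "freq j powr real m * (jacobi_coeff a b (\<lambda>x. u x - v x) j)\<^sup>2
          \<le> freq j powr real m * min 1 (t\<^sup>2 * freq j powr ?q) * (?c j)\<^sup>2"
        unfolding jacobi_coeff_diff[OF ab u_sq v_sq] v_coeff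
        by (cases "j \<in> F") (auto simp: F_def min_def)
    qed
    have 2: "t\<^sup>2 * jacobi_sum a b (real n) v \<le> K_sum a b m n t u"
    proof (rule sums_le[OF _ sums_mult[OF jacobi_sum_sums[OF vH]] K_sums])
      fix j
      have "freq j powr real n = freq j powr real m * freq j powr ?q"
        by (simp add: powr_add[symmetric])
      then show "t\<^sup>2 * (freq j powr real n * (jacobi_coeff a b v j)\<^sup>2)
          \<le> freq j powr real m * min 1 (t\<^sup>2 * freq j powr ?q) * (?c j)\<^sup>2"
        unfolding v_coeff by (cases "j \<in> F") (auto simp: F_def min_def mult_ac)
    qed
    let ?X = "sobolev_norm a b m (\<lambda>x. u x - v x)" and ?Y = "sobolev_norm a b n v"
    let ?S = "K_sum a b m n t u" and ?K = "K_functional a b m n t u"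
    have "?K \<le> ?X + t * ?Y"
      using t vH[of "real n"] by (intro K_functional_le) (auto simp: sobolev_space_eq_jacobi[OF ab])
    then have "(?K)\<^sup>2 \<le> (?X + t * ?Y)\<^sup>2"
      using K_functional_nonneg[OF ab, of t m n u] t by (intro power_mono) auto
    also have "\<dots> \<le> 2 * ((?X)\<^sup>2 + t\<^sup>2 * (?Y)\<^sup>2)"
      using zero_le_power2[of "?X - t * ?Y"]
      by (simp add: power2_sum power2_diff power_mult_distrib)
    also have "\<dots> \<le> 2 * (Cm * ?S + Cn * ?S)"
    proof -
      have "(?X)\<^sup>2 \<le> Cm * jacobi_sum a b (real m) (\<lambda>x. u x - v x)"
        by (rule Cm(2)) (use diffH in \<open>simp add: sobolev_space_eq_jacobi[OF ab]\<close>)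
      also have "\<dots> \<le> Cm * ?S" using 1 Cm(1) by (intro mult_left_mono) auto
      finally have A: "(?X)\<^sup>2 \<le> Cm * ?S" .
      have "t\<^sup>2 * (?Y)\<^sup>2 \<le> t\<^sup>2 * (Cn * jacobi_sum a b (real n) v)"
        using vH[of "real n"] by (intro mult_left_mono Cn(2)) (auto simp: sobolev_space_eq_jacobi[OF ab])
      also have "\<dots> = Cn * (t\<^sup>2 * jacobi_sum a b (real n) v)" by simp
      also have "\<dots> \<le> Cn * ?S" using 2 Cn(1) by (intro mult_left_mono) auto
      finally show ?thesis using A by simp
    qed
    finally show ?thesis by (simp add: algebra_simps)
  qed
  moreover have "2 * (Cm + Cn) > 0" using Cm(1) Cn(1) by simp
  ultimately show thesis using that by blast
qed

text \<open>For every admissible \<open>v\<close> with coefficients \<open>d\<^sub>j\<close>, use \<open>c\<^sub>j\<^sup>2 \<le> 2 (c\<^sub>j - d\<^sub>j)\<^sup>2 + 2 d\<^sub>j\<^sup>2\<close> in each degree and bound the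
  minimum by \<open>1\<close> in the first term and by \<open>t\<^sup>2 (1 + j\<^sup>2)\<^sup>n\<^sup>-\<^sup>m\<close> in the second.\<close>

lemma K_functional_lower:
  assumes ab: "a > -1" "b > -1" and mn: "m < n"
  obtains M where "M > 0"
    "\<And>t u. t > 0 \<Longrightarrow> u \<in> sobolev_space a b m \<Longrightarrow> K_sum a b m n t u \<le> M * (K_functional a b m n t u)\<^sup>2"
proof -
  let ?q = "real n - real m"
  obtain cm where cm: "cm > 0"
    "\<And>v. v \<in> sobolev_space a b m \<Longrightarrow> cm * jacobi_sum a b (real m) v \<le> (sobolev_norm a b m v)\<^sup>2"
    by (rule sobolev_norm_equivalent[OF ab, of m]) (rule that)
  obtain cn where cn: "cn > 0"
    "\<And>v. v \<in> sobolev_space a b n \<Longrightarrow> cn * jacobi_sum a b (real n) v \<le> (sobolev_norm a b n v)\<^sup>2"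
    by (rule sobolev_norm_equivalent[OF ab, of n]) (rule that)
  define M where "M = 2 * inverse cm + 2 * inverse cn"
  have M: "M > 0" unfolding M_def using cm(1) cn(1) by (intro add_pos_pos) simp_all
  have "K_sum a b m n t u \<le> M * (K_functional a b m n t u)\<^sup>2"
    if t: "t > 0" and u: "u \<in> sobolev_space a b m" for t u
  proof -
    let ?c = "jacobi_coeff a b u"
    have uH: "u \<in> H_jacobi_space a b (real m)" using u by (simp add: sobolev_space_eq_jacobi[OF ab])
    then have u_sq: "jacobi_L2 a b u" by (simp add: H_jacobi_space_iff)
    note K_sums = K_sum_sums[OF uH, of t n]
    have K_sum_nonneg: "0 \<le> K_sum a b m n t u"
      by (rule sums_le[OF _ sums_zero K_sums]) auto
    have "sqrt (K_sum a b m n t u / M) \<le> K_functional a b m n t u"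
    proof (rule K_functional_ge[OF ab])
      fix v assume v: "v \<in> sobolev_space a b n"
      let ?X = "sobolev_norm a b m (\<lambda>x. u x - v x)" and ?Y = "sobolev_norm a b n v"
      have vH: "v \<in> H_jacobi_space a b (real n)" using v by (simp add: sobolev_space_eq_jacobi[OF ab])
      then have v_sq: "jacobi_L2 a b v" by (simp add: H_jacobi_space_iff)
      have vHm: "v \<in> H_jacobi_space a b (real m)"
        using vH H_jacobi_space_antimono[of "real m" "real n" a b] mn by auto
      have diffH: "(\<lambda>x. u x - v x) \<in> H_jacobi_space a b (real m)"
        by (rule H_jacobi_space_diff[OF ab uH vHm])
      have "K_sum a b m n t u \<le> 2 * jacobi_sum a b (real m) (\<lambda>x. u x - v x) + 2 * t\<^sup>2 * jacobi_sum a b (real n) v"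
      proof (rule sums_le[OF _ K_sums sums_add[OF sums_mult[OF jacobi_sum_sums[OF diffH]] sums_mult[OF jacobi_sum_sums[OF vH]]]])
        fix j
        let ?d = "jacobi_coeff a b v j"
        let ?\<mu> = "min 1 (t\<^sup>2 * freq j powr ?q)"
        have pow: "freq j powr real n = freq j powr real m * freq j powr ?q"
          by (simp add: powr_add[symmetric])
        have \<mu>: "0 \<le> ?\<mu>" "?\<mu> \<le> 1" "?\<mu> \<le> t\<^sup>2 * freq j powr ?q" by auto
        have "?\<mu> * (?c j)\<^sup>2 \<le> ?\<mu> * (2 * (?c j - ?d)\<^sup>2 + 2 * ?d\<^sup>2)"
        proof (rule mult_left_mono[OF _ \<mu>(1)])
          have "(?c j)\<^sup>2 = ((?c j - ?d) + ?d)\<^sup>2" by simp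
          also have "\<dots> \<le> 2 * (?c j - ?d)\<^sup>2 + 2 * ?d\<^sup>2"
            using zero_le_power2[of "(?c j - ?d) - ?d"] unfolding power2_sum power2_diff[of "?c j - ?d"] by linarith
          finally show "(?c j)\<^sup>2 \<le> 2 * (?c j - ?d)\<^sup>2 + 2 * ?d\<^sup>2" .
        qed
        also have "\<dots> = ?\<mu> * (2 * (?c j - ?d)\<^sup>2) + ?\<mu> * (2 * ?d\<^sup>2)" by (rule distrib_left)
        also have "\<dots> \<le> 1 * (2 * (?c j - ?d)\<^sup>2) + (t\<^sup>2 * freq j powr ?q) * (2 * ?d\<^sup>2)"
          by (intro add_mono mult_right_mono \<mu>) auto
        finally have "freq j powr real m * (?\<mu> * (?c j)\<^sup>2)
            \<le> freq j powr real m * (1 * (2 * (?c j - ?d)\<^sup>2) + (t\<^sup>2 * freq j powr ?q) * (2 * ?d\<^sup>2))"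
          by (rule mult_left_mono) simp
        then show "freq j powr real m * ?\<mu> * (?c j)\<^sup>2
            \<le> 2 * (freq j powr real m * (jacobi_coeff a b (\<lambda>x. u x - v x) j)\<^sup>2) + 2 * t\<^sup>2 * (freq j powr real n * ?d\<^sup>2)"
          unfolding jacobi_coeff_diff[OF ab u_sq v_sq] pow by (simp add: algebra_simps)
      qed
      also have "\<dots> \<le> 2 * (inverse cm * ?X\<^sup>2) + 2 * t\<^sup>2 * (inverse cn * ?Y\<^sup>2)"
      proof (intro add_mono mult_left_mono)
        show "jacobi_sum a b (real m) (\<lambda>x. u x - v x) \<le> inverse cm * ?X\<^sup>2"
          using cm(2)[of "\<lambda>x. u x - v x"] diffH cm(1)
          by (simp add: sobolev_space_eq_jacobi[OF ab] field_simps)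
        show "jacobi_sum a b (real n) v \<le> inverse cn * ?Y\<^sup>2"
          using cn(2)[OF v] cn(1) by (simp add: field_simps)
      qed auto
      also have "\<dots> \<le> M * (?X + t * ?Y)\<^sup>2"
      proof -
        have X: "0 \<le> ?X" and Y: "0 \<le> t * ?Y" using t sobolev_norm_nonneg by simp_all
        have "?X\<^sup>2 \<le> (?X + t * ?Y)\<^sup>2" "(t * ?Y)\<^sup>2 \<le> (?X + t * ?Y)\<^sup>2"
          using X Y by (auto intro!: power_mono)
        then have "(2 * inverse cm) * ?X\<^sup>2 + (2 * inverse cn) * (t * ?Y)\<^sup>2
            \<le> (2 * inverse cm) * (?X + t * ?Y)\<^sup>2 + (2 * inverse cn) * (?X + t * ?Y)\<^sup>2"
          using cm(1) cn(1) by (intro add_mono mult_left_mono) auto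
        then show ?thesis unfolding M_def by (simp only: distrib_right power_mult_distrib mult_ac)
      qed
      finally have "K_sum a b m n t u / M \<le> (?X + t * ?Y)\<^sup>2" using M by (simp add: field_simps)
      then have "sqrt (K_sum a b m n t u / M) \<le> sqrt ((?X + t * ?Y)\<^sup>2)" by (rule real_sqrt_le_mono)
      then show "sqrt (K_sum a b m n t u / M) \<le> ?X + t * ?Y"
        using t sobolev_norm_nonneg[of a b m "\<lambda>x. u x - v x"] sobolev_norm_nonneg[of a b n v] by simp
    qed
    then have "(sqrt (K_sum a b m n t u / M))\<^sup>2 \<le> (K_functional a b m n t u)\<^sup>2"
      using K_sum_nonneg M by (intro power_mono) auto
    then show ?thesis using K_sum_nonneg M by (simp add: field_simps)
  qed
  with M that show thesis by blast
qed

section \<open>Interpolation spaces of fractional order\<close>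

text \<open>By homogeneity the integral scales like \<open>l powr \<theta>\<close>: this is what turns the two integer orders
  into the intermediate one.\<close>

lemma interpolation_kernel_integral:
  assumes \<theta>: "0 < \<theta>" "\<theta> < 1" and l: "l > 0"
  shows "(\<integral>\<^sup>+t. ennreal (indicat_real {0<..} t * (t powr (- 2 * \<theta>) * min 1 (t\<^sup>2 * l) / t)) \<partial>lborel)
    = ennreal ((1 / (2 - 2 * \<theta>) + 1 / (2 * \<theta>)) * l powr \<theta>)"
proof -
  let ?f = "\<lambda>t. indicat_real {0<..} t * (t powr (- 2 * \<theta>) * min 1 (t\<^sup>2 * l) / t)"
  \<comment> \<open>The point at which the two branches of the minimum meet.\<close>
  define T where "T = l powr (- 1 / 2)"
  have T: "T > 0" using l by (simp add: T_def)
  have T2: "T\<^sup>2 * l = 1"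
  proof -
    have "T\<^sup>2 = l powr (- 1)" using l by (simp add: T_def power2_eq_square powr_add[symmetric])
    then show ?thesis using l by (simp add: powr_minus)
  qed
  have "((\<lambda>t. l * t powr (1 - 2 * \<theta>)) has_integral l * (T powr (1 - 2 * \<theta> + 1) / (1 - 2 * \<theta> + 1))) {0..T}"
    using \<theta> T by (intro has_integral_mult_right has_integral_powr_from_0) auto
  then have 1: "(?f has_integral l * (T powr (1 - 2 * \<theta> + 1) / (1 - 2 * \<theta> + 1))) {0..T}"
  proof (rule has_integral_eq[rotated])
    fix t assume t: "t \<in> {0..T}"
    show "l * t powr (1 - 2 * \<theta>) = ?f t"
    proof (cases "t = 0")
      case False
      then have t0: "t > 0" using t by simp
      have "t\<^sup>2 \<le> T\<^sup>2" using t by (intro power_mono) auto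
      then have "t\<^sup>2 * l \<le> T\<^sup>2 * l" using l by (intro mult_right_mono) auto
      then have "min 1 (t\<^sup>2 * l) = t\<^sup>2 * l" by (simp add: T2)
      moreover have "t powr (1 - 2 * \<theta>) = t powr (- 2 * \<theta>) * t"
        using t0 powr_add[of t "- 2 * \<theta>" 1] by simp
      ultimately show ?thesis using t0 by (simp add: power2_eq_square)
    qed simp
  qed
  have "((\<lambda>t. t powr (- 2 * \<theta> - 1)) has_integral - (T powr (- 2 * \<theta> - 1 + 1)) / (- 2 * \<theta> - 1 + 1)) {T..}"
    using \<theta> T by (intro has_integral_powr_to_inf) auto
  then have 2: "(?f has_integral - (T powr (- 2 * \<theta> - 1 + 1)) / (- 2 * \<theta> - 1 + 1)) {T..}"
  proof (rule has_integral_eq[rotated])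
    fix t assume t: "t \<in> {T..}"
    then have t0: "t > 0" using T by simp
    have "T\<^sup>2 \<le> t\<^sup>2" using t T by (intro power_mono) auto
    then have "T\<^sup>2 * l \<le> t\<^sup>2 * l" using l by (intro mult_right_mono) auto
    then have "min 1 (t\<^sup>2 * l) = 1" by (simp add: T2)
    moreover have "t powr (- 2 * \<theta> - 1) = t powr (- 2 * \<theta>) / t"
      using t0 powr_diff[of t "- 2 * \<theta>" 1] by simp
    ultimately show "t powr (- 2 * \<theta> - 1) = ?f t" using t0 by simp
  qed
  let ?V = "l * (T powr (1 - 2 * \<theta> + 1) / (1 - 2 * \<theta> + 1)) + - (T powr (- 2 * \<theta> - 1 + 1)) / (- 2 * \<theta> - 1 + 1)"
  have "negligible ({0..T} \<inter> {T..})"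
    by (rule negligible_subset[of "{T}"]) auto
  from has_integral_Un[OF 1 2 this] have "(?f has_integral ?V) ({0..T} \<union> {T..})" .
  then have "(?f has_integral ?V) UNIV"
    by (rule has_integral_on_superset) (use T in \<open>auto simp: indicator_def\<close>)
  then have "(\<integral>\<^sup>+t. ennreal (?f t) \<partial>lborel) = ennreal ?V"
  proof (intro nn_integral_has_integral_lborel)
    show "?f \<in> borel_measurable borel" by measurable
    show "0 \<le> ?f t" for t using l by (auto simp: indicator_def)
  qed
  also have "?V = (1 / (2 - 2 * \<theta>) + 1 / (2 * \<theta>)) * l powr \<theta>"
  proof -
    have "l * T powr (2 - 2 * \<theta>) = l powr 1 * l powr (- 1 / 2 * (2 - 2 * \<theta>))"
      using l by (simp add: T_def powr_powr)
    also have "\<dots> = l powr \<theta>"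
      unfolding powr_add[symmetric] by (rule arg_cong[of _ _ "(powr) l"]) (simp add: algebra_simps)
    finally have A: "l * T powr (2 - 2 * \<theta>) = l powr \<theta>" .
    have "T powr (- 2 * \<theta>) = l powr \<theta>" using l by (simp add: T_def powr_powr)
    then show ?thesis using A \<theta> by (simp add: algebra_simps)
  qed
  finally show ?thesis .
qed

text \<open>Exchange the integral over \<open>t\<close> with the sum over the degrees in \<^const>\<open>K_sum\<close>. The kernel integral
  turns the weight of degree \<open>j\<close> into \<open>\<kappa> (1 + j\<^sup>2) powr (m + \<theta> (n - m))\<close>, whose exponent is \<open>s\<close>. Extended nonnegative integrals
  are used so that finiteness on one side gives finiteness on the other.\<close>

lemma interp_space_eq_jacobi:
  assumes ab: "a > -1" "b > -1" and s: "real m < s" "s < real n"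
  shows "interp_space a b m n s = H_jacobi_space a b s"
    and "\<exists>c>0. \<exists>C>0. \<forall>u\<in>H_jacobi_space a b s.
      c * jacobi_sum a b s u \<le> (interp_norm a b m n s u)\<^sup>2 \<and> (interp_norm a b m n s u)\<^sup>2 \<le> C * jacobi_sum a b s u"
proof -
  have mn: "m < n" using s by simp
  let ?q = "real n - real m"
  define \<theta> where "\<theta> = interp_exponent m n s"
  have \<theta>: "0 < \<theta>" "\<theta> < 1" and \<theta>q: "real m + ?q * \<theta> = s"
    using s by (auto simp: \<theta>_def interp_exponent_def field_simps)
  define \<kappa> where "\<kappa> = 1 / (2 - 2 * \<theta>) + 1 / (2 * \<theta>)"
  have \<kappa>: "\<kappa> > 0" using \<theta> unfolding \<kappa>_def by (intro add_pos_pos) auto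
  obtain C where C: "C > 0"
    "\<And>t u. t > 0 \<Longrightarrow> u \<in> sobolev_space a b m \<Longrightarrow> (K_functional a b m n t u)\<^sup>2 \<le> C * K_sum a b m n t u"
    by (rule K_functional_upper[OF ab mn]) (rule that)
  obtain M where M: "M > 0"
    "\<And>t u. t > 0 \<Longrightarrow> u \<in> sobolev_space a b m \<Longrightarrow> K_sum a b m n t u \<le> M * (K_functional a b m n t u)\<^sup>2"
    by (rule K_functional_lower[OF ab mn]) (rule that)
  define g where "g u t = indicat_real {0<..} t * (t powr (- 2 * \<theta>) * (K_functional a b m n t u)\<^sup>2 / t)" for u t
  define h where "h u t = indicat_real {0<..} t * (t powr (- 2 * \<theta>) * K_sum a b m n t u / t)" for u t
  let ?G = "\<lambda>u. \<integral>\<^sup>+t. ennreal (g u t) \<partial>lborel" and ?H = "\<lambda>u. \<integral>\<^sup>+t. ennreal (h u t) \<partial>lborel"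
  have g_nonneg: "0 \<le> g u t" for u t by (auto simp: g_def indicator_def)
  have g_meas: "g u \<in> borel_measurable borel" for u
  proof -
    \<comment> \<open>Measurability in \<open>t\<close> comes from monotonicity.\<close>
    define K where "K t = (if t > 0 then K_functional a b m n t u else 0)" for t
    have "mono K"
      using K_functional_mono[OF ab] K_functional_nonneg[OF ab] by (auto simp: mono_def K_def)
    then have [measurable]: "K \<in> borel_measurable borel" by (rule borel_measurable_mono)
    have "g u = (\<lambda>t. indicat_real {0<..} t * (t powr (- 2 * \<theta>) * (K t)\<^sup>2 / t))"
      by (auto simp: g_def K_def fun_eq_iff indicator_def)
    then show ?thesis by simp
  qed
  have h_int: "?H u = (\<Sum>j. ennreal (\<kappa> * (freq j powr s * (jacobi_coeff a b u j)\<^sup>2)))"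
    if u: "u \<in> sobolev_space a b m" for u
  proof -
    let ?A = "\<lambda>j. freq j powr real m * (jacobi_coeff a b u j)\<^sup>2"
    let ?k = "\<lambda>j t. indicat_real {0<..} t * (t powr (- 2 * \<theta>) * min 1 (t\<^sup>2 * freq j powr ?q) / t)"
    have uH: "u \<in> H_jacobi_space a b (real m)" using u by (simp add: sobolev_space_eq_jacobi[OF ab])
    have k_nonneg: "0 \<le> ?k j t" for j t by (auto simp: indicator_def)
    have "ennreal (h u t) = (\<Sum>j. ennreal (?A j) * ennreal (?k j t))" for t
    proof -
      have "(\<lambda>j. (indicat_real {0<..} t * (t powr (- 2 * \<theta>) / t)) *
          (freq j powr real m * min 1 (t\<^sup>2 * freq j powr ?q) * (jacobi_coeff a b u j)\<^sup>2))
          sums ((indicat_real {0<..} t * (t powr (- 2 * \<theta>) / t)) * K_sum a b m n t u)"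
        by (intro sums_mult K_sum_sums[OF uH])
      then have "(\<lambda>j. ?A j * ?k j t) sums h u t" by (simp add: h_def mult_ac)
      then have "ennreal (h u t) = (\<Sum>j. ennreal (?A j * ?k j t))"
        by (intro suminf_ennreal_eq[symmetric] mult_nonneg_nonneg[OF _ k_nonneg]) auto
      also have "(\<lambda>j. ennreal (?A j * ?k j t)) = (\<lambda>j. ennreal (?A j) * ennreal (?k j t))"
        by (rule ext, rule ennreal_mult[OF _ k_nonneg]) auto
      finally show ?thesis .
    qed
    then have "?H u = (\<integral>\<^sup>+t. (\<Sum>j. ennreal (?A j) * ennreal (?k j t)) \<partial>lborel)"
      by simp
    also have "\<dots> = (\<Sum>j. \<integral>\<^sup>+t. ennreal (?A j) * ennreal (?k j t) \<partial>lborel)"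
      by (rule nn_integral_suminf) measurable
    also have "\<dots> = (\<Sum>j. ennreal (\<kappa> * (freq j powr s * (jacobi_coeff a b u j)\<^sup>2)))"
    proof (rule arg_cong[of _ _ suminf], rule ext)
      fix j
      have "(\<integral>\<^sup>+t. ennreal (?A j) * ennreal (?k j t) \<partial>lborel) = ennreal (?A j) * (\<integral>\<^sup>+t. ennreal (?k j t) \<partial>lborel)"
        by (rule nn_integral_cmult) measurable
      also have "(\<integral>\<^sup>+t. ennreal (?k j t) \<partial>lborel) = ennreal (\<kappa> * (freq j powr ?q) powr \<theta>)"
        unfolding \<kappa>_def by (rule interpolation_kernel_integral[OF \<theta>]) (use add_pos_nonneg[of 1 "(real j)\<^sup>2"] in simp)
      also have "ennreal (?A j) * \<dots> = ennreal (?A j * (\<kappa> * (freq j powr ?q) powr \<theta>))"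
        using \<kappa> by (simp add: ennreal_mult)
      also have "?A j * (\<kappa> * (freq j powr ?q) powr \<theta>) = \<kappa> * ((freq j powr real m * freq j powr (?q * \<theta>)) * (jacobi_coeff a b u j)\<^sup>2)"
        by (simp add: powr_powr)
      also have "freq j powr real m * freq j powr (?q * \<theta>) = freq j powr s"
        by (simp only: powr_add[symmetric] \<theta>q)
      finally show "(\<integral>\<^sup>+t. ennreal (?A j) * ennreal (?k j t) \<partial>lborel) = ennreal (\<kappa> * (freq j powr s * (jacobi_coeff a b u j)\<^sup>2))" .
    qed
    finally show ?thesis .
  qed
  have g_upper: "?G u \<le> ennreal C * ?H u"
    and g_lower: "?H u \<le> ennreal M * ?G u"
    if u: "u \<in> sobolev_space a b m" for u
  proof -
    have gh: "g u t \<le> C * h u t" "h u t \<le> M * g u t" for t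
    proof -
      have "t powr (- 2 * \<theta>) / t * (K_functional a b m n t u)\<^sup>2 \<le> t powr (- 2 * \<theta>) / t * (C * K_sum a b m n t u)"
        "t powr (- 2 * \<theta>) / t * K_sum a b m n t u \<le> t powr (- 2 * \<theta>) / t * (M * (K_functional a b m n t u)\<^sup>2)" if "t > 0"
        using that C(2)[OF that u] M(2)[OF that u] by (intro mult_left_mono; simp)+
      then show "g u t \<le> C * h u t" "h u t \<le> M * g u t"
        by (cases "t > 0"; simp add: g_def h_def mult_ac)+
    qed
    have meas: "(\<lambda>t. ennreal (g u t)) \<in> borel_measurable lborel" using g_meas by simp
    have h_nonneg: "0 \<le> h u t" for t
      using order_trans[OF g_nonneg gh(1)] C(1) by (simp add: zero_le_mult_iff)
    have h_meas: "h u \<in> borel_measurable borel"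
    proof -
      have [measurable]: "(\<lambda>t. K_sum a b m n t u) \<in> borel_measurable borel"
        unfolding K_sum_def by measurable
      show ?thesis unfolding h_def[abs_def] by measurable
    qed
    have "?G u \<le> (\<integral>\<^sup>+t. ennreal C * ennreal (h u t) \<partial>lborel)"
      using gh C(1) h_nonneg by (intro nn_integral_mono) (simp add: ennreal_mult[symmetric] ennreal_leI)
    also have "\<dots> = ennreal C * ?H u"
      using h_meas by (intro nn_integral_cmult) simp
    finally show "?G u \<le> ennreal C * ?H u" .
    have "?H u \<le> (\<integral>\<^sup>+t. ennreal M * ennreal (g u t) \<partial>lborel)"
      using gh M(1) g_nonneg by (intro nn_integral_mono) (simp add: ennreal_mult[symmetric] ennreal_leI)
    also have "\<dots> = ennreal M * ?G u"
      by (rule nn_integral_cmult[OF meas])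
    finally show "?H u \<le> ennreal M * ?G u" .
  qed
  have integrable_iff: "set_integrable lebesgue {0<..} (\<lambda>t. t powr (- 2 * interp_exponent m n s) * (K_functional a b m n t u)\<^sup>2 / t)
      \<longleftrightarrow> ?G u < \<infinity>" for u
  proof -
    have "set_integrable lebesgue {0<..} (\<lambda>t. t powr (- 2 * interp_exponent m n s) * (K_functional a b m n t u)\<^sup>2 / t)
        \<longleftrightarrow> integrable lebesgue (g u)"
      by (simp add: set_integrable_def g_def[abs_def] \<theta>_def)
    also have "\<dots> \<longleftrightarrow> integrable lborel (g u)"
      using g_meas by (intro integrable_completion) simp
    also have "\<dots> \<longleftrightarrow> ?G u < \<infinity>"
      using g_meas g_nonneg by (simp add: integrable_iff_bounded)
    finally show ?thesis .
  qed
  have norm_sq: "(interp_norm a b m n s u)\<^sup>2 = enn2real (?G u)" for u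
  proof -
    have "(LINT t:{0<..}|lebesgue. t powr (- 2 * interp_exponent m n s) * (K_functional a b m n t u)\<^sup>2 / t)
        = integral\<^sup>L lebesgue (g u)"
      by (simp add: set_lebesgue_integral_def g_def[abs_def] \<theta>_def)
    also have "\<dots> = integral\<^sup>L lborel (g u)"
      using g_meas by (intro integral_completion) simp
    also have "\<dots> = enn2real (?G u)"
      using g_meas g_nonneg by (intro integral_eq_nn_integral) auto
    finally show ?thesis by (simp add: interp_norm_def)
  qed
  have sub: "H_jacobi_space a b s \<subseteq> sobolev_space a b m"
    unfolding sobolev_space_eq_jacobi[OF ab] using s by (intro H_jacobi_space_antimono) simp
  have h_sum: "?H u = ennreal (\<kappa> * jacobi_sum a b s u)"
    if u: "u \<in> H_jacobi_space a b s" for u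
    unfolding h_int[OF subsetD[OF sub u]]
    by (rule suminf_ennreal_eq[OF _ sums_mult[OF jacobi_sum_sums[OF u]]]) (use \<kappa> in simp)
  have g_fin: "?G u < \<infinity>" if u: "u \<in> H_jacobi_space a b s" for u
  proof (rule le_less_trans[OF g_upper[OF subsetD[OF sub u]]])
    show "ennreal C * ?H u < \<infinity>"
      unfolding h_sum[OF u] by (simp add: ennreal_mult_less_top)
  qed
  show "interp_space a b m n s = H_jacobi_space a b s"
  proof (intro equalityI subsetI)
    fix u assume "u \<in> interp_space a b m n s"
    then have u: "u \<in> sobolev_space a b m" and fin: "?G u < \<infinity>"
      unfolding interp_space_def integrable_iff by auto
    have "ennreal M * ?G u < top"
      using fin by (simp add: ennreal_mult_less_top)
    then have "(\<Sum>j. ennreal (\<kappa> * (freq j powr s * (jacobi_coeff a b u j)\<^sup>2))) < top"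
      using g_lower[OF u] unfolding h_int[OF u] by (rule le_less_trans[rotated])
    then have "(\<Sum>j. ennreal (\<kappa> * (freq j powr s * (jacobi_coeff a b u j)\<^sup>2))) \<noteq> top" by simp
    then have "summable (\<lambda>j. \<kappa> * (freq j powr s * (jacobi_coeff a b u j)\<^sup>2))"
      using \<kappa> by (intro summable_suminf_not_top) auto
    then have "summable (\<lambda>j. freq j powr s * (jacobi_coeff a b u j)\<^sup>2)"
      using \<kappa> by (simp add: summable_cmult_iff)
    then show "u \<in> H_jacobi_space a b s"
      using u unfolding sobolev_space_eq_jacobi[OF ab] H_jacobi_space_iff by blast
  next
    fix u assume "u \<in> H_jacobi_space a b s"
    then show "u \<in> interp_space a b m n s"
      using sub g_fin unfolding interp_space_def integrable_iff by blast
  qed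
  show "\<exists>c>0. \<exists>C>0. \<forall>u\<in>H_jacobi_space a b s.
      c * jacobi_sum a b s u \<le> (interp_norm a b m n s u)\<^sup>2 \<and> (interp_norm a b m n s u)\<^sup>2 \<le> C * jacobi_sum a b s u"
  proof (intro exI conjI ballI)
    show "\<kappa> / M > 0" "C * \<kappa> > 0" using \<kappa> C(1) M(1) by auto
    fix u assume u: "u \<in> H_jacobi_space a b s"
    obtain r where r: "r \<ge> 0" "?G u = ennreal r"
      using g_fin[OF u] by (cases "?G u") auto
    have nonneg: "0 \<le> \<kappa> * jacobi_sum a b s u" using \<kappa> jacobi_sum_nonneg[OF u] by simp
    have "ennreal r \<le> ennreal C * ennreal (\<kappa> * jacobi_sum a b s u)"
      "ennreal (\<kappa> * jacobi_sum a b s u) \<le> ennreal M * ennreal r"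
      using g_upper[OF subsetD[OF sub u]] g_lower[OF subsetD[OF sub u]] unfolding h_sum[OF u] r(2) by auto
    then have "r \<le> C * (\<kappa> * jacobi_sum a b s u)" "\<kappa> * jacobi_sum a b s u \<le> M * r"
      using C(1) M(1) r(1) nonneg by (simp_all add: ennreal_mult[symmetric])
    then show "\<kappa> / M * jacobi_sum a b s u \<le> (interp_norm a b m n s u)\<^sup>2"
      "(interp_norm a b m n s u)\<^sup>2 \<le> C * \<kappa> * jacobi_sum a b s u"
      unfolding norm_sq r(2) using r(1) M(1) by (simp_all add: field_simps)
  qed
qed

section \<open>Equivalence of the norms and duality\<close>

lemma norms_equivalent_onI_square:
  assumes "c > 0" "C > 0" "\<And>u. u \<in> V \<Longrightarrow> 0 \<le> N u"
    and "\<And>u. u \<in> V \<Longrightarrow> c * S u \<le> (N u)\<^sup>2" "\<And>u. u \<in> V \<Longrightarrow> (N u)\<^sup>2 \<le> C * S u"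
  shows "norms_equivalent_on V (\<lambda>u. sqrt (S u)) N"
  unfolding norms_equivalent_on_def
proof (intro exI conjI ballI)
  show "sqrt c > 0" "sqrt C > 0" using assms by auto
  fix u assume u: "u \<in> V"
  have "sqrt (c * S u) \<le> sqrt ((N u)\<^sup>2)" "sqrt ((N u)\<^sup>2) \<le> sqrt (C * S u)"
    using assms(4,5)[OF u] by (auto simp del: real_sqrt_abs)
  then show "sqrt c * sqrt (S u) \<le> N u" "N u \<le> sqrt C * sqrt (S u)"
    using assms(3)[OF u] by (simp_all add: real_sqrt_mult)
qed

lemma H_rho_nonneg_order:
  assumes ab: "a > -1" "b > -1" and s: "s \<ge> 0"
    and mn: "s \<notin> \<int> \<Longrightarrow> real m < s \<and> s < real n"
  shows "H_rho_space a b m n s = H_jacobi_space a b s"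
    and "norms_equivalent_on (H_jacobi_space a b s) (H_jacobi_norm a b s) (H_rho_norm a b m n s)"
proof -
  have norm: "H_jacobi_norm a b s = (\<lambda>u. sqrt (jacobi_sum a b s u))"
    by (rule ext) (rule H_jacobi_norm_sqrt)
  have *: "H_rho_space a b m n s = H_jacobi_space a b s \<and>
    norms_equivalent_on (H_jacobi_space a b s) (H_jacobi_norm a b s) (H_rho_norm a b m n s)"
  proof (cases "s \<in> \<int>")
    case True
    then obtain k where k: "s = real k" using s by (metis Ints_cases nonneg_int_cases of_int_0_le_iff of_int_of_nat_eq)
    then have floor: "nat \<lfloor>s\<rfloor> = k" by simp
    obtain c C where cC: "c > 0" "C > 0"
      "\<And>v. v \<in> sobolev_space a b k \<Longrightarrow> c * jacobi_sum a b (real k) v \<le> (sobolev_norm a b k v)\<^sup>2"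
      "\<And>v. v \<in> sobolev_space a b k \<Longrightarrow> (sobolev_norm a b k v)\<^sup>2 \<le> C * jacobi_sum a b (real k) v"
      by (rule sobolev_norm_equivalent[OF ab, of k]) (rule that)
    have "norms_equivalent_on (H_jacobi_space a b s) (\<lambda>u. sqrt (jacobi_sum a b s u)) (sobolev_norm a b k)"
      unfolding k sobolev_space_eq_jacobi[OF ab, symmetric]
      by (rule norms_equivalent_onI_square[OF cC(1,2) sobolev_norm_nonneg cC(3,4)])
    then show ?thesis
      using True unfolding H_rho_space_def H_rho_norm_def floor norm
      by (simp add: sobolev_space_eq_jacobi[OF ab] k)
  next
    case False
    then have s': "real m < s" "s < real n" using mn by auto
    obtain c C where cC: "c > 0" "C > 0" "\<And>u. u \<in> H_jacobi_space a b s \<Longrightarrow> c * jacobi_sum a b s u \<le> (interp_norm a b m n s u)\<^sup>2"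
      "\<And>u. u \<in> H_jacobi_space a b s \<Longrightarrow> (interp_norm a b m n s u)\<^sup>2 \<le> C * jacobi_sum a b s u"
      using interp_space_eq_jacobi(2)[OF ab s'] by blast
    have "0 \<le> interp_norm a b m n s u" for u
      unfolding interp_norm_def set_lebesgue_integral_def
      by (intro real_sqrt_ge_zero integral_nonneg_AE AE_I2) (auto simp: indicator_def)
    then have "norms_equivalent_on (H_jacobi_space a b s) (\<lambda>u. sqrt (jacobi_sum a b s u)) (interp_norm a b m n s)"
      by (intro norms_equivalent_onI_square[OF cC(1,2) _ cC(3,4)])
    then show ?thesis
      using False interp_space_eq_jacobi(1)[OF ab s'] unfolding H_rho_space_def H_rho_norm_def norm by simp
  qed
  then show "H_rho_space a b m n s = H_jacobi_space a b s"
    "norms_equivalent_on (H_jacobi_space a b s) (H_jacobi_norm a b s) (H_rho_norm a b m n s)" by auto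
qed

lemma dual_space_equivalent_norm:
  assumes eq: "norms_equivalent_on V N1 N2" and nonneg: "\<And>u. u \<in> V \<Longrightarrow> 0 \<le> N1 u"
  shows "dual_space V N1 = dual_space V N2"
proof -
  obtain c C where cC: "c > 0" "C > 0" "\<And>u. u \<in> V \<Longrightarrow> c * N1 u \<le> N2 u" "\<And>u. u \<in> V \<Longrightarrow> N2 u \<le> C * N1 u"
    using eq unfolding norms_equivalent_on_def by blast
  have "(\<exists>B. \<forall>u\<in>V. \<bar>F u\<bar> \<le> B * N1 u) \<longleftrightarrow> (\<exists>B. \<forall>u\<in>V. \<bar>F u\<bar> \<le> B * N2 u)" for F :: "(real \<Rightarrow> real) \<Rightarrow> real"
  proof
    assume "\<exists>B. \<forall>u\<in>V. \<bar>F u\<bar> \<le> B * N1 u"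
    then obtain B where B: "\<And>u. u \<in> V \<Longrightarrow> \<bar>F u\<bar> \<le> B * N1 u" by blast
    have "\<bar>F u\<bar> \<le> (\<bar>B\<bar> / c) * N2 u" if u: "u \<in> V" for u
    proof -
      have "\<bar>F u\<bar> \<le> \<bar>B\<bar> * N1 u"
        using B[OF u] mult_right_mono[OF abs_ge_self[of B] nonneg[OF u]] by linarith
      also have "\<dots> = (\<bar>B\<bar> / c) * (c * N1 u)" using cC(1) by simp
      also have "\<dots> \<le> (\<bar>B\<bar> / c) * N2 u" using cC(1) cC(3)[OF u] by (intro mult_left_mono) auto
      finally show ?thesis .
    qed
    then show "\<exists>B. \<forall>u\<in>V. \<bar>F u\<bar> \<le> B * N2 u" by blast
  next
    assume "\<exists>B. \<forall>u\<in>V. \<bar>F u\<bar> \<le> B * N2 u"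
    then obtain B where B: "\<And>u. u \<in> V \<Longrightarrow> \<bar>F u\<bar> \<le> B * N2 u" by blast
    have "\<bar>F u\<bar> \<le> (\<bar>B\<bar> * C) * N1 u" if u: "u \<in> V" for u
    proof -
      have "0 \<le> c * N1 u" using cC(1) nonneg[OF u] by simp
      then have "0 \<le> N2 u" using cC(3)[OF u] by linarith
      then have "\<bar>F u\<bar> \<le> \<bar>B\<bar> * N2 u"
        using B[OF u] mult_right_mono[OF abs_ge_self[of B]] by fastforce
      also have "\<dots> \<le> \<bar>B\<bar> * (C * N1 u)" using cC(4)[OF u] by (intro mult_left_mono) auto
      finally show ?thesis by (simp add: mult.assoc)
    qed
    then show "\<exists>B. \<forall>u\<in>V. \<bar>F u\<bar> \<le> B * N1 u" by blast
  qed
  then show ?thesis unfolding dual_space_def by simp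
qed

lemma dual_norm_mono:
  assumes F: "F \<in> dual_space V N2" and k: "k > 0"
    and nonneg: "\<And>u. u \<in> V \<Longrightarrow> 0 \<le> N2 u" and zero: "\<exists>u\<in>V. N1 u \<le> 1"
    and scale: "\<And>u. u \<in> V \<Longrightarrow> N1 u \<le> 1 \<Longrightarrow> (\<lambda>x. k * u x) \<in> V \<and> N2 (\<lambda>x. k * u x) \<le> 1"
  shows "k * dual_norm V N1 F \<le> dual_norm V N2 F"
proof -
  obtain B where B: "\<And>u. u \<in> V \<Longrightarrow> \<bar>F u\<bar> \<le> B * N2 u" and hom: "\<And>c u. u \<in> V \<Longrightarrow> F (\<lambda>x. c * u x) = c * F u"
    using F unfolding dual_space_def by blast
  have bdd: "bdd_above ((\<lambda>u. \<bar>F u\<bar>) ` {u \<in> V. N2 u \<le> 1})"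
  proof (rule bdd_aboveI2)
    fix u assume "u \<in> {u \<in> V. N2 u \<le> 1}"
    then have u: "u \<in> V" "N2 u \<le> 1" by auto
    have "\<bar>F u\<bar> \<le> B * N2 u" by (rule B[OF u(1)])
    also have "\<dots> \<le> \<bar>B\<bar> * 1" using nonneg[OF u(1)] u by (intro mult_mono) auto
    finally show "\<bar>F u\<bar> \<le> \<bar>B\<bar>" by simp
  qed
  have "dual_norm V N1 F \<le> dual_norm V N2 F / k"
    unfolding dual_norm_def[of V N1]
  proof (rule cSUP_least)
    show "{u \<in> V. N1 u \<le> 1} \<noteq> {}" using zero by blast
    fix u assume "u \<in> {u \<in> V. N1 u \<le> 1}"
    then have u: "u \<in> V" "N1 u \<le> 1" by auto
    have "\<bar>F (\<lambda>x. k * u x)\<bar> \<le> dual_norm V N2 F"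
      unfolding dual_norm_def using scale[OF u] by (intro cSUP_upper[OF _ bdd]) auto
    then show "\<bar>F u\<bar> \<le> dual_norm V N2 F / k"
      using k by (simp add: hom[OF u(1)] abs_mult field_simps)
  qed
  then show ?thesis using k by (simp add: field_simps)
qed

text \<open>Dilating the unit ball of one norm puts it inside the unit ball of the other. Homogeneity is
  asked of \<open>N1\<close>, for which the norm given by the coefficients will be taken, where it is immediate.\<close>

lemma dual_norm_equivalent:
  assumes eq: "norms_equivalent_on V N1 N2" and nonneg: "\<And>u. u \<in> V \<Longrightarrow> 0 \<le> N1 u"
    and ne: "V \<noteq> {}"
    and scale: "\<And>c u. u \<in> V \<Longrightarrow> (\<lambda>x. c * u x) \<in> V"
    and hom: "\<And>c u. u \<in> V \<Longrightarrow> N1 (\<lambda>x. c * u x) = \<bar>c\<bar> * N1 u"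
  shows "norms_equivalent_on (dual_space V N1) (dual_norm V N1) (dual_norm V N2)"
proof -
  obtain c C where cC: "c > 0" "C > 0" "\<And>u. u \<in> V \<Longrightarrow> c * N1 u \<le> N2 u" "\<And>u. u \<in> V \<Longrightarrow> N2 u \<le> C * N1 u"
    using eq unfolding norms_equivalent_on_def by blast
  have nonneg2: "0 \<le> N2 u" if "u \<in> V" for u
    using cC(3)[OF that] mult_nonneg_nonneg[of c "N1 u"] cC(1) nonneg[OF that] by linarith
  obtain u where u: "u \<in> V" using ne by blast
  have z: "(\<lambda>x. 0 * u x) \<in> V" "N1 (\<lambda>x. 0 * u x) = 0"
    using scale[OF u, of 0] hom[OF u, of 0] by auto
  have zero1: "\<exists>u\<in>V. N1 u \<le> 1" using z by (intro bexI[of _ "\<lambda>x. 0 * u x"]) auto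
  have zero2: "\<exists>u\<in>V. N2 u \<le> 1" using z cC(4)[OF z(1)] by (intro bexI[of _ "\<lambda>x. 0 * u x"]) auto
  show ?thesis
    unfolding norms_equivalent_on_def
  proof (intro exI conjI ballI)
    show "1 / C > 0" "1 / c > 0" using cC by auto
    fix F assume F: "F \<in> dual_space V N1"
    then have F2: "F \<in> dual_space V N2" using dual_space_equivalent_norm[OF eq nonneg] by simp
    show "1 / C * dual_norm V N1 F \<le> dual_norm V N2 F"
    proof (rule dual_norm_mono[OF F2 _ nonneg2 zero1])
      fix u assume u: "u \<in> V" "N1 u \<le> 1"
      have "N2 (\<lambda>x. 1 / C * u x) \<le> C * N1 (\<lambda>x. 1 / C * u x)" by (rule cC(4)[OF scale[OF u(1)]])
      also have "\<dots> = N1 u" unfolding hom[OF u(1)] using cC(2) by simp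
      finally show "(\<lambda>x. 1 / C * u x) \<in> V \<and> N2 (\<lambda>x. 1 / C * u x) \<le> 1"
        using scale[OF u(1), of "1 / C"] u(2) by auto
    qed (use cC in auto)
    have "c * dual_norm V N2 F \<le> dual_norm V N1 F"
    proof (rule dual_norm_mono[OF F cC(1) nonneg zero2])
      fix u assume u: "u \<in> V" "N2 u \<le> 1"
      have "N1 (\<lambda>x. c * u x) = c * N1 u" unfolding hom[OF u(1)] using cC(1) by simp
      also have "\<dots> \<le> N2 u" by (rule cC(3)[OF u(1)])
      finally show "(\<lambda>x. c * u x) \<in> V \<and> N1 (\<lambda>x. c * u x) \<le> 1"
        using scale[OF u(1), of c] u(2) by auto
    qed
    then show "dual_norm V N2 F \<le> 1 / c * dual_norm V N1 F" using cC(1) by (simp add: field_simps)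
  qed
qed

theorem theorem1:
  fixes a b s :: real and m n :: nat
  assumes "a > -1" and "b > -1"
    and "s \<notin> \<int> \<Longrightarrow> real m < \<bar>s\<bar> \<and> \<bar>s\<bar> < real n"
  shows "(s \<ge> 0 \<longrightarrow>
            H_jacobi_space a b s = H_rho_space a b m n s \<and>
            norms_equivalent_on (H_jacobi_space a b s) (H_jacobi_norm a b s) (H_rho_norm a b m n s)) \<and>
         (s < 0 \<longrightarrow>
            H_jacobi_neg_space a b (- s) = H_rho_neg_space a b m n (- s) \<and>
            norms_equivalent_on (H_jacobi_neg_space a b (- s))
              (H_jacobi_neg_norm a b (- s)) (H_rho_neg_norm a b m n (- s)))"
proof (intro conjI impI)
  assume "s \<ge> 0"
  then have "s \<notin> \<int> \<Longrightarrow> real m < s \<and> s < real n" using assms(3) by simp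
  from H_rho_nonneg_order[OF assms(1,2) \<open>s \<ge> 0\<close> this]
  show "H_jacobi_space a b s = H_rho_space a b m n s"
    "norms_equivalent_on (H_jacobi_space a b s) (H_jacobi_norm a b s) (H_rho_norm a b m n s)" by auto
next
  assume "s < 0"
  let ?r = "- s" and ?V = "H_jacobi_space a b (- s)"
  have r: "?r \<ge> 0" using \<open>s < 0\<close> by simp
  have "?r \<notin> \<int> \<Longrightarrow> real m < ?r \<and> ?r < real n" using assms(3) \<open>s < 0\<close> by simp
  from H_rho_nonneg_order[OF assms(1,2) r this]
  have space: "H_rho_space a b m n ?r = ?V"
    and eq: "norms_equivalent_on ?V (H_jacobi_norm a b ?r) (H_rho_norm a b m n ?r)" by auto
  have nonneg: "0 \<le> H_jacobi_norm a b ?r u" if "u \<in> ?V" for u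
    using jacobi_sum_nonneg[OF that] by (simp add: H_jacobi_norm_sqrt)
  \<comment> \<open>Spaces of larger integer order are contained in this one and known to be nonempty.\<close>
  obtain k where k: "?r \<le> real k" using real_arch_simple by blast
  have ne: "?V \<noteq> {}"
    using sobolev_space_nonempty[OF assms(1,2), of k] H_jacobi_space_antimono[OF k, of a b]
    unfolding sobolev_space_eq_jacobi[OF assms(1,2)] by blast
  show "H_jacobi_neg_space a b ?r = H_rho_neg_space a b m n ?r"
    unfolding H_jacobi_neg_space_def H_rho_neg_space_def space
    by (rule dual_space_equivalent_norm[OF eq nonneg])
  have "H_jacobi_neg_norm a b ?r = dual_norm ?V (H_jacobi_norm a b ?r)"
    "H_rho_neg_norm a b m n ?r = dual_norm ?V (H_rho_norm a b m n ?r)"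
    by (simp_all add: H_jacobi_neg_norm_def H_rho_neg_norm_def space fun_eq_iff)
  then show "norms_equivalent_on (H_jacobi_neg_space a b ?r) (H_jacobi_neg_norm a b ?r) (H_rho_neg_norm a b m n ?r)"
    using dual_norm_equivalent[OF eq nonneg ne H_jacobi_space_cmult H_jacobi_norm_cmult]
    unfolding H_jacobi_neg_space_def by simp
qed

end
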